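(* Let $n\ge3$. There are no nonzero odd scalar conformal invariants (in dimension $n$) of weight $w$ with $-w<n$. There are no nonzero odd Weyl invariants of weight $w$ with $-w<n+1$.
   Context: Scalar invariants. A scalar invariant $I(g)$ of metrics of signature $(p,q)$, $p+q=n$, is a polynomial in the variables $(\partial^\alpha g_{ij})_{|\alpha|\ge0}$ and $|\det g_{ij}|^{-1/2}$ whose value is independent of orientation-preserving changes of the coordinates used to express and differentiate $g$. It is even if also unchanged under orientation-reversing changes of coordinates, odd if it changes sign under them. It is a scalar conformal invariant of weight $w$ if $I(\Omega^2g)=\Omega^wI(g)$ for all smooth positive functions $\Omega$. Ambient metrics. For a conformal class $[g]$ of signature $(p,q)$ on $M$: $\mathcal G=\{(h,x): x\in M,\ h=s^2g_x,\ s>0\}$, $\pi(h,x)=x$, $\delta_s(h,x)=(s^2h,x)$, $T=\frac{d}{ds}\delta_s|_{s=1}$, $\mathbf g_0(X,Y)=h(\pi_*X,\pi_*Y)$ on $T_{(h,x)}\mathcal G$; $\delta_s$, $T$ extend to $\mathcal G\times\mathbb R$ acting in the first factor; $\rho$ is the coordinate on $\mathbb R$; $\iota(z)=(z,0)$. An ambient metric is a smooth metric $\tilde g$ of signature $(p+1,q+1)$ on a dilation-invariant open neighborhood $\tilde{\mathcal G}$ of $\mathcal G\times\{0\}$ with $\delta_s^*\tilde g=s^2\tilde g$, $\iota^*\tilde g=\mathbf g_0$, and $\operatorname{Ric}(\tilde g)$ vanishing to infinite order at $\rho=0$ if $n$ is odd, $\operatorname{Ric}(\tilde g)=O^+_{IJ}(\rho^{n/2-1})$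 if $n\ge4$ is even, where $S=O^+_{IJ}(\rho^m)$ means $S=O(\rho^m)$ and for each $z\in\mathcal G$, $(\iota^*(\rho^{-m}S))(z)=\pi^*s$ with $s$ a symmetric 2-tensor at $\pi(z)$ trace-free with respect to $g$. It is straight if $\tilde\nabla T=\mathrm{Id}$. Straight ambient metrics exist. Weyl invariants. Let $\tilde R$ be the curvature tensor of a straight ambient metric, $\tilde\nabla$ its Levi-Civita connection, $\tilde\mu$ its volume form with respect to the orientation on $\tilde{\mathcal G}$ induced by an orientation of $M$, $\tilde\mu_0=T\lrcorner\tilde\mu$. Consider complete contractions with respect to $\tilde g$: (i) $\operatorname{contr}(\tilde\nabla^{r_1}\tilde R\otimes\cdots\otimes\tilde\nabla^{r_L}\tilde R)$, (ii) $\operatorname{contr}(\tilde\mu\otimes\tilde\nabla^{r_1}\tilde R\otimes\cdots\otimes\tilde\nabla^{r_L}\tilde R)$, (iii) $\operatorname{contr}(\tilde\mu_0\otimes\tilde\nabla^{r_1}\tilde R\otimes\cdots\otimes\tilde\nabla^{r_L}\tilde R)$. Restricting to $\mathcal G$ and composing with the section $x\mapsto(g_x,x)$ gives scalar conformal invariants of weight $w$, where $-w=2L+\sum r_i$ for (i), (ii) and $-w=2L+\sum r_i-1$ for (iii); (i) is even, (ii), (iii) are odd; when $n$ is even this is asserted (and the contractions are considered) only under the restrictions $L\ge2$ and $-w\le n+2$ for (i), and $-w\le2n-2$ for (ii), (iii). A Weyl (conformal) invariant is a linear combination of such contractions, all of the same weight, satisfying these restrictions if $n$ is even. It is odd if it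 is odd as a scalar invariant. *)

theory Defs
  imports "HOL-Analysis.Analysis" "HOL-Library.Poly_Mapping"
begin

section \<open>Smooth functions and tensors in coordinates\<close>

definition pd :: "'a::finite \<Rightarrow> (real^'a \<Rightarrow> real) \<Rightarrow> real^'a \<Rightarrow> real" where
  "pd k f z = frechet_derivative f (at z) (axis k 1)"

fun pds :: "'a::finite list \<Rightarrow> (real^'a \<Rightarrow> real) \<Rightarrow> real^'a \<Rightarrow> real" where
  "pds [] f = f"
| "pds (k # ks) f = pd k (pds ks f)"

text \<open>Used for open sets only; then this is the usual notion of a \<open>C\<^sup>\<infinity>\<close> function.\<close>

definition smooth_on :: "(real^'a::finite) set \<Rightarrow> (real^'a \<Rightarrow> real) \<Rightarrow> bool" where
  "smooth_on S f \<longleftrightarrow> (\<forall>ks. pds ks f differentiable_on S)"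

definition smooth_map_on :: "(real^'a::finite) set \<Rightarrow> (real^'a \<Rightarrow> real^'b::finite) \<Rightarrow> bool" where
  "smooth_map_on S f \<longleftrightarrow> (\<forall>i. smooth_on S (\<lambda>z. f z $ i))"

definition smooth_tensor_on :: "(real^'a::finite) set \<Rightarrow> (real^'a \<Rightarrow> real^'b::finite^'b) \<Rightarrow> bool" where
  "smooth_tensor_on S h \<longleftrightarrow> (\<forall>i j. smooth_on S (\<lambda>z. h z $ i $ j))"

definition pullback ::
  "(real^'a::finite \<Rightarrow> real^'b::finite) \<Rightarrow> (real^'b \<Rightarrow> real^'b^'b) \<Rightarrow> real^'a \<Rightarrow> real^'a^'a" where
  "pullback \<phi> h z = transpose (jacobian \<phi> (at z)) ** h (\<phi> z) ** jacobian \<phi> (at z)"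

text \<open>A symmetric matrix has signature \<open>(p, q)\<close> if some basis diagonalises the associated
  quadratic form with \<open>p\<close> entries \<open>1\<close> and \<open>q\<close> entries \<open>-1\<close>.\<close>

definition has_signature :: "nat \<Rightarrow> nat \<Rightarrow> real^'a::finite^'a \<Rightarrow> bool" where
  "has_signature p q A \<longleftrightarrow> (\<exists>(P :: real^'a^'a) (d :: 'a \<Rightarrow> real). invertible P \<and>
     transpose P ** A ** P = (\<chi> i j. if i = j then d i else 0) \<and>
     (\<forall>i. d i = 1 \<or> d i = -1) \<and> card {i. d i = 1} = p \<and> card {i. d i = -1} = q)"

definition metric_on ::
  "nat \<Rightarrow> nat \<Rightarrow> (real^'a::finite) set \<Rightarrow> (real^'a \<Rightarrow> real^'a^'a) \<Rightarrow> bool" where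
  "metric_on p q U g \<longleftrightarrow> open U \<and> smooth_tensor_on U g \<and>
     (\<forall>x\<in>U. transpose (g x) = g x \<and> has_signature p q (g x))"

definition diffeo :: "(real^'a::finite) set \<Rightarrow> (real^'a) set \<Rightarrow> (real^'a \<Rightarrow> real^'a) \<Rightarrow> bool" where
  "diffeo U V \<phi> \<longleftrightarrow> open U \<and> open V \<and> bij_betw \<phi> U V \<and>
     smooth_map_on U \<phi> \<and> smooth_map_on V (inv_into U \<phi>)"

definition orientation_preserving :: "(real^'a::finite) set \<Rightarrow> (real^'a \<Rightarrow> real^'a) \<Rightarrow> bool" where
  "orientation_preserving U \<phi> \<longleftrightarrow> (\<forall>x\<in>U. det (jacobian \<phi> (at x)) > 0)"

definition orientation_reversing :: "(real^'a::finite) set \<Rightarrow> (real^'a \<Rightarrow> real^'a) \<Rightarrow> bool" where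
  "orientation_reversing U \<phi> \<longleftrightarrow> (\<forall>x\<in>U. det (jacobian \<phi> (at x)) < 0)"


section \<open>Scalar invariants\<close>

text \<open>The variable \<open>Jet ks i j\<close> stands for the iterated partial derivative of \<open>g\<^sub>i\<^sub>j\<close> along
  the coordinate directions listed in \<open>ks\<close>. Lists that are permutations of each other, and
  \<open>(i, j)\<close> and \<open>(j, i)\<close>, give equal values on metrics, so these variables are the
  \<open>\<partial>\<^sup>\<alpha> g\<^sub>i\<^sub>j\<close> with repetitions. \<open>DetVar\<close> stands for \<open>\<bar>det g\<bar>\<close> to the power \<open>-1/2\<close>.\<close>

datatype 'n jet_var = Jet "'n list" 'n 'n | DetVar

type_synonym 'v polynomial = "('v \<Rightarrow>\<^sub>0 nat) \<Rightarrow>\<^sub>0 real"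

definition poly_value :: "'v polynomial \<Rightarrow> ('v \<Rightarrow> real) \<Rightarrow> real" where
  "poly_value P v = (\<Sum>m\<in>Poly_Mapping.keys P. Poly_Mapping.lookup P m *
     (\<Prod>x\<in>Poly_Mapping.keys m. v x ^ Poly_Mapping.lookup m x))"

fun jet_value :: "(real^'n::finite \<Rightarrow> real^'n^'n) \<Rightarrow> real^'n \<Rightarrow> 'n jet_var \<Rightarrow> real" where
  "jet_value g x (Jet ks i j) = pds ks (\<lambda>y. g y $ i $ j) x"
| "jet_value g x DetVar = \<bar>det (g x)\<bar> powr (- (1/2))"

definition inv_value ::
  "('n::finite) jet_var polynomial \<Rightarrow> (real^'n \<Rightarrow> real^'n^'n) \<Rightarrow> real^'n \<Rightarrow> real" where
  "inv_value P g x = poly_value P (jet_value g x)"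

definition scalar_invariant :: "nat \<Rightarrow> nat \<Rightarrow> ('n::finite) jet_var polynomial \<Rightarrow> bool" where
  "scalar_invariant p q P \<longleftrightarrow>
     (\<forall>U V \<phi> g. diffeo U V \<phi> \<longrightarrow> orientation_preserving U \<phi> \<longrightarrow> metric_on p q V g \<longrightarrow>
        (\<forall>x\<in>U. inv_value P (pullback \<phi> g) x = inv_value P g (\<phi> x)))"

definition odd_scalar_invariant :: "nat \<Rightarrow> nat \<Rightarrow> ('n::finite) jet_var polynomial \<Rightarrow> bool" where
  "odd_scalar_invariant p q P \<longleftrightarrow> scalar_invariant p q P \<and>
     (\<forall>U V \<phi> g. diffeo U V \<phi> \<longrightarrow> orientation_reversing U \<phi> \<longrightarrow> metric_on p q V g \<longrightarrow>
        (\<forall>x\<in>U. inv_value P (pullback \<phi> g) x = - inv_value P g (\<phi> x)))"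

definition scalar_conformal_invariant ::
  "nat \<Rightarrow> nat \<Rightarrow> real \<Rightarrow> ('n::finite) jet_var polynomial \<Rightarrow> bool" where
  "scalar_conformal_invariant p q w P \<longleftrightarrow> scalar_invariant p q P \<and>
     (\<forall>U g \<Omega>. metric_on p q U g \<longrightarrow> smooth_on U \<Omega> \<longrightarrow> (\<forall>x\<in>U. \<Omega> x > 0) \<longrightarrow>
        (\<forall>x\<in>U. inv_value P (\<lambda>y. (\<Omega> y)\<^sup>2 *\<^sub>R g y) x = \<Omega> x powr w * inv_value P g x))"


section \<open>Curvature and covariant derivatives\<close>

definition christoffel ::
  "(real^'a::finite \<Rightarrow> real^'a^'a) \<Rightarrow> 'a \<Rightarrow> 'a \<Rightarrow> 'a \<Rightarrow> real^'a \<Rightarrow> real" where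
  "christoffel G k i j z = (\<Sum>l\<in>UNIV. matrix_inv (G z) $ k $ l *
     (pd i (\<lambda>y. G y $ j $ l) z + pd j (\<lambda>y. G y $ i $ l) z - pd l (\<lambda>y. G y $ i $ j) z)) / 2"

text \<open>\<open>riem_up G m j k l\<close> is the \<open>\<partial>\<^sub>m\<close>-component of
  \<open>(\<nabla>\<^sub>k \<nabla>\<^sub>l - \<nabla>\<^sub>l \<nabla>\<^sub>k) \<partial>\<^sub>j\<close>.\<close>

definition riem_up ::
  "(real^'a::finite \<Rightarrow> real^'a^'a) \<Rightarrow> 'a \<Rightarrow> 'a \<Rightarrow> 'a \<Rightarrow> 'a \<Rightarrow> real^'a \<Rightarrow> real" where
  "riem_up G m j k l z =
     pd k (christoffel G m l j) z - pd l (christoffel G m k j) z +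
     (\<Sum>s\<in>UNIV. christoffel G m k s z * christoffel G s l j z
               - christoffel G m l s z * christoffel G s k j z)"

definition ricci :: "(real^'a::finite \<Rightarrow> real^'a^'a) \<Rightarrow> real^'a \<Rightarrow> real^'a^'a" where
  "ricci G z = (\<chi> j l. \<Sum>m\<in>UNIV. riem_up G m j m l z)"

text \<open>A covariant tensor field of rank \<open>m\<close> is given by its components, indexed by lists of
  length \<open>m\<close>; values on lists of another length are irrelevant.\<close>

type_synonym 'a tensor = "'a list \<Rightarrow> real^'a \<Rightarrow> real"

definition riem :: "(real^'a::finite \<Rightarrow> real^'a^'a) \<Rightarrow> 'a tensor" where
  "riem G I z = (\<Sum>m\<in>UNIV. G z $ (I!0) $ m * riem_up G m (I!1) (I!2) (I!3) z)"

text \<open>The differentiation index comes first.\<close>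

definition nabla :: "(real^'a::finite \<Rightarrow> real^'a^'a) \<Rightarrow> 'a tensor \<Rightarrow> 'a tensor" where
  "nabla G S I z = pd (hd I) (S (tl I)) z -
     (\<Sum>k<length (tl I). \<Sum>d\<in>UNIV. christoffel G d (hd I) (tl I ! k) z * S ((tl I)[k := d]) z)"

fun nabla_products :: "(real^'a::finite \<Rightarrow> real^'a^'a) \<Rightarrow> nat list \<Rightarrow> 'a tensor" where
  "nabla_products G [] I z = 1"
| "nabla_products G (r # rs) I z =
     (nabla G ^^ r) (riem G) (take (r + 4) I) z * nabla_products G rs (drop (r + 4) I) z"

text \<open>Volume form with respect to the orientation in which the coordinate frame, ordered as in
  the list \<open>E\<close>, is positive. The determinant is the value of
  \<open>dx\<^bsup>E!0\<^esup> \<and> dx\<^bsup>E!1\<^esup> \<and> \<dots>\<close> on the coordinate vectors with indices \<open>I!0\<close>, \<open>I!1\<close>, \<open>\<dots>\<close>: it is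
  the sign of \<open>I\<close> as a rearrangement of \<open>E\<close>, and zero if \<open>I\<close> has a repetition.\<close>

definition vol_form :: "'a list \<Rightarrow> (real^'a::finite \<Rightarrow> real^'a^'a) \<Rightarrow> 'a tensor" where
  "vol_form E G I z = sqrt \<bar>det (G z)\<bar> *
     det (\<chi> a b. if the (map_of (zip E I) a) = b then 1 else 0)"

definition interior_product :: "(real^'a::finite \<Rightarrow> real^'a) \<Rightarrow> 'a tensor \<Rightarrow> 'a tensor" where
  "interior_product X S I z = (\<Sum>a\<in>UNIV. X z $ a * S (a # I) z)"

text \<open>Complete contraction of a tensor of even rank \<open>m\<close>, in which slot \<open>\<sigma> (2k)\<close> is paired with
  slot \<open>\<sigma> (2k+1)\<close>, for a permutation \<open>\<sigma>\<close> of the slots \<open>{..<m}\<close>.\<close>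

definition contr ::
  "(real^'a::finite \<Rightarrow> real^'a^'a) \<Rightarrow> nat \<Rightarrow> (nat \<Rightarrow> nat) \<Rightarrow> 'a tensor \<Rightarrow> real^'a \<Rightarrow> real" where
  "contr G m \<sigma> S z = (\<Sum>I | length I = m.
     (\<Prod>k<m div 2. matrix_inv (G z) $ (I ! \<sigma> (2*k)) $ (I ! \<sigma> (2*k+1))) * S I z)"


section \<open>Ambient metrics\<close>

text \<open>A metric \<open>g\<close> on an open set \<open>U\<close> of \<open>\<real>\<^sup>n\<close> identifies the metric bundle \<open>\<G>\<close> of its conformal
  class with \<open>{t > 0} \<times> U\<close>, where \<open>(t, x)\<close> corresponds to \<open>(t\<^sup>2 g\<^sub>x, x)\<close>. Coordinates on \<open>\<G>\<close> are
  indexed by \<open>'n option\<close>: \<open>None\<close> for \<open>t\<close> and \<open>Some i\<close> for \<open>x\<^sup>i\<close>. Coordinates on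
  \<open>\<G> \<times> \<real>\<close> are indexed by \<open>'n option option\<close>: \<open>None\<close> for \<open>\<rho>\<close> and \<open>Some a\<close> for the
  coordinates \<open>a\<close> of \<open>\<G>\<close>.\<close>

definition bundle_proj :: "real^('n::finite option) \<Rightarrow> real^'n" where
  "bundle_proj z = (\<chi> i. z $ Some i)"

definition cone :: "(real^'n::finite) set \<Rightarrow> (real^('n option)) set" where
  "cone U = {z. z $ None > 0 \<and> bundle_proj z \<in> U}"

definition unit_section :: "real^'n::finite \<Rightarrow> real^('n option)" where
  "unit_section x = (\<chi> a. case a of None \<Rightarrow> 1 | Some i \<Rightarrow> x $ i)"

text \<open>The tautological tensor \<open>\<g>\<^sub>0\<close>: at the point \<open>(h, x)\<close> with \<open>h = t\<^sup>2 g\<^sub>x\<close> it is \<open>\<pi>\<^sup>*h\<close>.\<close>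

definition tautological ::
  "(real^'n::finite \<Rightarrow> real^'n^'n) \<Rightarrow> real^('n option) \<Rightarrow> real^('n option)^('n option)" where
  "tautological g z = pullback bundle_proj (\<lambda>x. (z $ None)\<^sup>2 *\<^sub>R g x) z"

definition cone_proj :: "real^('n::finite option option) \<Rightarrow> real^('n option)" where
  "cone_proj y = (\<chi> a. y $ Some a)"

definition iota :: "real^('n::finite option) \<Rightarrow> real^('n option option)" where
  "iota z = (\<chi> b. case b of None \<Rightarrow> 0 | Some a \<Rightarrow> z $ a)"

definition dilation :: "real \<Rightarrow> real^('n::finite option option) \<Rightarrow> real^('n option option)" where
  "dilation s y = (\<chi> b. if b = Some None then s * y $ b else y $ b)"

definition T_field :: "real^('n::finite option option) \<Rightarrow> real^('n option option)" where
  "T_field y = vector_derivative (\<lambda>s. dilation s y) (at 1)"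

definition ambient_domain ::
  "(real^'n::finite) set \<Rightarrow> (real^('n option option)) set \<Rightarrow> bool" where
  "ambient_domain U W \<longleftrightarrow> open W \<and> iota ` cone U \<subseteq> W \<and> (\<forall>y\<in>W. cone_proj y \<in> cone U) \<and>
     (\<forall>y\<in>W. \<forall>s>0. dilation s y \<in> W)"

text \<open>\<open>rho_quotient W m S S'\<close>: \<open>S' = \<rho>\<^bsup>-m\<^esup> S\<close> extends smoothly across \<open>\<rho> = 0\<close>, that is,
  \<open>S = O(\<rho>\<^sup>m)\<close>. The extension is unique.\<close>

definition rho_quotient ::
  "(real^('n::finite option option)) set \<Rightarrow> nat \<Rightarrow>
   (real^('n option option) \<Rightarrow> real^('n option option)^('n option option)) \<Rightarrow>
   (real^('n option option) \<Rightarrow> real^('n option option)^('n option option)) \<Rightarrow> bool" where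
  "rho_quotient W m S S' \<longleftrightarrow> smooth_tensor_on W S' \<and> (\<forall>y\<in>W. S y = (y $ None) ^ m *\<^sub>R S' y)"

definition vanishes_infinite_order ::
  "(real^('n::finite option option)) set \<Rightarrow>
   (real^('n option option) \<Rightarrow> real^('n option option)^('n option option)) \<Rightarrow> bool" where
  "vanishes_infinite_order W S \<longleftrightarrow> (\<forall>m. \<exists>S'. rho_quotient W m S S')"

definition O_plus ::
  "(real^'n::finite) set \<Rightarrow> (real^'n \<Rightarrow> real^'n^'n) \<Rightarrow> (real^('n option option)) set \<Rightarrow> nat \<Rightarrow>
   (real^('n option option) \<Rightarrow> real^('n option option)^('n option option)) \<Rightarrow> bool" where
  "O_plus U g W m S \<longleftrightarrow> (\<exists>S'. rho_quotient W m S S' \<and>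
     (\<forall>z\<in>cone U. \<exists>s. transpose s = s \<and> trace (matrix_inv (g (bundle_proj z)) ** s) = 0 \<and>
        pullback iota S' z = pullback bundle_proj (\<lambda>_. s) z))"

definition ambient_metric ::
  "nat \<Rightarrow> nat \<Rightarrow> (real^'n::finite) set \<Rightarrow> (real^'n \<Rightarrow> real^'n^'n) \<Rightarrow>
   (real^('n option option)) set \<Rightarrow>
   (real^('n option option) \<Rightarrow> real^('n option option)^('n option option)) \<Rightarrow> bool" where
  "ambient_metric p q U g W G \<longleftrightarrow>
     ambient_domain U W \<and> metric_on (p + 1) (q + 1) W G \<and>
     (\<forall>s>0. \<forall>y\<in>W. pullback (dilation s) G y = s\<^sup>2 *\<^sub>R G y) \<and>
     (\<forall>z\<in>cone U. pullback iota G z = tautological g z) \<and>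
     (odd CARD('n) \<longrightarrow> vanishes_infinite_order W (ricci G)) \<and>
     (even CARD('n) \<longrightarrow> O_plus U g W (CARD('n) div 2 - 1) (ricci G))"

definition straight ::
  "(real^('n::finite option option)) set \<Rightarrow>
   (real^('n option option) \<Rightarrow> real^('n option option)^('n option option)) \<Rightarrow> bool" where
  "straight W G \<longleftrightarrow> (\<forall>y\<in>W. \<forall>a b. pd a (\<lambda>v. T_field v $ b) y +
     (\<Sum>c\<in>UNIV. christoffel G b a c y * T_field y $ c) = (if a = b then 1 else 0))"

definition straight_ambient_metric ::
  "nat \<Rightarrow> nat \<Rightarrow> (real^'n::finite) set \<Rightarrow> (real^'n \<Rightarrow> real^'n^'n) \<Rightarrow>
   (real^('n option option)) set \<Rightarrow>
   (real^('n option option) \<Rightarrow> real^('n option option)^('n option option)) \<Rightarrow> bool" where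
  "straight_ambient_metric p q U g W G \<longleftrightarrow> ambient_metric p q U g W G \<and> straight W G"


section \<open>Weyl invariants\<close>

text \<open>An orientation of an open set of \<open>\<real>\<^sup>n\<close> is given by an ordering of the coordinates. The
  induced orientation upstairs orders the coordinates as \<open>t\<close>, \<open>x\<close>, \<open>\<rho>\<close>.\<close>

definition coordinate_order :: "'n::finite list \<Rightarrow> bool" where
  "coordinate_order e \<longleftrightarrow> distinct e \<and> set e = UNIV"

definition ambient_order :: "'n list \<Rightarrow> 'n option option list" where
  "ambient_order e = Some None # map (\<lambda>i. Some (Some i)) e @ [None]"

datatype vol_factor = NoVol | AmbVol | AmbVol0

text \<open>A complete contraction of a tensor product of covariant derivatives of curvature, possibly
  with a leading factor \<open>\<mu>\<close> (\<open>AmbVol\<close>) or \<open>T \<rfloor> \<mu>\<close> (\<open>AmbVol0\<close>) for the ambient volume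
  form \<open>\<mu>\<close>; the list \<open>orders\<close> is \<open>[r\<^sub>1, \<dots>, r\<^sub>L]\<close>, and \<open>pairing\<close> is as in \<open>contr\<close>.\<close>

datatype contraction = Contraction (vol: vol_factor) (orders: "nat list") (pairing: "nat \<Rightarrow> nat")

fun vol_rank :: "nat \<Rightarrow> vol_factor \<Rightarrow> nat" where
  "vol_rank n NoVol = 0"
| "vol_rank n AmbVol = n + 2"
| "vol_rank n AmbVol0 = n + 1"

fun vol_tensor :: "'n::finite list \<Rightarrow>
  (real^('n option option) \<Rightarrow> real^('n option option)^('n option option)) \<Rightarrow>
  vol_factor \<Rightarrow> 'n option option tensor" where
  "vol_tensor e G NoVol I z = 1"
| "vol_tensor e G AmbVol I z = vol_form (ambient_order e) G I z"
| "vol_tensor e G AmbVol0 I z = interior_product T_field (vol_form (ambient_order e) G) I z"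

definition total_rank :: "nat \<Rightarrow> contraction \<Rightarrow> nat" where
  "total_rank n c = vol_rank n (vol c) + (\<Sum>r\<leftarrow>orders c. r + 4)"

definition is_contraction :: "nat \<Rightarrow> contraction \<Rightarrow> bool" where
  "is_contraction n c \<longleftrightarrow> orders c \<noteq> [] \<and> even (total_rank n c) \<and> pairing c permutes {..<total_rank n c}"

definition contraction_weight :: "contraction \<Rightarrow> int" where
  "contraction_weight c = - (2 * int (length (orders c)) + int (sum_list (orders c))
     - (if vol c = AmbVol0 then 1 else 0))"

definition admissible :: "nat \<Rightarrow> contraction \<Rightarrow> bool" where
  "admissible n c \<longleftrightarrow> (even n \<longrightarrow>
     (if vol c = NoVol then length (orders c) \<ge> 2 \<and> - contraction_weight c \<le> int n + 2
      else - contraction_weight c \<le> 2 * int n - 2))"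

definition contraction_value :: "'n::finite list \<Rightarrow>
  (real^('n option option) \<Rightarrow> real^('n option option)^('n option option)) \<Rightarrow>
  contraction \<Rightarrow> real^('n option option) \<Rightarrow> real" where
  "contraction_value e G c =
     (let k = vol_rank CARD('n) (vol c) in
      contr G (total_rank CARD('n) c) (pairing c)
        (\<lambda>I z. vol_tensor e G (vol c) (take k I) z * nabla_products G (orders c) (drop k I) z))"

text \<open>A linear combination is a list of contractions with coefficients.\<close>

definition weyl_invariant :: "nat \<Rightarrow> int \<Rightarrow> (real \<times> contraction) list \<Rightarrow> bool" where
  "weyl_invariant n w C \<longleftrightarrow> (\<forall>(a, c)\<in>set C.
     is_contraction n c \<and> contraction_weight c = w \<and> admissible n c)"

text \<open>The value at \<open>x\<close>, computed with a straight ambient metric \<open>G\<close> for \<open>(U, [g])\<close>: restriction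
  to \<open>\<G>\<close>, evaluated at the point \<open>(g\<^sub>x, x)\<close>.\<close>

definition weyl_value :: "'n::finite list \<Rightarrow> (real \<times> contraction) list \<Rightarrow>
  (real^('n option option) \<Rightarrow> real^('n option option)^('n option option)) \<Rightarrow> real^'n \<Rightarrow> real" where
  "weyl_value e C G x = (\<Sum>(a, c)\<leftarrow>C. a * contraction_value e G c (iota (unit_section x)))"

text \<open>Oddness of the resulting scalar invariant, whose value at a metric is computed with any
  straight ambient metric for its conformal class.\<close>

definition odd_weyl :: "nat \<Rightarrow> nat \<Rightarrow> 'n::finite list \<Rightarrow> (real \<times> contraction) list \<Rightarrow> bool" where
  "odd_weyl p q e C \<longleftrightarrow>
     (\<forall>U V \<phi> g W G W' G'. diffeo U V \<phi> \<longrightarrow> orientation_reversing U \<phi> \<longrightarrow> metric_on p q V g \<longrightarrow>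
        straight_ambient_metric p q V g W G \<longrightarrow>
        straight_ambient_metric p q U (pullback \<phi> g) W' G' \<longrightarrow>
        (\<forall>x\<in>U. weyl_value e C G' x = - weyl_value e C G (\<phi> x)))"

end

theory Submission
  imports Defs
begin

text \<open>
  Scalar invariants. In coordinates centred at the point in which the metric is standard to first order,
  an invariant is a polynomial in the jets of order at least two. These jets are sums of tensors
  \<open>a\<^sup>2 \<otimes> b\<^sup>k\<close> with \<open>k \<ge> 2\<close>, and an invariant of weight \<open>w\<close> is homogeneous of degree \<open>-w\<close> if such a
  tensor has degree \<open>k\<close>. If \<open>-w < n\<close>, each monomial thus involves fewer than \<open>n/2\<close> of them, hence fewer
  than \<open>n\<close> covectors \<open>a\<close>, \<open>b\<close>. For generic covectors some reflection fixes them all, so that an odd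
  invariant vanishes.

  Weyl invariants. By the Bianchi identities at most \<open>r + 2\<close> slots of \<open>\<nabla>\<^sup>r R\<close> can be contracted with an
  alternating tensor, and at most \<open>r + 1\<close> if \<open>r > 0\<close>. Counting the slots of the volume form leaves only
  contractions of \<open>T \<rfloor> \<mu>\<close> with undifferentiated curvature tensors. These vanish because \<open>T \<rfloor> R = 0\<close> and
  \<open>T\<close> is null on the metric bundle. The contractions without volume form are even, as one sees by lifting
  a coordinate reflection to the ambient space.
\<close>


text \<open>A single monomial of an invariant cannot be tested against a reflection. So jets are
  realized by polynomial metrics with real parameters t_m in front of the tensors: setting all but
  few of them to zero isolates the monomials of small support, and scaling t_m by c^k bounds the
  others. Such a metric may be degenerate away from the origin, hence the need for openness of the
  signature condition. The vector orthogonal to the covectors may be null and then defines no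
  reflection; a limit through non-null vectors covers this case.

  On the Weyl side a factor nabla^r R contributes r + 2 to the weight count, an upper bound for the
  slots it can offer to an alternating tensor. For -w \<le> n the n + 2 slots of \<mu> cannot all be
  filled. T \<rfloor> \<mu> has n + 1 slots and its weight is shifted by one, so exactly the case of
  equality escapes the count; there the two facts about T are spent.

  An odd combination may contain even contractions that are not zero one by one. Their sum is
  unchanged by a reflection and also changes sign under it.\<close>

lemma pds_append: "pds (ks @ ls) f = pds ks (pds ls f)"
  by (induction ks) auto

section \<open>Rules for partial derivatives\<close>

lemma pd_eqI: "(f has_derivative f') (at z) \<Longrightarrow> pd k f z = f' (axis k 1)"
  unfolding pd_def using frechet_derivative_at by metis

text \<open>\<open>frechet_derivative\<close> is a choice among all derivatives at the point.
  Functions that agree near z have the same derivatives there, so the choices coincide even if there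
  are none.\<close>

lemma pd_cong_open:
  assumes "open S" "z \<in> S" "\<And>y. y \<in> S \<Longrightarrow> f y = g y"
  shows "pd k f z = pd k g z"
proof -
  have "(f has_derivative f') (at z) \<longleftrightarrow> (g has_derivative f') (at z)" for f'
    using has_derivative_transform_within_open[of f f' z UNIV S g]
      has_derivative_transform_within_open[of g f' z UNIV S f] assms by auto
  then show ?thesis unfolding pd_def frechet_derivative_def by simp
qed

lemma pds_cong_open:
  assumes "open S" "\<And>y. y \<in> S \<Longrightarrow> f y = g y" "z \<in> S"
  shows "pds ks f z = pds ks g z"
  using assms(3)
proof (induction ks arbitrary: z)
  case (Cons k ks)
  then have "pd k (pds ks f) z = pd k (pds ks g) z" by (intro pd_cong_open[OF assms(1)])
  then show ?case by simp
qed (use assms in auto)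

lemma differentiable_at_cong_open:
  assumes "open S" "z \<in> S" "\<And>y. y \<in> S \<Longrightarrow> f y = g y" "f differentiable at z"
  shows "g differentiable at z"
proof -
  obtain f' where "(f has_derivative f') (at z)" using assms(4) unfolding differentiable_def by blast
  then have "(g has_derivative f') (at z)"
    using has_derivative_transform_within_open[of f f' z UNIV S g] assms by auto
  then show ?thesis unfolding differentiable_def by blast
qed

lemma frechet_eq_pd_sum:
  fixes f :: "real^'a::finite \<Rightarrow> real"
  assumes "f differentiable at z"
  shows "frechet_derivative f (at z) v = (\<Sum>j\<in>UNIV. pd j f z * v $ j)"
proof -
  have l: "linear (frechet_derivative f (at z))"
    using assms linear_frechet_derivative by blast
  have "v = (\<Sum>j\<in>UNIV. v $ j *\<^sub>R axis j 1)"
    using basis_expansion[of v] by (simp add: scalar_mult_eq_scaleR)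
  then have "frechet_derivative f (at z) v = frechet_derivative f (at z) (\<Sum>j\<in>UNIV. v $ j *\<^sub>R axis j 1)"
    by simp
  also have "\<dots> = (\<Sum>j\<in>UNIV. v $ j *\<^sub>R frechet_derivative f (at z) (axis j 1))"
    using l by (simp add: linear_sum linear_cmul)
  finally show ?thesis by (simp add: pd_def mult.commute)
qed

lemma has_derivative_pd:
  fixes f :: "real^'a::finite \<Rightarrow> real"
  assumes "f differentiable at z"
  shows "(f has_derivative (\<lambda>v. \<Sum>j\<in>UNIV. pd j f z * v $ j)) (at z)"
proof -
  have "(\<lambda>v. \<Sum>j\<in>UNIV. pd j f z * v $ j) = frechet_derivative f (at z)"
    using frechet_eq_pd_sum[OF assms] by auto
  then show ?thesis using assms frechet_derivative_works by metis
qed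

lemma pd_const [simp]: "pd k (\<lambda>_. c) z = 0"
  by (rule pd_eqI[THEN trans]) (auto intro!: derivative_eq_intros)

lemma pd_add:
  assumes "f differentiable at z" "g differentiable at z"
  shows "pd k (\<lambda>y. f y + g y) z = pd k f z + pd k g z"
  using has_derivative_add[OF assms[unfolded frechet_derivative_works]]
  by (subst pd_eqI) (auto simp: pd_def)

lemma pd_diff:
  assumes "f differentiable at z" "g differentiable at z"
  shows "pd k (\<lambda>y. f y - g y) z = pd k f z - pd k g z"
  using has_derivative_diff[OF assms[unfolded frechet_derivative_works]]
  by (subst pd_eqI) (auto simp: pd_def)

lemma pd_mult:
  assumes "f differentiable at z" "g differentiable at z"
  shows "pd k (\<lambda>y. f y * g y) z = f z * pd k g z + pd k f z * g z"
  using has_derivative_mult[OF assms[unfolded frechet_derivative_works]]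
  by (subst pd_eqI) (auto simp: pd_def)

lemma pd_cmult:
  assumes "f differentiable at z"
  shows "pd k (\<lambda>y. c * f y) z = c * pd k f z"
  using pd_mult[OF _ assms, of "\<lambda>_. c" k] by simp

lemma pd_sum:
  assumes "\<And>i. i \<in> A \<Longrightarrow> f i differentiable at z"
  shows "pd k (\<lambda>y. \<Sum>i\<in>A. f i y) z = (\<Sum>i\<in>A. pd k (f i) z)"
proof (cases "finite A")
  case True
  have "((\<lambda>y. \<Sum>i\<in>A. f i y) has_derivative (\<lambda>h. \<Sum>i\<in>A. frechet_derivative (f i) (at z) h)) (at z)"
    by (intro has_derivative_sum) (use assms frechet_derivative_works in blast)
  from pd_eqI[OF this] show ?thesis by (simp add: pd_def)
qed simp

lemma pd_inverse:
  fixes f :: "real^'a::finite \<Rightarrow> real"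
  assumes "f differentiable at z" "f z \<noteq> 0"
  shows "pd k (\<lambda>y. inverse (f y)) z = - (inverse (f z) * pd k f z * inverse (f z))"
  using Deriv.has_derivative_inverse[OF assms(2) assms(1)[unfolded frechet_derivative_works]]
  by (subst pd_eqI) (auto simp: pd_def)

lemma pd_component: "pd k (\<lambda>y. y $ i) z = (if i = k then 1 else 0)"
proof -
  have "((\<lambda>y. y $ i) has_derivative (\<lambda>h. h $ i)) (at z)"
    by (intro bounded_linear_imp_has_derivative bounded_linear_vec_nth)
  from pd_eqI[OF this] show ?thesis by (auto simp: axis_def)
qed

lemma differentiable_component [simp, intro]: "(\<lambda>y. y $ i) differentiable at z"
  by (intro bounded_linear_imp_differentiable bounded_linear_vec_nth)

lemma has_derivative_vecI:
  fixes f :: "real^'a::finite \<Rightarrow> real^'b::finite"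
  assumes "\<And>i. ((\<lambda>y. f y $ i) has_derivative (\<lambda>h. f' h $ i)) (at z)"
  shows "(f has_derivative f') (at z)"
  using assms has_derivative_componentwise_within[of f f' z UNIV]
  by (auto simp: Basis_vec_def inner_axis)

lemma has_derivative_map:
  fixes \<phi> :: "real^'a::finite \<Rightarrow> real^'b::finite"
  assumes "\<And>i. (\<lambda>y. \<phi> y $ i) differentiable at z"
  shows "(\<phi> has_derivative (\<lambda>v. \<chi> i. \<Sum>j\<in>UNIV. pd j (\<lambda>y. \<phi> y $ i) z * v $ j)) (at z)"
  by (rule has_derivative_vecI) (simp add: has_derivative_pd[OF assms])

lemma jacobian_component:
  fixes \<phi> :: "real^'a::finite \<Rightarrow> real^'b::finite"
  assumes "\<And>i. (\<lambda>y. \<phi> y $ i) differentiable at z"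
  shows "jacobian \<phi> (at z) $ i $ j = pd j (\<lambda>y. \<phi> y $ i) z"
proof -
  have "frechet_derivative \<phi> (at z) = (\<lambda>v. \<chi> i. \<Sum>j\<in>UNIV. pd j (\<lambda>y. \<phi> y $ i) z * v $ j)"
    using frechet_derivative_at[OF has_derivative_map[OF assms]] by simp
  then show ?thesis
    by (simp add: jacobian_def matrix_def axis_def if_distrib cong: if_cong)
qed

lemma differentiable_comp:
  fixes \<phi> :: "real^'a::finite \<Rightarrow> real^'b::finite" and f :: "real^'b \<Rightarrow> real"
  assumes "\<And>i. (\<lambda>y. \<phi> y $ i) differentiable at z" "f differentiable at (\<phi> z)"
  shows "(\<lambda>y. f (\<phi> y)) differentiable at z"
proof -
  have "\<phi> differentiable at z" using has_derivative_map[OF assms(1)] unfolding differentiable_def by blast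
  then show ?thesis using differentiable_chain_at[of \<phi> z f] assms(2) by (simp add: o_def)
qed

lemma pd_comp:
  fixes \<phi> :: "real^'a::finite \<Rightarrow> real^'b::finite" and f :: "real^'b \<Rightarrow> real"
  assumes "\<And>i. (\<lambda>y. \<phi> y $ i) differentiable at z" "f differentiable at (\<phi> z)"
  shows "pd k (\<lambda>y. f (\<phi> y)) z = (\<Sum>j\<in>UNIV. pd j f (\<phi> z) * pd k (\<lambda>y. \<phi> y $ j) z)"
proof -
  have "(f \<circ> \<phi> has_derivative (\<lambda>v. \<Sum>j\<in>UNIV. pd j f (\<phi> z) * v $ j) \<circ>
      (\<lambda>v. \<chi> i. \<Sum>j\<in>UNIV. pd j (\<lambda>y. \<phi> y $ i) z * v $ j)) (at z)"
    by (rule diff_chain_at[OF has_derivative_map[OF assms(1)] has_derivative_pd[OF assms(2)]])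
  from pd_eqI[OF this] show ?thesis
    by (simp add: o_def axis_def if_distrib cong: if_cong)
qed

subsection \<open>Functions with finitely many derivatives\<close>

text \<open>Smoothness quantifies over all orders at once; this filtration by order allows closure
  properties to be proved by induction. Order 0 already demands differentiability, so
  \<open>Ck k\<close> means differentiable k + 1 times.\<close>

definition Ck :: "nat \<Rightarrow> (real^'a::finite) set \<Rightarrow> (real^'a \<Rightarrow> real) \<Rightarrow> bool" where
  "Ck k S f \<longleftrightarrow> (\<forall>ks. length ks \<le> k \<longrightarrow> pds ks f differentiable_on S)"

lemma smooth_on_iff_Ck: "smooth_on S f \<longleftrightarrow> (\<forall>k. Ck k S f)"
  unfolding smooth_on_def Ck_def by blast

lemma Ck_0: "Ck 0 S f \<longleftrightarrow> f differentiable_on S"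
  by (auto simp: Ck_def)

text \<open>\<open>pds\<close> adds derivatives on the outside, whereas the inductions below split
  off the innermost one. Appending an index to the list passes from one view to the other.\<close>

lemma Ck_Suc: "Ck (Suc k) S f \<longleftrightarrow> f differentiable_on S \<and> (\<forall>i. Ck k S (pd i f))"
proof
  assume L: "Ck (Suc k) S f"
  have "pds ks (pd i f) differentiable_on S" if "length ks \<le> k" for ks i
    using L[unfolded Ck_def, rule_format, of "ks @ [i]"] that by (simp add: pds_append)
  then show "f differentiable_on S \<and> (\<forall>i. Ck k S (pd i f))"
    using L[unfolded Ck_def, rule_format, of "[]"] by (auto simp: Ck_def)
next
  assume R: "f differentiable_on S \<and> (\<forall>i. Ck k S (pd i f))"
  have "pds ks f differentiable_on S" if "length ks \<le> Suc k" for ks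
  proof (cases ks rule: rev_cases)
    case (snoc ls i)
    then show ?thesis using R that by (auto simp: Ck_def pds_append)
  qed (use R in auto)
  then show "Ck (Suc k) S f" by (auto simp: Ck_def)
qed

lemma Ck_mono: "Ck k S f \<Longrightarrow> l \<le> k \<Longrightarrow> Ck l S f"
  by (auto simp: Ck_def)

lemma Ck_differentiable_on: "Ck k S f \<Longrightarrow> f differentiable_on S"
  using Ck_mono[of k S f 0] by (simp add: Ck_0)

lemma Ck_differentiable_at: "Ck k S f \<Longrightarrow> open S \<Longrightarrow> z \<in> S \<Longrightarrow> f differentiable at z"
  using Ck_differentiable_on differentiable_on_eq_differentiable_at by blast

lemma Ck_cong:
  assumes "open S" "\<And>y. y \<in> S \<Longrightarrow> f y = g y" "Ck k S f"
  shows "Ck k S g"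
  unfolding Ck_def
proof (intro allI impI)
  fix ks :: "'a list"
  assume l: "length ks \<le> k"
  have "pds ks g differentiable at z" if z: "z \<in> S" for z
  proof (rule differentiable_at_cong_open[OF assms(1) z])
    show "pds ks f y = pds ks g y" if "y \<in> S" for y
      by (rule pds_cong_open[OF assms(1,2) that])
    show "pds ks f differentiable at z"
      using assms(1,3) l z differentiable_on_eq_differentiable_at unfolding Ck_def by blast
  qed
  then show "pds ks g differentiable_on S"
    using assms(1) differentiable_on_eq_differentiable_at by blast
qed

lemma Ck_subset: "Ck k S f \<Longrightarrow> T \<subseteq> S \<Longrightarrow> Ck k T f"
  unfolding Ck_def using differentiable_on_subset by blast

lemma Ck_const: "Ck k S (\<lambda>_. c)"
proof (induction k arbitrary: c)
  case (Suc k)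
  have "pd i (\<lambda>_::real^'a. c) = (\<lambda>_. 0)" for i by auto
  then show ?case using Suc by (auto simp: Ck_Suc)
qed (auto simp: Ck_0)

lemma Ck_add:
  assumes "open S"
  shows "Ck k S f \<Longrightarrow> Ck k S g \<Longrightarrow> Ck k S (\<lambda>y. f y + g y)"
proof (induction k arbitrary: f g)
  case (Suc k)
  have d: "f differentiable at y" "g differentiable at y" if "y \<in> S" for y
    using Suc.prems Ck_differentiable_at[OF _ assms that] by blast+
  have "Ck k S (pd i (\<lambda>y. f y + g y))" for i
    by (rule Ck_cong[OF assms, of "\<lambda>y. pd i f y + pd i g y"])
      (use Suc d in \<open>auto simp: Ck_Suc intro!: pd_add[symmetric]\<close>)
  then show ?case using Suc.prems by (auto simp: Ck_Suc)
qed (auto simp: Ck_0)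

lemma Ck_mult:
  assumes "open S"
  shows "Ck k S f \<Longrightarrow> Ck k S g \<Longrightarrow> Ck k S (\<lambda>y. f y * g y)"
proof (induction k arbitrary: f g)
  case (Suc k)
  have *: "Ck k S f" "Ck k S g" using Suc.prems Ck_mono[of "Suc k" S _ k] by auto
  have "Ck k S (pd i (\<lambda>y. f y * g y))" for i
  proof (rule Ck_cong[OF assms])
    show "Ck k S (\<lambda>y. f y * pd i g y + pd i f y * g y)"
      using * Suc by (intro Ck_add[OF assms] Suc.IH) (auto simp: Ck_Suc)
    show "f y * pd i g y + pd i f y * g y = pd i (\<lambda>y. f y * g y) y" if "y \<in> S" for y
      using Suc.prems Ck_differentiable_at[OF _ assms that] by (intro pd_mult[symmetric]) blast+
  qed
  then show ?case using Suc.prems by (auto simp: Ck_Suc intro!: differentiable_on_mult)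
qed (auto simp: Ck_0)

lemma Ck_sum:
  assumes "open S" "\<And>i. i \<in> A \<Longrightarrow> Ck k S (f i)"
  shows "Ck k S (\<lambda>y. \<Sum>i\<in>A. f i y)"
  using assms(2)
  by (induction A rule: infinite_finite_induct) (auto intro!: Ck_const Ck_add[OF assms(1)])

lemma Ck_prod:
  assumes "open S" "\<And>i. i \<in> A \<Longrightarrow> Ck k S (f i)"
  shows "Ck k S (\<lambda>y. \<Prod>i\<in>A. f i y)"
  using assms(2)
  by (induction A rule: infinite_finite_induct) (auto intro!: Ck_const Ck_mult[OF assms(1)])

lemma Ck_cmult: "open S \<Longrightarrow> Ck k S f \<Longrightarrow> Ck k S (\<lambda>y. c * f y)"
  by (intro Ck_mult Ck_const)

lemma Ck_diff:
  assumes "open S" "Ck k S f" "Ck k S g"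
  shows "Ck k S (\<lambda>y. f y - g y)"
  using Ck_add[OF assms(1,2) Ck_cmult[OF assms(1,3), of "-1"]] by simp

lemma Ck_power: "open S \<Longrightarrow> Ck k S f \<Longrightarrow> Ck k S (\<lambda>y. f y ^ n)"
  by (induction n) (auto intro!: Ck_const Ck_mult)

lemma Ck_component: "Ck k S (\<lambda>y. y $ i)"
proof (cases k)
  case 0
  then show ?thesis
    by (auto simp: Ck_0 differentiable_on_def intro: differentiable_at_withinI)
next
  case (Suc l)
  have "pd j (\<lambda>y::real^'a. y $ i) = (\<lambda>_. if i = j then 1 else 0)" for j
    by (auto simp: pd_component)
  then show ?thesis using Suc
    by (auto simp: Ck_Suc differentiable_on_def intro: differentiable_at_withinI Ck_const)
qed

lemma Ck_inverse:
  assumes "open S" "\<And>y. y \<in> S \<Longrightarrow> f y \<noteq> 0"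
  shows "Ck k S f \<Longrightarrow> Ck k S (\<lambda>y. inverse (f y))"
proof (induction k)
  case 0
  have "(\<lambda>y. inverse (f y)) differentiable at z" if "z \<in> S" for z
    using differentiable_inverse[OF Ck_differentiable_at[OF 0 assms(1) that] assms(2)[OF that]] .
  then show ?case using assms(1) by (simp add: Ck_0 differentiable_on_eq_differentiable_at)
next
  case (Suc k)
  have f: "Ck k S f" using Suc.prems by (rule Ck_mono) simp
  have i: "Ck k S (\<lambda>y. inverse (f y))" by (rule Suc.IH[OF f])
  have p: "Ck k S (pd j f)" for j using Suc.prems by (simp add: Ck_Suc)
  have "Ck k S (pd j (\<lambda>y. inverse (f y)))" for j
  proof (rule Ck_cong[OF assms(1)])
    show "Ck k S (\<lambda>y. (-1) * (inverse (f y) * pd j f y * inverse (f y)))"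
      by (intro Ck_mult Ck_const assms(1) i p)
    show "(-1) * (inverse (f y) * pd j f y * inverse (f y)) = pd j (\<lambda>y. inverse (f y)) y" if "y \<in> S" for y
      using pd_inverse[OF Ck_differentiable_at[OF Suc.prems assms(1) that] assms(2)[OF that]] by simp
  qed
  then show ?case using Ck_differentiable_on[OF i] by (simp add: Ck_Suc)
qed

text \<open>By the chain rule a first derivative of the composite involves the composites of the
  functions \<open>pd j f\<close> with \<phi>, so the induction hypothesis has to range over all
  f.\<close>

lemma Ck_comp:
  fixes \<phi> :: "real^'a::finite \<Rightarrow> real^'b::finite"
  assumes "open S" "open T" "\<And>y. y \<in> S \<Longrightarrow> \<phi> y \<in> T"
  shows "Ck k T f \<Longrightarrow> (\<And>i. Ck k S (\<lambda>y. \<phi> y $ i)) \<Longrightarrow> Ck k S (\<lambda>y. f (\<phi> y))"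
proof (induction k arbitrary: f)
  case 0
  have "(\<lambda>y. f (\<phi> y)) differentiable at y" if "y \<in> S" for y
    by (rule differentiable_comp[OF Ck_differentiable_at[OF 0(2) assms(1) that]
        Ck_differentiable_at[OF 0(1) assms(2) assms(3)[OF that]]])
  then show ?case
    using assms(1) by (simp add: Ck_0 differentiable_on_eq_differentiable_at)
next
  case (Suc k)
  note d = Ck_differentiable_at[OF Suc.prems(2) assms(1)] Ck_differentiable_at[OF Suc.prems(1) assms(2,3)]
  have dc: "(\<lambda>y. f (\<phi> y)) differentiable at y" if "y \<in> S" for y
    by (rule differentiable_comp[OF d(1)[OF that] d(2)[OF that]])
  have p: "Ck k S (\<lambda>y. \<phi> y $ i)" for i using Suc.prems(2)[of i] by (rule Ck_mono) simp
  have "Ck k S (pd i (\<lambda>y. f (\<phi> y)))" for i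
  proof (rule Ck_cong[OF assms(1)])
    show "Ck k S (\<lambda>y. \<Sum>j\<in>UNIV. pd j f (\<phi> y) * pd i (\<lambda>y. \<phi> y $ j) y)"
    proof (intro Ck_sum Ck_mult assms(1))
      show "Ck k S (\<lambda>y. pd j f (\<phi> y))" for j
        by (rule Suc.IH[OF _ p]) (use Suc.prems(1) in \<open>simp add: Ck_Suc\<close>)
      show "Ck k S (\<lambda>y. pd i (\<lambda>y. \<phi> y $ j) y)" for j
        using Suc.prems(2) by (simp add: Ck_Suc)
    qed
    show "(\<Sum>j\<in>UNIV. pd j f (\<phi> y) * pd i (\<lambda>y. \<phi> y $ j) y) = pd i (\<lambda>y. f (\<phi> y)) y" if "y \<in> S" for y
      by (rule pd_comp[OF d(1)[OF that] d(2)[OF that], symmetric])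
  qed
  then show ?case using dc assms(1) by (simp add: Ck_Suc differentiable_on_eq_differentiable_at)
qed

section \<open>Determinants and inverses of matrix-valued functions\<close>

lemma Ck_det:
  fixes A :: "real^'a::finite \<Rightarrow> real^'b::finite^'b"
  assumes "open S" "\<And>i j. Ck k S (\<lambda>y. A y $ i $ j)"
  shows "Ck k S (\<lambda>y. det (A y))"
  unfolding det_def by (intro Ck_sum Ck_mult Ck_prod Ck_const assms)

lemma matrix_inv_mult:
  fixes A :: "real^'b::finite^'b"
  assumes "invertible A"
  shows "A ** matrix_inv A = mat 1" "matrix_inv A ** A = mat 1"
  using someI_ex[OF assms[unfolded invertible_def]] unfolding matrix_inv_def by auto

text \<open>Cramer's rule turns the entries of the inverse into quotients of polynomials in the
  entries of A, from which their smoothness can be read off.\<close>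

lemma matrix_inv_cramer:
  fixes A :: "real^'b::finite^'b"
  assumes "det A \<noteq> 0"
  shows "matrix_inv A $ i $ j = det (\<chi> r c. if c = i then axis j 1 $ r else A $ r $ c) / det A"
proof -
  have "A ** matrix_inv A = mat 1"
    using assms by (simp add: invertible_det_nz matrix_inv_mult)
  then have "A *v (matrix_inv A *v axis j 1) = axis j 1"
    by (simp add: matrix_vector_mul_assoc)
  then have "matrix_inv A *v axis j 1 = (\<chi> k. det (\<chi> r c. if c = k then axis j 1 $ r else A $ r $ c) / det A)"
    using cramer[OF assms] by blast
  then have "(matrix_inv A *v axis j 1) $ i = det (\<chi> r c. if c = i then axis j 1 $ r else A $ r $ c) / det A"
    by simp
  then show ?thesis by (simp add: matrix_vector_mult_basis column_def)
qed

lemma Ck_matrix_inv: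
  fixes A :: "real^'a::finite \<Rightarrow> real^'b::finite^'b"
  assumes "open S" "\<And>i j. Ck k S (\<lambda>y. A y $ i $ j)" "\<And>y. y \<in> S \<Longrightarrow> det (A y) \<noteq> 0"
  shows "Ck k S (\<lambda>y. matrix_inv (A y) $ i $ j)"
proof (rule Ck_cong[OF assms(1)])
  have "Ck k S (\<lambda>y. if c = i then axis j 1 $ r else A y $ r $ c)" for r c
    using assms(2) Ck_const by (cases "c = i") auto
  then show "Ck k S (\<lambda>y. det (\<chi> r c. if c = i then axis j 1 $ r else A y $ r $ c) * inverse (det (A y)))"
    by (intro Ck_mult Ck_det Ck_inverse assms) auto
  show "det (\<chi> r c. if c = i then axis j 1 $ r else A y $ r $ c) * inverse (det (A y)) =
      matrix_inv (A y) $ i $ j" if "y \<in> S" for y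
    using matrix_inv_cramer[OF assms(3)[OF that]] by (simp add: divide_inverse)
qed

section \<open>Symmetry of second partial derivatives\<close>

lemma pd_line_deriv:
  fixes f :: "real^'a::finite \<Rightarrow> real"
  assumes "f differentiable at (a + s *\<^sub>R axis i 1)"
  shows "((\<lambda>s. f (a + s *\<^sub>R axis i 1)) has_real_derivative pd i f (a + s *\<^sub>R axis i 1)) (at s)"
proof -
  have l: "((\<lambda>s. a + s *\<^sub>R axis i 1) has_derivative (\<lambda>h. h *\<^sub>R axis i 1)) (at s)"
    by (auto intro!: derivative_eq_intros)
  have "(f \<circ> (\<lambda>s. a + s *\<^sub>R axis i 1) has_derivative
      (\<lambda>v. \<Sum>j\<in>UNIV. pd j f (a + s *\<^sub>R axis i 1) * v $ j) \<circ> (\<lambda>h. h *\<^sub>R axis i 1)) (at s)"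
    by (rule diff_chain_at[OF l has_derivative_pd[OF assms]])
  moreover have "(\<lambda>v. \<Sum>j\<in>UNIV. pd j f (a + s *\<^sub>R axis i 1) * v $ j) \<circ> (\<lambda>h. h *\<^sub>R axis i 1) =
      (*) (pd i f (a + s *\<^sub>R axis i 1))"
    by (auto simp: o_def axis_def if_distrib cong: if_cong)
  ultimately show ?thesis by (simp add: has_field_derivative_def o_def)
qed

text \<open>The second difference over a square of side h is a first difference of \<open>g\<close>.
  The mean value theorem in direction i and then in direction j replaces it by a mixed derivative at
  an intermediate point.\<close>

lemma pd_mixed_mean_value:
  fixes f :: "real^'a::finite \<Rightarrow> real"
  assumes C: "Ck 1 (ball z \<delta>) f" and h: "0 < h" "2 * h < \<delta>"
  shows "\<exists>y\<in>ball z \<delta>. f (z + h *\<^sub>R axis i 1 + h *\<^sub>R axis j 1) - f (z + h *\<^sub>R axis i 1)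
     - f (z + h *\<^sub>R axis j 1) + f z = h * h * pd j (pd i f) y"
proof -
  have inb: "z + s *\<^sub>R axis i 1 + t *\<^sub>R axis j 1 \<in> ball z \<delta>" if "0 \<le> s" "s \<le> h" "0 \<le> t" "t \<le> h" for s t
  proof -
    have "norm (s *\<^sub>R axis i 1 + t *\<^sub>R axis j 1 :: real^'a) \<le> \<bar>s\<bar> + \<bar>t\<bar>"
      using norm_triangle_ineq[of "s *\<^sub>R axis i 1 :: real^'a" "t *\<^sub>R axis j 1"] by (simp add: norm_axis_1)
    then have "norm (s *\<^sub>R axis i 1 + t *\<^sub>R axis j 1 :: real^'a) < \<delta>" using that h by linarith
    then show ?thesis by (simp add: dist_norm add.assoc norm_minus_commute) (simp add: add.commute)
  qed
  have d0: "f differentiable at y" if "y \<in> ball z \<delta>" for y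
    by (rule Ck_differentiable_at[OF C open_ball that])
  have "Ck 0 (ball z \<delta>) (pd i f)" using C by (metis Ck_Suc One_nat_def)
  then have d1: "pd i f differentiable at y" if "y \<in> ball z \<delta>" for y
    using Ck_differentiable_at[OF _ open_ball that] by blast
  define g where "g s = f (z + h *\<^sub>R axis j 1 + s *\<^sub>R axis i 1) - f (z + s *\<^sub>R axis i 1)" for s
  define g' where "g' s = pd i f (z + h *\<^sub>R axis j 1 + s *\<^sub>R axis i 1) - pd i f (z + s *\<^sub>R axis i 1)" for s
  have "\<exists>\<xi>. \<xi> > 0 \<and> \<xi> < h \<and> g h - g 0 = (h - 0) * g' \<xi>"
  proof (rule MVT2[OF h(1)])
    fix s assume s: "0 \<le> s" "s \<le> h"
    have "z + h *\<^sub>R axis j 1 + s *\<^sub>R axis i 1 \<in> ball z \<delta>" "z + s *\<^sub>R axis i 1 \<in> ball z \<delta>"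
      using inb[OF s, of h] inb[OF s, of 0] h by (auto simp: algebra_simps)
    then show "(g has_real_derivative g' s) (at s)"
      unfolding g_def g'_def by (intro DERIV_diff pd_line_deriv d0)
  qed
  then obtain \<xi> where \<xi>: "\<xi> > 0" "\<xi> < h" "g h - g 0 = h * g' \<xi>" by auto
  have "\<exists>\<eta>. \<eta> > 0 \<and> \<eta> < h \<and> pd i f (z + \<xi> *\<^sub>R axis i 1 + h *\<^sub>R axis j 1) - pd i f (z + \<xi> *\<^sub>R axis i 1 + 0 *\<^sub>R axis j 1) =
      (h - 0) * pd j (pd i f) (z + \<xi> *\<^sub>R axis i 1 + \<eta> *\<^sub>R axis j 1)"
    by (rule MVT2[OF h(1)], rule pd_line_deriv, rule d1, rule inb) (use \<xi> in auto)
  then obtain \<eta> where \<eta>: "\<eta> > 0" "\<eta> < h" "g' \<xi> = h * pd j (pd i f) (z + \<xi> *\<^sub>R axis i 1 + \<eta> *\<^sub>R axis j 1)"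
    by (auto simp: g'_def algebra_simps)
  have "f (z + h *\<^sub>R axis i 1 + h *\<^sub>R axis j 1) - f (z + h *\<^sub>R axis i 1) - f (z + h *\<^sub>R axis j 1) + f z = g h - g 0"
    by (simp add: g_def algebra_simps)
  also have "\<dots> = h * h * pd j (pd i f) (z + \<xi> *\<^sub>R axis i 1 + \<eta> *\<^sub>R axis j 1)"
    using \<xi> \<eta> by simp
  finally show ?thesis using inb[of \<xi> \<eta>] \<xi> \<eta> by auto
qed

text \<open>Schwarz's theorem. The second difference over a square does not change when i and j are
  exchanged, so the two mixed derivatives take equal values at points arbitrarily close to z, and
  both are continuous.\<close>

lemma pd_commute:
  fixes f :: "real^'a::finite \<Rightarrow> real"
  assumes S: "open S" "z \<in> S" and C: "Ck 2 S f"
  shows "pd i (pd j f) z = pd j (pd i f) z"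
proof -
  have "isCont (pd k (pd l f)) z" for k l
  proof -
    have "Ck 0 S (pd k (pd l f))" using C by (simp add: numeral_2_eq_2 Ck_Suc)
    then show ?thesis using Ck_differentiable_at[OF _ S] differentiable_imp_continuous_within by blast
  qed
  then have cont: "\<exists>d>0. \<forall>y. dist y z < d \<longrightarrow> dist (pd k (pd l f) y) (pd k (pd l f) z) < e" if "e > 0" for k l e
    using that unfolding continuous_at_eps_delta by blast
  obtain r where r: "r > 0" "ball z r \<subseteq> S" using S open_contains_ball by blast
  have "\<bar>pd i (pd j f) z - pd j (pd i f) z\<bar> < 2 * e" if e: "e > 0" for e
  proof -
    obtain d1 where d1: "d1 > 0" "\<And>y. dist y z < d1 \<Longrightarrow> \<bar>pd i (pd j f) y - pd i (pd j f) z\<bar> < e"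
      using cont[OF e, of i j] by (auto simp: dist_real_def)
    obtain d2 where d2: "d2 > 0" "\<And>y. dist y z < d2 \<Longrightarrow> \<bar>pd j (pd i f) y - pd j (pd i f) z\<bar> < e"
      using cont[OF e, of j i] by (auto simp: dist_real_def)
    define \<delta> where "\<delta> = min r (min d1 d2)"
    have \<delta>: "\<delta> > 0" using r d1 d2 by (simp add: \<delta>_def)
    \<comment> \<open>The far corner of the square lies within 2h of z, so 2h < \<delta> keeps the
      square in the ball.\<close>
    define h where "h = \<delta> / 3"
    have h: "0 < h" "2 * h < \<delta>" using \<delta> by (auto simp: h_def)
    have "Ck 2 (ball z \<delta>) f" using C r by (rule_tac Ck_subset) (auto simp: \<delta>_def)
    then have C1: "Ck 1 (ball z \<delta>) f" by (rule Ck_mono) simp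
    obtain y1 where y1: "y1 \<in> ball z \<delta>" "f (z + h *\<^sub>R axis i 1 + h *\<^sub>R axis j 1) - f (z + h *\<^sub>R axis i 1)
     - f (z + h *\<^sub>R axis j 1) + f z = h * h * pd j (pd i f) y1"
      using pd_mixed_mean_value[OF C1 h, of i j] by blast
    obtain y2 where y2: "y2 \<in> ball z \<delta>" "f (z + h *\<^sub>R axis j 1 + h *\<^sub>R axis i 1) - f (z + h *\<^sub>R axis j 1)
     - f (z + h *\<^sub>R axis i 1) + f z = h * h * pd i (pd j f) y2"
      using pd_mixed_mean_value[OF C1 h, of j i] by blast
    have "z + h *\<^sub>R axis j 1 + h *\<^sub>R axis i 1 = z + h *\<^sub>R axis i 1 + h *\<^sub>R axis j 1" by simp
    then have "h * h * pd j (pd i f) y1 = h * h * pd i (pd j f) y2" using y1(2) y2(2) by (simp only:)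
    then have "pd j (pd i f) y1 = pd i (pd j f) y2" using h by simp
    moreover have "\<bar>pd i (pd j f) y2 - pd i (pd j f) z\<bar> < e" "\<bar>pd j (pd i f) y1 - pd j (pd i f) z\<bar> < e"
      using y1(1) y2(1) by (auto intro!: d1(2) d2(2) simp: \<delta>_def dist_commute)
    ultimately show ?thesis by linarith
  qed
  then have "\<bar>pd i (pd j f) z - pd j (pd i f) z\<bar> \<le> 0 + e" if "e > 0" for e
    using that by (smt (verit) field_sum_of_halves half_gt_zero)
  then have "\<bar>pd i (pd j f) z - pd j (pd i f) z\<bar> \<le> 0" by (rule field_le_epsilon)
  then show ?thesis by simp
qed

subsection \<open>Smooth functions\<close>

lemma smooth_on_Ck: "smooth_on S f \<Longrightarrow> Ck k S f"
  by (simp add: smooth_on_iff_Ck)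

lemma smooth_on_pd: "smooth_on S f \<Longrightarrow> smooth_on S (pd i f)"
  using Ck_Suc[of _ S f] by (auto simp: smooth_on_iff_Ck)

lemma smooth_on_pds: "smooth_on S f \<Longrightarrow> smooth_on S (pds ks f)"
  by (induction ks) (auto intro: smooth_on_pd)

lemma smooth_on_differentiable: "smooth_on S f \<Longrightarrow> open S \<Longrightarrow> z \<in> S \<Longrightarrow> f differentiable at z"
  using Ck_differentiable_at[OF smooth_on_Ck] .

lemma smooth_on_cong:
  "open S \<Longrightarrow> (\<And>y. y \<in> S \<Longrightarrow> f y = g y) \<Longrightarrow> smooth_on S f \<Longrightarrow> smooth_on S g"
  using Ck_cong[of S f g] by (simp add: smooth_on_iff_Ck)

lemma smooth_on_subset: "smooth_on S f \<Longrightarrow> T \<subseteq> S \<Longrightarrow> smooth_on T f"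
  using Ck_subset[of _ S f T] by (simp add: smooth_on_iff_Ck)

lemma smooth_on_const [simp]: "smooth_on S (\<lambda>_. c)"
  by (simp add: smooth_on_iff_Ck Ck_const)

lemma smooth_on_component: "smooth_on S (\<lambda>y. y $ i)"
  by (simp add: smooth_on_iff_Ck Ck_component)

lemma smooth_on_add: "open S \<Longrightarrow> smooth_on S f \<Longrightarrow> smooth_on S g \<Longrightarrow> smooth_on S (\<lambda>y. f y + g y)"
  using Ck_add[of S _ f g] by (simp add: smooth_on_iff_Ck)

lemma smooth_on_diff: "open S \<Longrightarrow> smooth_on S f \<Longrightarrow> smooth_on S g \<Longrightarrow> smooth_on S (\<lambda>y. f y - g y)"
  using Ck_diff[of S _ f g] by (simp add: smooth_on_iff_Ck)

lemma smooth_on_mult: "open S \<Longrightarrow> smooth_on S f \<Longrightarrow> smooth_on S g \<Longrightarrow> smooth_on S (\<lambda>y. f y * g y)"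
  using Ck_mult[of S _ f g] by (simp add: smooth_on_iff_Ck)

lemma smooth_on_cmult: "open S \<Longrightarrow> smooth_on S f \<Longrightarrow> smooth_on S (\<lambda>y. c * f y)"
  by (intro smooth_on_mult) auto

lemma smooth_on_power: "open S \<Longrightarrow> smooth_on S f \<Longrightarrow> smooth_on S (\<lambda>y. f y ^ n)"
  using Ck_power[of S _ f n] by (simp add: smooth_on_iff_Ck)

lemma smooth_on_sum:
  "open S \<Longrightarrow> (\<And>i. i \<in> A \<Longrightarrow> smooth_on S (f i)) \<Longrightarrow> smooth_on S (\<lambda>y. \<Sum>i\<in>A. f i y)"
  using Ck_sum[of S A _ f] by (simp add: smooth_on_iff_Ck)

lemma smooth_on_comp:
  assumes "open S" "open T" "\<And>y. y \<in> S \<Longrightarrow> \<phi> y \<in> T" "smooth_on T f" "\<And>i. smooth_on S (\<lambda>y. \<phi> y $ i)"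
  shows "smooth_on S (\<lambda>y. f (\<phi> y))"
  unfolding smooth_on_iff_Ck
proof
  fix k
  show "Ck k S (\<lambda>y. f (\<phi> y))"
    by (rule Ck_comp[OF assms(1-3) smooth_on_Ck[OF assms(4)] smooth_on_Ck[OF assms(5)]])
qed

lemma smooth_on_matrix_inv:
  assumes "open S" "smooth_tensor_on S A" "\<And>y. y \<in> S \<Longrightarrow> det (A y) \<noteq> 0"
  shows "smooth_on S (\<lambda>y. matrix_inv (A y) $ i $ j)"
  using Ck_matrix_inv[OF assms(1) _ assms(3)] assms(2)
  by (simp add: smooth_on_iff_Ck smooth_tensor_on_def)

lemma smooth_on_pd_commute:
  assumes "open S" "smooth_on S f" "z \<in> S"
  shows "pd i (pd j f) z = pd j (pd i f) z"
  by (rule pd_commute[OF assms(1,3) smooth_on_Ck[OF assms(2)]])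

subsection \<open>Curvature of a metric\<close>

text \<open>Of the signature only nondegeneracy is kept, so that the results apply alike to metrics
  of signature (p, q) and to ambient metrics.\<close>

locale smooth_metric =
  fixes W :: "(real^'a::finite) set" and G :: "real^'a \<Rightarrow> real^'a^'a"
  assumes open_W: "open W"
    and smooth_G: "smooth_on W (\<lambda>y. G y $ i $ j)"
    and sym_G: "z \<in> W \<Longrightarrow> G z $ i $ j = G z $ j $ i"
    and det_G: "z \<in> W \<Longrightarrow> det (G z) \<noteq> 0"

lemma has_signature_det:
  fixes A :: "real^'a::finite^'a"
  assumes "has_signature p q A"
  shows "det A \<noteq> 0"
proof -
  obtain P :: "real^'a^'a" and d where e: "transpose P ** A ** P = (\<chi> i j. if i = j then d i else 0)" "\<forall>i. d i = 1 \<or> d i = -1"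
    using assms unfolding has_signature_def by auto
  have "det (\<chi> i j. if i = j then d i else (0::real)) = (\<Prod>i\<in>UNIV. d i)"
    by (subst det_diagonal) auto
  also have "\<dots> \<noteq> 0" using e(2) by (auto simp: prod_zero_iff) (metis one_neq_zero zero_neq_neg_one)
  finally have "det (transpose P ** A ** P) \<noteq> 0" using e(1) by simp
  then show ?thesis by (auto simp: det_mul)
qed

lemma transpose_eq_self: "transpose A = A \<longleftrightarrow> (\<forall>i j. A $ i $ j = A $ j $ i)"
  by (auto simp: transpose_def vec_eq_iff)

lemma metric_on_smooth_metric:
  assumes "metric_on p q W G"
  shows "smooth_metric W G"
proof
  show "open W" "smooth_on W (\<lambda>y. G y $ i $ j)" for i j
    using assms by (auto simp: metric_on_def smooth_tensor_on_def)
  show "G z $ i $ j = G z $ j $ i" "det (G z) \<noteq> 0" if "z \<in> W" for z i j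
    using assms that has_signature_det unfolding metric_on_def transpose_eq_self by blast+
qed

context smooth_metric
begin

abbreviation gi :: "'a \<Rightarrow> 'a \<Rightarrow> real^'a \<Rightarrow> real" where
  "gi k l z \<equiv> matrix_inv (G z) $ k $ l"

lemma gi_mult:
  assumes "z \<in> W"
  shows "(\<Sum>l\<in>UNIV. G z $ i $ l * gi l j z) = (if i = j then 1 else 0)"
    and "(\<Sum>l\<in>UNIV. gi i l z * G z $ l $ j) = (if i = j then 1 else 0)"
proof -
  have "invertible (G z)" using det_G[OF assms] by (simp add: invertible_det_nz)
  from matrix_inv_mult[OF this]
  have "(G z ** matrix_inv (G z)) $ i $ j = mat 1 $ i $ j" "(matrix_inv (G z) ** G z) $ i $ j = mat 1 $ i $ j"
    by simp_all
  then show "(\<Sum>l\<in>UNIV. G z $ i $ l * gi l j z) = (if i = j then 1 else 0)"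
    "(\<Sum>l\<in>UNIV. gi i l z * G z $ l $ j) = (if i = j then 1 else 0)"
    by (simp_all add: matrix_matrix_mult_def mat_def)
qed

lemma gi_sym:
  assumes "z \<in> W"
  shows "gi i j z = gi j i z"
proof -
  have inv: "invertible (G z)" using det_G[OF assms] by (simp add: invertible_det_nz)
  have t: "transpose (G z) = G z" using sym_G[OF assms] by (simp add: transpose_eq_self)
  have "transpose (matrix_inv (G z)) ** G z = transpose (G z ** matrix_inv (G z))"
    by (simp add: matrix_transpose_mul t)
  then have "transpose (matrix_inv (G z)) ** G z = mat 1"
    by (simp add: matrix_inv_mult(1)[OF inv] transpose_mat)
  then have "transpose (matrix_inv (G z)) ** (G z ** matrix_inv (G z)) = matrix_inv (G z)"
    by (simp add: matrix_mul_assoc)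
  then have "transpose (matrix_inv (G z)) = matrix_inv (G z)"
    by (simp add: matrix_inv_mult(1)[OF inv])
  then show ?thesis by (simp add: transpose_eq_self)
qed

lemma smooth_gi: "smooth_on W (gi i j)"
  using smooth_on_matrix_inv[OF open_W _ det_G] smooth_G by (simp add: smooth_tensor_on_def)

lemma diff_G: "z \<in> W \<Longrightarrow> (\<lambda>y. G y $ i $ j) differentiable at z"
  by (rule smooth_on_differentiable[OF smooth_G open_W])

lemma pd_G_sym: "z \<in> W \<Longrightarrow> pd k (\<lambda>y. G y $ i $ j) z = pd k (\<lambda>y. G y $ j $ i) z"
  by (rule pd_cong_open[OF open_W _ sym_G])

text \<open>Christoffel symbols of the first kind, lowered index first.\<close>

definition chr_low :: "'a \<Rightarrow> 'a \<Rightarrow> 'a \<Rightarrow> real^'a \<Rightarrow> real" where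
  "chr_low m i j z = (pd i (\<lambda>y. G y $ j $ m) z + pd j (\<lambda>y. G y $ i $ m) z - pd m (\<lambda>y. G y $ i $ j) z) / 2"

lemma christoffel_chr_low: "christoffel G k i j z = (\<Sum>l\<in>UNIV. gi k l z * chr_low l i j z)"
  unfolding christoffel_def chr_low_def by (simp add: sum_divide_distrib)

lemma smooth_chr_low: "smooth_on W (chr_low m i j)"
proof -
  have "chr_low m i j = (\<lambda>z. (1/2) * (pd i (\<lambda>y. G y $ j $ m) z + pd j (\<lambda>y. G y $ i $ m) z - pd m (\<lambda>y. G y $ i $ j) z))"
    by (auto simp: chr_low_def)
  then show ?thesis
    by (simp only:) (intro smooth_on_cmult smooth_on_diff smooth_on_add smooth_on_pd smooth_G open_W)
qed

lemma smooth_christoffel: "smooth_on W (christoffel G k i j)"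
proof -
  have "christoffel G k i j = (\<lambda>z. \<Sum>l\<in>UNIV. gi k l z * chr_low l i j z)"
    by (rule ext) (rule christoffel_chr_low)
  then show ?thesis
    by (simp only:) (intro smooth_on_sum smooth_on_mult smooth_gi smooth_chr_low open_W)
qed

lemma diff_christoffel: "z \<in> W \<Longrightarrow> christoffel G k i j differentiable at z"
  by (rule smooth_on_differentiable[OF smooth_christoffel open_W])

lemma smooth_riem_up: "smooth_on W (riem_up G m j k l)"
proof -
  have e: "riem_up G m j k l = (\<lambda>z. pd k (christoffel G m l j) z - pd l (christoffel G m k j) z +
     (\<Sum>s\<in>UNIV. christoffel G m k s z * christoffel G s l j z
               - christoffel G m l s z * christoffel G s k j z))"
    by (rule ext) (simp add: riem_up_def)
  show ?thesis
    unfolding e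
    by (intro smooth_on_add smooth_on_diff smooth_on_sum smooth_on_mult smooth_on_pd smooth_christoffel open_W)
qed

lemma chr_low_sym: "z \<in> W \<Longrightarrow> chr_low m i j z = chr_low m j i z"
  using pd_G_sym[of z m i j] by (simp add: chr_low_def)

lemma christoffel_sym: "z \<in> W \<Longrightarrow> christoffel G k i j z = christoffel G k j i z"
  unfolding christoffel_chr_low by (simp add: chr_low_sym[of z _ i j])

lemma christoffel_lower:
  assumes "z \<in> W"
  shows "(\<Sum>k\<in>UNIV. G z $ m $ k * christoffel G k i j z) = chr_low m i j z"
proof -
  have "(\<Sum>k\<in>UNIV. G z $ m $ k * christoffel G k i j z) =
      (\<Sum>k\<in>UNIV. \<Sum>l\<in>UNIV. G z $ m $ k * gi k l z * chr_low l i j z)"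
    unfolding christoffel_chr_low by (simp add: sum_distrib_left mult.assoc)
  also have "\<dots> = (\<Sum>l\<in>UNIV. \<Sum>k\<in>UNIV. G z $ m $ k * gi k l z * chr_low l i j z)"
    by (rule sum.swap)
  also have "\<dots> = (\<Sum>l\<in>UNIV. (if m = l then 1 else 0) * chr_low l i j z)"
    by (simp only: sum_distrib_right[symmetric] gi_mult(1)[OF assms])
  also have "\<dots> = (\<Sum>l\<in>UNIV. if m = l then chr_low l i j z else 0)" by (intro sum.cong) auto
  also have "\<dots> = chr_low m i j z" by simp
  finally show ?thesis .
qed

text \<open>In the sum of two lowered Christoffel symbols everything but the k-derivative cancels;
  the result expresses nabla G = 0.\<close>

lemma metric_compatible:
  assumes "z \<in> W"
  shows "pd k (\<lambda>y. G y $ i $ j) z =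
    (\<Sum>l\<in>UNIV. christoffel G l k i z * G z $ l $ j) + (\<Sum>l\<in>UNIV. G z $ i $ l * christoffel G l k j z)"
proof -
  have "(\<Sum>l\<in>UNIV. christoffel G l k i z * G z $ l $ j) = (\<Sum>l\<in>UNIV. G z $ j $ l * christoffel G l k i z)"
    by (intro sum.cong refl) (simp add: sym_G[OF assms, of j])
  then have "(\<Sum>l\<in>UNIV. christoffel G l k i z * G z $ l $ j) + (\<Sum>l\<in>UNIV. G z $ i $ l * christoffel G l k j z)
      = chr_low j k i z + chr_low i k j z"
    by (simp add: christoffel_lower[OF assms])
  moreover have "pd k (\<lambda>y. G y $ i $ j) z = chr_low j k i z + chr_low i k j z"
    unfolding chr_low_def pd_G_sym[OF assms, of k j i]
    by (simp add: field_simps)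
  ultimately show ?thesis by simp
qed

definition rm :: "'a \<Rightarrow> 'a \<Rightarrow> 'a \<Rightarrow> 'a \<Rightarrow> real^'a \<Rightarrow> real" where
  "rm i j k l z = (\<Sum>m\<in>UNIV. G z $ i $ m * riem_up G m j k l z)"

text \<open>The inner product of nabla_k e_i with nabla_l e_j, where the e_i are the coordinate
  fields.\<close>

definition chr_quad :: "'a \<Rightarrow> 'a \<Rightarrow> 'a \<Rightarrow> 'a \<Rightarrow> real^'a \<Rightarrow> real" where
  "chr_quad k i l j z = (\<Sum>s\<in>UNIV. \<Sum>m\<in>UNIV. christoffel G s k i z * G z $ s $ m * christoffel G m l j z)"

lemma chr_quad_sym:
  assumes "z \<in> W"
  shows "chr_quad k i l j z = chr_quad i k l j z" "chr_quad k i l j z = chr_quad k i j l z"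
    "chr_quad k i l j z = chr_quad l j k i z"
proof -
  show "chr_quad k i l j z = chr_quad i k l j z" "chr_quad k i l j z = chr_quad k i j l z"
    unfolding chr_quad_def
    by (simp_all add: christoffel_sym[OF assms, of _ k i] christoffel_sym[OF assms, of _ l j])
  have "chr_quad k i l j z = (\<Sum>m\<in>UNIV. \<Sum>s\<in>UNIV. christoffel G s k i z * G z $ s $ m * christoffel G m l j z)"
    unfolding chr_quad_def by (rule sum.swap)
  also have "\<dots> = chr_quad l j k i z"
    unfolding chr_quad_def by (intro sum.cong refl) (simp add: sym_G[OF assms])
  finally show "chr_quad k i l j z = chr_quad l j k i z" .
qed

text \<open>Taking the lowering factor into the derivative costs a derivative of G, which metric
  compatibility expands into two products of Christoffel symbols. One is \<open>chr_quad\<close>;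
  the other will cancel against the quadratic part of the curvature.\<close>

lemma lower_pd_christoffel:
  assumes "z \<in> W"
  shows "(\<Sum>m\<in>UNIV. G z $ i $ m * pd k (christoffel G m l j) z) =
    pd k (chr_low i l j) z - chr_quad k i l j z
     - (\<Sum>m\<in>UNIV. \<Sum>s\<in>UNIV. G z $ i $ m * (christoffel G m k s z * christoffel G s l j z))"
proof -
  have "pd k (chr_low i l j) z = pd k (\<lambda>y. \<Sum>m\<in>UNIV. G y $ i $ m * christoffel G m l j y) z"
    by (rule pd_cong_open[OF open_W assms]) (simp add: christoffel_lower)
  also have "\<dots> = (\<Sum>m\<in>UNIV. pd k (\<lambda>y. G y $ i $ m * christoffel G m l j y) z)"
    by (intro pd_sum differentiable_mult diff_G diff_christoffel assms)
  also have "\<dots> = (\<Sum>m\<in>UNIV. G z $ i $ m * pd k (christoffel G m l j) z + pd k (\<lambda>y. G y $ i $ m) z * christoffel G m l j z)"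
    by (intro sum.cong refl pd_mult diff_G diff_christoffel assms)
  finally have *: "pd k (chr_low i l j) z = (\<Sum>m\<in>UNIV. G z $ i $ m * pd k (christoffel G m l j) z) +
     (\<Sum>m\<in>UNIV. pd k (\<lambda>y. G y $ i $ m) z * christoffel G m l j z)"
    by (simp add: sum.distrib)
  have "(\<Sum>m\<in>UNIV. pd k (\<lambda>y. G y $ i $ m) z * christoffel G m l j z) =
     (\<Sum>m\<in>UNIV. \<Sum>s\<in>UNIV. christoffel G s k i z * G z $ s $ m * christoffel G m l j z) +
     (\<Sum>m\<in>UNIV. \<Sum>s\<in>UNIV. G z $ i $ s * (christoffel G s k m z * christoffel G m l j z))"
    by (simp add: metric_compatible[OF assms] distrib_right sum.distrib sum_distrib_right mult.assoc)
  moreover have "(\<Sum>m\<in>UNIV. \<Sum>s\<in>UNIV. christoffel G s k i z * G z $ s $ m * christoffel G m l j z) = chr_quad k i l j z"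
    unfolding chr_quad_def by (rule sum.swap)
  moreover have "(\<Sum>m\<in>UNIV. \<Sum>s\<in>UNIV. G z $ i $ s * (christoffel G s k m z * christoffel G m l j z)) =
      (\<Sum>m\<in>UNIV. \<Sum>s\<in>UNIV. G z $ i $ m * (christoffel G m k s z * christoffel G s l j z))"
    by (rule sum.swap)
  ultimately show ?thesis using * by linarith
qed

text \<open>In this form the symmetries become visible: what is left are second derivatives of G and
  inner products of derivatives of coordinate fields.\<close>

lemma rm_formula:
  assumes "z \<in> W"
  shows "rm i j k l z = pd k (chr_low i l j) z - pd l (chr_low i k j) z - chr_quad k i l j z + chr_quad l i k j z"
proof -
  have "rm i j k l z = (\<Sum>m\<in>UNIV. G z $ i $ m * pd k (christoffel G m l j) z)
     - (\<Sum>m\<in>UNIV. G z $ i $ m * pd l (christoffel G m k j) z)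
     + (\<Sum>m\<in>UNIV. \<Sum>s\<in>UNIV. G z $ i $ m * (christoffel G m k s z * christoffel G s l j z))
     - (\<Sum>m\<in>UNIV. \<Sum>s\<in>UNIV. G z $ i $ m * (christoffel G m l s z * christoffel G s k j z))"
    unfolding rm_def riem_up_def
    by (simp add: distrib_left right_diff_distrib sum.distrib sum_subtractf sum_distrib_left)
  then show ?thesis using lower_pd_christoffel[OF assms, of i k l j] lower_pd_christoffel[OF assms, of i l k j] by linarith
qed

definition ddG :: "'a \<Rightarrow> 'a \<Rightarrow> 'a \<Rightarrow> 'a \<Rightarrow> real^'a \<Rightarrow> real" where
  "ddG a b i j = pd a (pd b (\<lambda>y. G y $ i $ j))"

lemma pd_chr_low:
  assumes "z \<in> W"
  shows "pd k (chr_low i l j) z = (ddG k l j i z + ddG k j l i z - ddG k i l j z) / 2"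
proof -
  have d: "pd a (\<lambda>y. G y $ b $ c) differentiable at z" for a b c
    by (rule smooth_on_differentiable[OF smooth_on_pd[OF smooth_G] open_W assms])
  have "chr_low i l j = (\<lambda>z. (1/2) * (pd l (\<lambda>y. G y $ j $ i) z + pd j (\<lambda>y. G y $ l $ i) z - pd i (\<lambda>y. G y $ l $ j) z))"
    by (auto simp: chr_low_def)
  then have "pd k (chr_low i l j) z = (1/2) * pd k (\<lambda>z. pd l (\<lambda>y. G y $ j $ i) z + pd j (\<lambda>y. G y $ l $ i) z - pd i (\<lambda>y. G y $ l $ j) z) z"
    by (simp only:) (intro pd_cmult differentiable_add differentiable_diff d)
  also have "\<dots> = (1/2) * (pd k (pd l (\<lambda>y. G y $ j $ i)) z + pd k (pd j (\<lambda>y. G y $ l $ i)) z - pd k (pd i (\<lambda>y. G y $ l $ j)) z)"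
    by (subst pd_diff, intro differentiable_add d, rule d, subst pd_add, rule d, rule d) (rule refl)
  finally show ?thesis by (simp add: ddG_def)
qed

lemma ddG_sym:
  assumes "z \<in> W"
  shows "ddG a b i j z = ddG b a i j z" "ddG a b i j z = ddG a b j i z"
  unfolding ddG_def
  by (rule smooth_on_pd_commute[OF open_W smooth_G assms])
    (rule pd_cong_open[OF open_W assms pd_G_sym])

text \<open>After expansion into \<open>ddG\<close> and \<open>chr_quad\<close> each identity is
  linear in these quantities, modulo their own symmetries.\<close>

lemma rm_symmetries:
  assumes "z \<in> W"
  shows "rm i j k l z = - rm j i k l z" "rm i j k l z = - rm i j l k z"
    "rm i j k l z = rm k l i j z" "rm i j k l z + rm i k l j z + rm i l j k z = 0"
proof -
  note q = chr_quad_sym[OF assms]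
  note d = ddG_sym[OF assms]
  have f: "rm i j k l z = (ddG k j i l z - ddG k i j l z - ddG l j i k z + ddG l i j k z) / 2
     - chr_quad k i l j z + chr_quad l i k j z" for i j k l
    unfolding rm_formula[OF assms] pd_chr_low[OF assms] add_divide_distrib diff_divide_distrib
    using d(1)[of k l j i] d(2)[of k j l i] d(2)[of k i l j] d(2)[of l j k i] d(2)[of l i k j]
    by linarith
  show "rm i j k l z = - rm j i k l z"
    unfolding f add_divide_distrib diff_divide_distrib using q(3)[of l i k j] q(3)[of k i l j] by linarith
  show "rm i j k l z = - rm i j l k z"
    unfolding f add_divide_distrib diff_divide_distrib by linarith
  show "rm i j k l z = rm k l i j z"
    unfolding f add_divide_distrib diff_divide_distrib using d(1)[of k j i l] d(1)[of k i j l] d(1)[of l j i k] d(1)[of l i j k]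
      d(2)[of j k i l] d(2)[of i k j l] d(2)[of j l i k] d(2)[of i l j k]
      q(1)[of k i l j] q(2)[of i k l j] q(1)[of l i k j] q(3)[of i l k j] q(1)[of k j i l]
    by linarith
  show "rm i j k l z + rm i k l j z + rm i l j k z = 0"
    unfolding f add_divide_distrib diff_divide_distrib using d(1)[of k j i l] d(2)[of k i j l] d(1)[of l j i k] d(2)[of l i j k] d(1)[of l k i j] d(2)[of j i k l]
      q(2)[of k i l j] q(2)[of l i k j] q(2)[of j i l k]
    by linarith
qed

end

subsection \<open>Slot permutations and alternation\<close>

text \<open>Slot s of the result is slot \<open>f s\<close> of the argument. This is a right action:
  permuting by \<tau> and then by \<kappa> is permuting by \<tau> \<circ> \<kappa>.\<close>

definition permI :: "(nat \<Rightarrow> nat) \<Rightarrow> 'a list \<Rightarrow> 'a list" where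
  "permI f I = map (\<lambda>s. I ! f s) [0..<length I]"

lemma length_permI [simp]: "length (permI f I) = length I"
  by (simp add: permI_def)

lemma nth_permI [simp]: "s < length I \<Longrightarrow> permI f I ! s = I ! f s"
  by (simp add: permI_def)

lemma permI_id [simp]: "permI id I = I" "permI (\<lambda>x. x) I = I"
  by (auto simp: permI_def intro: nth_equalityI)

lemma permI_update:
  assumes "\<tau> permutes {..<length I}" "k < length I"
  shows "(permI \<tau> I)[k := d] = permI \<tau> (I[\<tau> k := d])"
proof (rule nth_equalityI)
  fix s assume "s < length ((permI \<tau> I)[k := d])"
  then have s: "s < length I" by simp
  have "\<tau> s < length I" "\<tau> k < length I" using assms s permutes_in_image[OF assms(1)] by auto
  moreover have "\<tau> k = \<tau> s \<longleftrightarrow> k = s" using permutes_inj[OF assms(1)] by (auto dest: injD)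
  ultimately show "(permI \<tau> I)[k := d] ! s = permI \<tau> (I[\<tau> k := d]) ! s"
    using s by (auto simp: nth_list_update)
qed simp

lemma permI_compose:
  assumes "\<kappa> permutes {..<length I}"
  shows "permI \<kappa> (permI \<tau> I) = permI (\<tau> \<circ> \<kappa>) I"
proof (rule nth_equalityI)
  fix s assume "s < length (permI \<kappa> (permI \<tau> I))"
  then have s: "s < length I" by simp
  have "\<kappa> s < length I" using permutes_in_image[OF assms] s by auto
  then show "permI \<kappa> (permI \<tau> I) ! s = permI (\<tau> \<circ> \<kappa>) I ! s" using s by simp
qed simp

lemma permI4: "permI \<tau> [i,j,k,l] = [[i,j,k,l] ! \<tau> 0, [i,j,k,l] ! \<tau> 1, [i,j,k,l] ! \<tau> 2, [i,j,k,l] ! \<tau> 3]"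
  by (simp add: permI_def upt_rec numeral_3_eq_3 numeral_2_eq_2)

text \<open>X antisymmetrized over the slots in K is zero, the other slots being fixed. This is the
  property that makes a contraction of all slots in K with an alternating tensor vanish.\<close>

definition alt_vanishes :: "nat \<Rightarrow> ('a list \<Rightarrow> real) \<Rightarrow> nat set \<Rightarrow> bool" where
  "alt_vanishes m X K \<longleftrightarrow> (\<forall>I. length I = m \<longrightarrow>
     (\<Sum>\<tau> | \<tau> permutes K. of_int (sign \<tau>) * X (permI \<tau> I)) = 0)"

text \<open>Relabelling of slots by an injection. It carries an alternation inside one factor to the
  slots that this factor occupies in a derivative or in a product.\<close>

lemma sum_permutations_image:
  assumes "inj f" "finite K"
  shows "(\<Sum>\<tau> | \<tau> permutes f ` K. of_int (sign \<tau>) * F \<tau>) =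
    (\<Sum>\<tau> | \<tau> permutes K. of_int (sign \<tau>) * (F (map_permutation K f \<tau>) :: real))"
proof (rule sum.reindex_bij_witness[where j = "map_permutation (f ` K) (inv f)" and i = "map_permutation K f"])
  have ij: "inj_on f K" using assms(1) inj_on_subset by blast
  have ij': "inj_on (inv f) (f ` K)" by (rule inj_onI) (use assms(1) in auto)
  have im: "inv f ` f ` K = K" using assms(1) by (simp add: image_image)
  fix \<tau> assume t: "\<tau> \<in> {\<tau>. \<tau> permutes f ` K}"
  show "map_permutation K f (map_permutation (f ` K) (inv f) \<tau>) = \<tau>"
    using t ij' assms im by (intro map_permutation_compose_inv) (auto simp: bij_betw_def)
  show "map_permutation (f ` K) (inv f) \<tau> \<in> {\<tau>. \<tau> permutes K}"
    using t ij' im by (auto intro!: map_permutation_permutes simp: bij_betw_def)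
  then show "of_int (sign (map_permutation (f ` K) (inv f) \<tau>)) *
      F (map_permutation K f (map_permutation (f ` K) (inv f) \<tau>)) = of_int (sign \<tau>) * F \<tau>"
    using t ij' assms \<open>map_permutation K f (map_permutation (f ` K) (inv f) \<tau>) = \<tau>\<close>
    by (simp add: sign_map_permutation)
next
  have ij: "inj_on f K" using assms(1) inj_on_subset by blast
  fix \<tau> assume t: "\<tau> \<in> {\<tau>. \<tau> permutes K}"
  show "map_permutation (f ` K) (inv f) (map_permutation K f \<tau>) = \<tau>"
    using t ij assms by (intro map_permutation_compose_inv) (auto simp: bij_betw_def)
  show "map_permutation K f \<tau> \<in> {\<tau>. \<tau> permutes f ` K}"
    using t ij by (auto intro!: map_permutation_permutes simp: bij_betw_def)
qed

lemma map_permutation_inj_apply: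
  assumes "inj f" "\<tau> permutes K"
  shows "map_permutation K f \<tau> (f x) = f (\<tau> x)"
proof (cases "x \<in> K")
  case True
  then show ?thesis using assms by (intro map_permutation_apply) (auto intro: inj_on_subset)
next
  case False
  then have "f x \<notin> f ` K" using assms(1) by (auto dest: injD)
  then show ?thesis using False assms(2) by (simp add: map_permutation_def restrict_id_def permutes_not_in)
qed

lemma map_permutation_not_in_image:
  "y \<notin> f ` K \<Longrightarrow> map_permutation K f \<tau> y = y"
  by (simp add: map_permutation_def restrict_id_def)

lemma sum_permutations_singleton: "(\<Sum>\<tau> | \<tau> permutes {a}. F \<tau>) = F id"
proof -
  have "{\<tau>. \<tau> permutes {a}} = {id}" by auto
  then show ?thesis by simp
qed

lemma sum_permutations_three:
  fixes F :: "('x \<Rightarrow> 'x) \<Rightarrow> real"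
  assumes "a \<noteq> b" "a \<noteq> c" "b \<noteq> c"
  shows "(\<Sum>\<tau> | \<tau> permutes {a, b, c}. of_int (sign \<tau>) * F \<tau>) =
    F id - F (Transposition.transpose b c) - F (Transposition.transpose a b) + F (Transposition.transpose a b \<circ> Transposition.transpose b c)
    - F (Transposition.transpose a c) + F (Transposition.transpose a c \<circ> Transposition.transpose b c)"
  using assms
  by (simp add: sum_over_permutations_insert sum_permutations_singleton sign_compose sign_swap_id
      permutation_swap_id permutation_compose)

context smooth_metric
begin

subsection \<open>Covariant derivatives\<close>

definition smooth_tens :: "nat \<Rightarrow> 'a tensor \<Rightarrow> bool" where
  "smooth_tens m S \<longleftrightarrow> (\<forall>I. length I = m \<longrightarrow> smooth_on W (S I))"

lemma smooth_nabla:
  assumes "smooth_tens m S"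
  shows "smooth_tens (Suc m) (nabla G S)"
  unfolding smooth_tens_def
proof (intro allI impI)
  fix I :: "'a list" assume "length I = Suc m"
  then obtain a J where I: "I = a # J" "length J = m" by (cases I) auto
  have e: "nabla G S I = (\<lambda>z. pd a (S J) z -
     (\<Sum>k<length J. \<Sum>d\<in>UNIV. christoffel G d a (J ! k) z * S (J[k := d]) z))"
    by (rule ext) (simp add: nabla_def I)
  have s: "smooth_on W (S J')" if "length J' = m" for J' using assms that by (simp add: smooth_tens_def)
  show "smooth_on W (nabla G S I)"
    unfolding e
    by (intro smooth_on_diff smooth_on_sum smooth_on_mult smooth_on_pd smooth_christoffel open_W s)
      (simp_all add: I)
qed

lemma smooth_riem: "smooth_tens 4 (riem G)"
  unfolding smooth_tens_def
proof (intro allI impI)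
  fix I :: "'a list"
  have e: "riem G I = (\<lambda>z. \<Sum>m\<in>UNIV. G z $ (I!0) $ m * riem_up G m (I!1) (I!2) (I!3) z)"
    by (rule ext) (simp add: riem_def)
  show "smooth_on W (riem G I)"
    unfolding e by (intro smooth_on_sum smooth_on_mult smooth_G smooth_riem_up open_W)
qed

lemma smooth_nabla_power: "smooth_tens m S \<Longrightarrow> smooth_tens (r + m) ((nabla G ^^ r) S)"
  by (induction r) (auto intro: smooth_nabla)

text \<open>Covariant differentiation commutes with permutations of the slots, so it preserves
  linear relations between permuted copies of a tensor. An indexed family of permutations covers
  pair symmetries, the Bianchi identity and full alternations at once.\<close>

lemma nabla_linear_relation:
  fixes \<tau> :: "'x \<Rightarrow> nat \<Rightarrow> nat" and c :: "'x \<Rightarrow> real"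
  assumes S: "smooth_tens m S" and A: "finite A" "\<And>x. x \<in> A \<Longrightarrow> \<tau> x permutes {..<m}"
    and rel: "\<And>I z. length I = m \<Longrightarrow> z \<in> W \<Longrightarrow> (\<Sum>x\<in>A. c x * S (permI (\<tau> x) I) z) = 0"
    and I: "length I = m" and z: "z \<in> W"
  shows "(\<Sum>x\<in>A. c x * nabla G S (a # permI (\<tau> x) I) z) = 0"
proof -
  have d: "S J differentiable at z" if "length J = m" for J
    using S that smooth_on_differentiable[OF _ open_W z] by (auto simp: smooth_tens_def)
  have "(\<Sum>x\<in>A. c x * pd a (S (permI (\<tau> x) I)) z) = pd a (\<lambda>y. \<Sum>x\<in>A. c x * S (permI (\<tau> x) I) y) z"
    by (subst pd_sum) (auto intro!: sum.cong pd_cmult[symmetric] d differentiable_mult simp: I)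
  also have "\<dots> = pd a (\<lambda>y. 0) z"
    by (rule pd_cong_open[OF open_W z]) (rule rel[OF I])
  finally have 1: "(\<Sum>x\<in>A. c x * pd a (S (permI (\<tau> x) I)) z) = 0" by simp
  \<comment> \<open>Replacing entry k of the permuted list amounts to replacing entry \<tau> k of I
    before permuting; the sum over k then absorbs \<tau>.\<close>
  have 2: "(\<Sum>k<m. \<Sum>d\<in>UNIV. christoffel G d a (permI (\<tau> x) I ! k) z * S ((permI (\<tau> x) I)[k := d]) z) =
      (\<Sum>k<m. \<Sum>d\<in>UNIV. christoffel G d a (I ! k) z * S (permI (\<tau> x) (I[k := d])) z)" if x: "x \<in> A" for x
  proof -
    have "(\<Sum>k<m. \<Sum>d\<in>UNIV. christoffel G d a (permI (\<tau> x) I ! k) z * S ((permI (\<tau> x) I)[k := d]) z) =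
      (\<Sum>k<m. \<Sum>d\<in>UNIV. christoffel G d a (I ! \<tau> x k) z * S (permI (\<tau> x) (I[\<tau> x k := d])) z)"
      using A(2)[OF x] I by (intro sum.cong refl) (simp add: permI_update)
    also have "\<dots> = (\<Sum>k<m. \<Sum>d\<in>UNIV. christoffel G d a (I ! k) z * S (permI (\<tau> x) (I[k := d])) z)"
      using sum.reindex_bij_betw[OF permutes_imp_bij[OF A(2)[OF x]],
          of "\<lambda>k. \<Sum>d\<in>UNIV. christoffel G d a (I ! k) z * S (permI (\<tau> x) (I[k := d])) z"] by simp
    finally show ?thesis .
  qed
  have "(\<Sum>x\<in>A. c x * (\<Sum>k<m. \<Sum>d\<in>UNIV. christoffel G d a (I ! k) z * S (permI (\<tau> x) (I[k := d])) z)) =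
      (\<Sum>k<m. \<Sum>d\<in>UNIV. \<Sum>x\<in>A. christoffel G d a (I ! k) z * (c x * S (permI (\<tau> x) (I[k := d])) z))"
    by (simp only: sum_distrib_left) (subst sum.swap, intro sum.cong refl, subst sum.swap, simp add: mult_ac)
  also have "\<dots> = (\<Sum>k<m. \<Sum>d\<in>UNIV. christoffel G d a (I ! k) z * (\<Sum>x\<in>A. c x * S (permI (\<tau> x) (I[k := d])) z))"
    by (simp only: sum_distrib_left)
  also have "\<dots> = 0" using rel[OF _ z] I by simp
  finally have 3: "(\<Sum>x\<in>A. c x * (\<Sum>k<m. \<Sum>d\<in>UNIV. christoffel G d a (I ! k) z * S (permI (\<tau> x) (I[k := d])) z)) = 0" .
  have "(\<Sum>x\<in>A. c x * nabla G S (a # permI (\<tau> x) I) z) =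
     (\<Sum>x\<in>A. c x * pd a (S (permI (\<tau> x) I)) z) -
     (\<Sum>x\<in>A. c x * (\<Sum>k<m. \<Sum>d\<in>UNIV. christoffel G d a (I ! k) z * S (permI (\<tau> x) (I[k := d])) z))"
    unfolding sum_subtractf[symmetric]
    by (intro sum.cong refl) (simp only: nabla_def list.sel length_permI I 2 right_diff_distrib)
  then show ?thesis using 1 3 by simp
qed

text \<open>The new derivative index occupies slot 0, which moves every old slot up by one.\<close>

lemma alt_vanishes_nabla:
  assumes S: "smooth_tens m S" and K: "K \<subseteq> {..<m}" "\<And>z. z \<in> W \<Longrightarrow> alt_vanishes m (\<lambda>I. S I z) K"
    and z: "z \<in> W"
  shows "alt_vanishes (Suc m) (\<lambda>I. nabla G S I z) (Suc ` K)"
  unfolding alt_vanishes_def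
proof (intro allI impI)
  fix I :: "'a list" assume "length I = Suc m"
  then obtain a J where I: "I = a # J" "length J = m" by (cases I) auto
  have fK: "finite K" using K(1) finite_subset by blast
  have "permI (map_permutation K Suc \<tau>) I = a # permI \<tau> J" if t: "\<tau> permutes K" for \<tau>
  proof (rule nth_equalityI)
    fix s assume "s < length (permI (map_permutation K Suc \<tau>) I)"
    then have s: "s < Suc m" by (simp add: I)
    show "permI (map_permutation K Suc \<tau>) I ! s = (a # permI \<tau> J) ! s"
    proof (cases s)
      case 0
      then show ?thesis using s by (simp add: I map_permutation_not_in_image)
    next
      case (Suc u)
      then show ?thesis using s by (simp add: I map_permutation_inj_apply[OF _ t])
    qed
  qed (simp add: I)
  then have "(\<Sum>\<tau> | \<tau> permutes Suc ` K. of_int (sign \<tau>) * nabla G S (permI \<tau> I) z) =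
      (\<Sum>\<tau> | \<tau> permutes K. of_int (sign \<tau>) * nabla G S (a # permI \<tau> J) z)"
    by (subst sum_permutations_image) (auto simp: fK)
  also have "\<dots> = 0"
  proof (rule nabla_linear_relation[OF S, of _ id, unfolded id_apply])
    show "finite {\<tau>. \<tau> permutes K}" using fK finite_permutations by blast
    show "\<tau> permutes {..<m}" if "\<tau> \<in> {\<tau>. \<tau> permutes K}" for \<tau>
      using that permutes_subset K(1) by blast
  qed (use K(2) I z in \<open>auto simp: alt_vanishes_def\<close>)
  finally show "(\<Sum>\<tau> | \<tau> permutes Suc ` K. of_int (sign \<tau>) * nabla G S (permI \<tau> I) z) = 0" .
qed

lemma alt_vanishes_nabla_power:
  assumes S: "smooth_tens m S" and K: "K \<subseteq> {..<m}" "\<And>z. z \<in> W \<Longrightarrow> alt_vanishes m (\<lambda>I. S I z) K"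
    and z: "z \<in> W"
  shows "alt_vanishes (r + m) (\<lambda>I. (nabla G ^^ r) S I z) ((+) r ` K)"
  using z
proof (induction r arbitrary: z)
  case (Suc r)
  have "alt_vanishes (Suc (r + m)) (\<lambda>I. nabla G ((nabla G ^^ r) S) I z) (Suc ` (+) r ` K)"
    by (rule alt_vanishes_nabla[OF smooth_nabla_power[OF S] _ Suc.IH Suc.prems]) (use K in auto)
  then show ?case by (simp add: image_image)
qed (use K in simp)

lemma riem_rm: "riem G [i, j, k, l] z = rm i j k l z"
  by (simp add: riem_def rm_def numeral_3_eq_3 numeral_2_eq_2)

abbreviation nrm :: "'a \<Rightarrow> 'a \<Rightarrow> 'a \<Rightarrow> 'a \<Rightarrow> 'a \<Rightarrow> real^'a \<Rightarrow> real" where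
  "nrm a i j k l z \<equiv> nabla G (riem G) [a, i, j, k, l] z"

lemma nrm_linear_relation:
  fixes \<tau> :: "'x \<Rightarrow> nat \<Rightarrow> nat" and c :: "'x \<Rightarrow> real"
  assumes "finite A" "\<And>x. x \<in> A \<Longrightarrow> \<tau> x permutes {..<4}"
    and "\<And>i j k l z. z \<in> W \<Longrightarrow> (\<Sum>x\<in>A. c x * riem G (permI (\<tau> x) [i,j,k,l]) z) = 0"
    and "z \<in> W"
  shows "(\<Sum>x\<in>A. c x * nabla G (riem G) (a # permI (\<tau> x) [i,j,k,l]) z) = 0"
proof (rule nabla_linear_relation[OF smooth_riem assms(1,2)])
  show "(\<Sum>x\<in>A. c x * riem G (permI (\<tau> x) I) z) = 0" if "length I = 4" "z \<in> W" for I z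
  proof -
    have "I = [I ! 0, I ! 1, I ! 2, I ! 3]"
      using that(1) by (intro nth_equalityI) (auto simp: less_Suc_eq numeral_eq_Suc)
    then show ?thesis using assms(3)[OF that(2), of "I ! 0" "I ! 1" "I ! 2" "I ! 3"] by simp
  qed
qed (use assms in auto)

lemma nrm_symmetries:
  assumes z: "z \<in> W"
  shows "nrm a i j k l z = - nrm a j i k l z" "nrm a i j k l z = - nrm a i j l k z"
    "nrm a i j k l z = nrm a k l i j z" "nrm a i j k l z + nrm a i k l j z + nrm a i l j k z = 0"
proof -
  have "(\<Sum>x\<in>{True,False}. 1 * nabla G (riem G) (a # permI (if x then id else Transposition.transpose 0 1) [i,j,k,l]) z) = 0"
  proof (rule nrm_linear_relation[OF _ _ _ z])
    show "(\<Sum>x\<in>{True,False}. 1 * riem G (permI (if x then id else Transposition.transpose 0 1) [i,j,k,l]) z) = 0" if "z \<in> W" for i j k l z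
      using rm_symmetries(1)[OF that, of i j k l] by (simp add: permI4 riem_rm Transposition.transpose_def)
  qed (auto simp: permutes_id intro: permutes_swap_id)
  then show "nrm a i j k l z = - nrm a j i k l z" by (simp add: permI4 Transposition.transpose_def)
  have "(\<Sum>x\<in>{True,False}. 1 * nabla G (riem G) (a # permI (if x then id else Transposition.transpose 2 3) [i,j,k,l]) z) = 0"
  proof (rule nrm_linear_relation[OF _ _ _ z])
    show "(\<Sum>x\<in>{True,False}. 1 * riem G (permI (if x then id else Transposition.transpose 2 3) [i,j,k,l]) z) = 0" if "z \<in> W" for i j k l z
      using rm_symmetries(2)[OF that, of i j k l] by (simp add: permI4 riem_rm Transposition.transpose_def numeral_eq_Suc)
  qed (auto simp: permutes_id intro: permutes_swap_id)
  then show "nrm a i j k l z = - nrm a i j l k z" by (simp add: permI4 Transposition.transpose_def numeral_eq_Suc)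
  have "(\<Sum>x\<in>{True,False}. (if x then 1 else -1) * nabla G (riem G) (a # permI (if x then id else Transposition.transpose 0 2 \<circ> Transposition.transpose 1 3) [i,j,k,l]) z) = 0"
  proof (rule nrm_linear_relation[OF _ _ _ z])
    show "(\<Sum>x\<in>{True,False}. (if x then 1 else -1) * riem G (permI (if x then id else Transposition.transpose 0 2 \<circ> Transposition.transpose 1 3) [i,j,k,l]) z) = 0" if "z \<in> W" for i j k l z
      using rm_symmetries(3)[OF that, of i j k l] by (simp add: permI4 riem_rm Transposition.transpose_def numeral_eq_Suc)
  qed (auto simp: permutes_id intro!: permutes_compose permutes_swap_id)
  then show "nrm a i j k l z = nrm a k l i j z" by (simp add: permI4 Transposition.transpose_def numeral_eq_Suc)
  \<comment> \<open>The three cyclic rotations of the slots 1, 2, 3.\<close>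
  let ?\<tau> = "\<lambda>x::nat. if x = 0 then id else if x = 1 then Transposition.transpose 1 2 \<circ> Transposition.transpose 2 3 else Transposition.transpose 1 3 \<circ> Transposition.transpose 2 (3::nat)"
  have "(\<Sum>x\<in>{0,1,2}. 1 * nabla G (riem G) (a # permI (?\<tau> x) [i,j,k,l]) z) = 0"
  proof (rule nrm_linear_relation[OF _ _ _ z])
    show "(\<Sum>x\<in>{0,1,2}. 1 * riem G (permI (?\<tau> x) [i,j,k,l]) z) = 0" if "z \<in> W" for i j k l z
      using rm_symmetries(4)[OF that, of i j k l] by (simp add: permI4 riem_rm Transposition.transpose_def numeral_eq_Suc)
  qed (auto simp: permutes_id intro!: permutes_compose permutes_swap_id)
  then show "nrm a i j k l z + nrm a i k l j z + nrm a i l j k z = 0" by (simp add: permI4 Transposition.transpose_def numeral_eq_Suc)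
qed

end

section \<open>Alternation of curvature over three slots\<close>

lemma curvature_orbit:
  fixes R :: "'a \<Rightarrow> 'a \<Rightarrow> 'a \<Rightarrow> 'a \<Rightarrow> real"
  assumes s: "\<And>i j k l. R i j k l = - R j i k l" "\<And>i j k l. R i j k l = - R i j l k"
    "\<And>i j k l. R i j k l = R k l i j"
  shows "R j i k l = - R i j k l" "R i j l k = - R i j k l" "R j i l k = R i j k l"
    "R k l i j = R i j k l" "R l k i j = - R i j k l" "R k l j i = - R i j k l" "R l k j i = R i j k l"
  using s(1)[of i j k l] s(2)[of i j k l] s(2)[of j i k l] s(3)[of i j k l]
    s(3)[of i j l k] s(3)[of j i k l] s(3)[of j i l k]
  by simp_all

text \<open>By the pair symmetries the six terms coincide in pairs up to sign, and what remains is
  twice a cyclic Bianchi sum with one index fixed.\<close>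

lemma alt_curvature:
  fixes R :: "'a list \<Rightarrow> real"
  assumes s: "\<And>i j k l. R [i,j,k,l] = - R [j,i,k,l]" "\<And>i j k l. R [i,j,k,l] = - R [i,j,l,k]"
    "\<And>i j k l. R [i,j,k,l] = R [k,l,i,j]"
    and b: "\<And>i j k l. R [i,j,k,l] + R [i,k,l,j] + R [i,l,j,k] = 0"
    and K: "K \<in> {{0,1,2},{0,1,3},{0,2,3},{1,2,3}}"
  shows "alt_vanishes 4 R K"
  unfolding alt_vanishes_def
proof (intro allI impI)
  fix I :: "'a list" assume "length I = 4"
  then have I: "I = [I ! 0, I ! 1, I ! 2, I ! 3]"
    by (intro nth_equalityI) (auto simp: less_Suc_eq numeral_eq_Suc)
  obtain i j k l where I: "I = [i,j,k,l]" using I by metis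
  note o = curvature_orbit[of "\<lambda>i j k l. R [i,j,k,l]", OF s]
  note e = o[of i j k l] o[of i k l j] o[of i l j k] b[of i j k l]
  show "(\<Sum>\<tau> | \<tau> permutes K. of_int (sign \<tau>) * R (permI \<tau> I)) = 0"
    using K unfolding insert_iff empty_iff
    by (elim disjE FalseE; simp add: sum_permutations_three permI4 I Transposition.transpose_def)
      (use e in \<open>simp_all add: numeral_eq_Suc\<close>)
qed

lemma permI5: "permI \<tau> [a,i,j,k,l] = [[a,i,j,k,l] ! \<tau> 0, [a,i,j,k,l] ! \<tau> 1, [a,i,j,k,l] ! \<tau> 2, [a,i,j,k,l] ! \<tau> 3, [a,i,j,k,l] ! \<tau> 4]"
  by (simp add: permI_def upt_rec numeral_eq_Suc)

text \<open>Slot 0 is the derivative index, and only sets containing it are listed; the others come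
  from the undifferentiated tensor. \<open>c34\<close> is the differential Bianchi identity, and the
  remaining cases are reduced to it by the algebraic symmetries.\<close>

lemma alt_curvature_derivative:
  fixes R :: "'a list \<Rightarrow> real"
  assumes s: "\<And>a i j k l. R [a,i,j,k,l] = - R [a,j,i,k,l]" "\<And>a i j k l. R [a,i,j,k,l] = - R [a,i,j,l,k]"
    "\<And>a i j k l. R [a,i,j,k,l] = R [a,k,l,i,j]"
    and b: "\<And>a i j k l. R [a,i,j,k,l] + R [a,i,k,l,j] + R [a,i,l,j,k] = 0"
    and b2: "\<And>a i j k l. R [a,i,j,k,l] + R [k,i,j,l,a] + R [l,i,j,a,k] = 0"
    and K: "K \<in> {{0,1,2},{0,1,3},{0,1,4},{0,2,3},{0,2,4},{0,3,4}}"
  shows "alt_vanishes 5 R K"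
  unfolding alt_vanishes_def
proof (intro allI impI)
  fix I :: "'a list" assume "length I = 5"
  then have I: "I = [I ! 0, I ! 1, I ! 2, I ! 3, I ! 4]"
    by (intro nth_equalityI) (auto simp: less_Suc_eq numeral_eq_Suc)
  obtain a i j k l where I: "I = [a,i,j,k,l]" using I by metis
  have o: "R [a,j,i,k,l] = - R [a,i,j,k,l]" "R [a,i,j,l,k] = - R [a,i,j,k,l]" "R [a,j,i,l,k] = R [a,i,j,k,l]"
    "R [a,k,l,i,j] = R [a,i,j,k,l]" "R [a,l,k,i,j] = - R [a,i,j,k,l]" "R [a,k,l,j,i] = - R [a,i,j,k,l]"
    "R [a,l,k,j,i] = R [a,i,j,k,l]" for a i j k l
    by (rule curvature_orbit[of "\<lambda>i j k l. R [a,i,j,k,l]", OF s])+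
  have c34: "R [a,i,j,k,l] - R [a,i,j,l,k] - R [k,i,j,a,l] + R [k,i,j,l,a] - R [l,i,j,k,a] + R [l,i,j,a,k] = 0"
    for a i j k l
    using b2[of a i j k l] s(2)[of a i j l k] s(2)[of k i j a l] s(2)[of l i j k a] by linarith
  have c12: "R [a,i,j,k,l] - R [a,j,i,k,l] - R [i,a,j,k,l] + R [i,j,a,k,l] - R [j,i,a,k,l] + R [j,a,i,k,l] = 0"
    for a i j k l
    using c34[of a k l i j] s(3) by metis
  have c13: "R [a,i,j,k,l] - R [a,k,j,i,l] - R [i,a,j,k,l] + R [i,k,j,a,l] - R [k,i,j,a,l] + R [k,a,j,i,l] = 0"
    for a i j k l
  proof -
    \<comment> \<open>The first Bianchi identity turns the difference under exchange of slots 1 and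
      3 into one component in which the two indices form the first pair, the situation of
      \<open>c12\<close>.\<close>
    have d: "R [x,p,j,q,l] - R [x,q,j,p,l] = R [x,p,q,j,l]" for x p q
      using o[of x p j q l] o[of x p q l j] o[of x p l j q] b[of x p j q l] by linarith
    show ?thesis using d[of a i k] d[of i a k] d[of k i a] c12[of a i k j l]
        s(1)[of a i k j l] s(1)[of i a k j l] s(1)[of k i a j l] by linarith
  qed
  have c14: "R [a,i,j,k,l] - R [a,l,j,k,i] - R [i,a,j,k,l] + R [i,l,j,k,a] - R [l,i,j,k,a] + R [l,a,j,k,i] = 0"
    for a i j k l
    using c13[of a i j l k] s(2)[of a i j k l] s(2)[of a l j k i] s(2)[of i a j k l] s(2)[of i l j k a]
      s(2)[of l i j k a] s(2)[of l a j k i] by linarith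
  have c23: "R [a,i,j,k,l] - R [a,i,k,j,l] - R [j,i,a,k,l] + R [j,i,k,a,l] - R [k,i,j,a,l] + R [k,i,a,j,l] = 0"
    for a i j k l
    using c13[of a j i k l] s(1)[of a i j k l] s(1)[of a i k j l] s(1)[of j i a k l] s(1)[of j i k a l]
      s(1)[of k i j a l] s(1)[of k i a j l] by linarith
  have c24: "R [a,i,j,k,l] - R [a,i,l,k,j] - R [j,i,a,k,l] + R [j,i,l,k,a] - R [l,i,j,k,a] + R [l,i,a,k,j] = 0"
    for a i j k l
    using c14[of a j i k l] s(1)[of a i j k l] s(1)[of a i l k j] s(1)[of j i a k l] s(1)[of j i l k a]
      s(1)[of l i j k a] s(1)[of l i a k j] by linarith
  show "(\<Sum>\<tau> | \<tau> permutes K. of_int (sign \<tau>) * R (permI \<tau> I)) = 0"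
    using K unfolding insert_iff empty_iff
    by (elim disjE FalseE; simp add: sum_permutations_three permI5 I Transposition.transpose_def)
      (use c12[of a i j k l] c13[of a i j k l] c14[of a i j k l] c23[of a i j k l] c24[of a i j k l] c34[of a i j k l]
        in \<open>simp_all add: numeral_eq_Suc\<close>)
qed

section \<open>The differential Bianchi identity, and curvature contracted with the dilation
  field\<close>

context smooth_metric
begin

text \<open>With the Christoffel symbols as a matrix-valued 1-form \<Gamma>, the curvature is the
  2-form U = d\<Gamma> + \<Gamma> \<and> \<Gamma>, and the identity is dU + [\<Gamma>, U] = 0. The
  Christoffel terms of the two form indices drop out of the cyclic sum.\<close>

lemma second_bianchi:
  assumes z: "z \<in> W"
  shows "nrm a i j k l z + nrm k i j l a z + nrm l i j a k z = 0"
proof -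
  define \<Gamma> where "\<Gamma> b = (\<chi> m s. christoffel G m b s z)" for b
  define D where "D c b = (\<chi> m s. pd c (christoffel G m b s) z)" for c b
  define DD where "DD d c b = (\<chi> m s. pd d (pd c (christoffel G m b s)) z)" for d c b
  define U where "U b c = (\<chi> m s. riem_up G m s b c z)" for b c
  define dU where "dU d b c = (\<chi> m s. pd d (riem_up G m s b c) z)" for d b c
  \<comment> \<open>V differentiates U covariantly in its matrix indices only.\<close>
  define V where "V d b c = dU d b c + \<Gamma> d ** U b c - U b c ** \<Gamma> d" for d b c
  have dpd: "pd b (christoffel G m c s) differentiable at z" for b m c s
    by (rule smooth_on_differentiable[OF smooth_on_pd[OF smooth_christoffel] open_W z])
  note dc = diff_christoffel[OF z]
  have DDs: "DD d c b = DD c d b" for d c b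
    unfolding DD_def by (simp add: vec_eq_iff smooth_on_pd_commute[OF open_W smooth_christoffel z, of d c])
  have Ue: "U b c = D b c - D c b + \<Gamma> b ** \<Gamma> c - \<Gamma> c ** \<Gamma> b" for b c
    by (simp add: vec_eq_iff U_def D_def \<Gamma>_def riem_up_def matrix_matrix_mult_def sum_subtractf)
  have dUe: "dU d b c = DD d b c - DD d c b + (D d b ** \<Gamma> c + \<Gamma> b ** D d c) - (D d c ** \<Gamma> b + \<Gamma> c ** D d b)" for d b c
  proof -
    have "pd d (riem_up G m s b c) z = pd d (pd b (christoffel G m c s)) z - pd d (pd c (christoffel G m b s)) z
      + (\<Sum>t\<in>UNIV. (christoffel G m b t z * pd d (christoffel G t c s) z + pd d (christoffel G m b t) z * christoffel G t c s z)
        - (christoffel G m c t z * pd d (christoffel G t b s) z + pd d (christoffel G m c t) z * christoffel G t b s z))" for m s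
    proof -
      have e: "riem_up G m s b c = (\<lambda>z. (pd b (christoffel G m c s) z - pd c (christoffel G m b s) z) +
        (\<Sum>t\<in>UNIV. christoffel G m b t z * christoffel G t c s z - christoffel G m c t z * christoffel G t b s z))"
        by (rule ext) (simp add: riem_up_def)
      show ?thesis
        unfolding e
        by (simp add: pd_add pd_diff pd_sum pd_mult dpd dc differentiable_diff differentiable_sum differentiable_mult)
    qed
    then show ?thesis
      by (simp add: vec_eq_iff dU_def DD_def D_def \<Gamma>_def matrix_matrix_mult_def sum_subtractf sum.distrib)
  qed
  have ms: "A ** (B - C) = A ** B - A ** C" "(B - C) ** A = B ** A - C ** A" for A B C :: "real^'a^'a"
    by (simp_all add: vec_eq_iff matrix_matrix_mult_def right_diff_distrib left_diff_distrib sum_subtractf)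
  have ma: "(B + C) ** A = B ** A + C ** A" for A B C :: "real^'a^'a"
    by (simp add: vec_eq_iff matrix_matrix_mult_def distrib_right sum.distrib)
  have cyc: "V a k l + V k l a + V l a k = 0"
    unfolding V_def dUe Ue
    by (simp add: ms ma matrix_add_ldistrib matrix_mul_assoc DDs[of k a l] DDs[of l a k] DDs[of l k a])
  \<comment> \<open>Lowering the first matrix index commutes with this differentiation by metric
    compatibility. The two subtracted sums are the Christoffel terms of the form indices.\<close>
  have N: "nrm d i j b c z = (\<Sum>m\<in>UNIV. G z $ i $ m * V d b c $ m $ j)
      - (\<Sum>e\<in>UNIV. christoffel G e d b z * rm i j e c z) - (\<Sum>e\<in>UNIV. christoffel G e d c z * rm i j b e z)" for d b c
  proof -
    have rmf: "riem G [i,j,b,c] = rm i j b c" for i j b c by (rule ext) (rule riem_rm)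
    have "nrm d i j b c z = pd d (rm i j b c) z - ((\<Sum>e\<in>UNIV. christoffel G e d i z * rm e j b c z)
       + (\<Sum>e\<in>UNIV. christoffel G e d j z * rm i e b c z) + (\<Sum>e\<in>UNIV. christoffel G e d b z * rm i j e c z)
       + (\<Sum>e\<in>UNIV. christoffel G e d c z * rm i j b e z))"
      by (simp add: nabla_def rmf lessThan_Suc numeral_eq_Suc)
    moreover have "pd d (rm i j b c) z = (\<Sum>m\<in>UNIV. G z $ i $ m * pd d (riem_up G m j b c) z)
       + (\<Sum>m\<in>UNIV. pd d (\<lambda>y. G y $ i $ m) z * riem_up G m j b c z)"
    proof -
      have dr: "riem_up G m j b c differentiable at z" for m
        by (rule smooth_on_differentiable[OF smooth_riem_up open_W z])
      have "rm i j b c = (\<lambda>y. \<Sum>m\<in>UNIV. G y $ i $ m * riem_up G m j b c y)"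
        by (rule ext) (simp add: rm_def)
      then show ?thesis
        by (simp add: pd_sum pd_mult diff_G[OF z] dr differentiable_mult sum.distrib)
    qed
    moreover have "(\<Sum>m\<in>UNIV. pd d (\<lambda>y. G y $ i $ m) z * riem_up G m j b c z) =
       (\<Sum>e\<in>UNIV. christoffel G e d i z * rm e j b c z) +
       (\<Sum>m\<in>UNIV. G z $ i $ m * (\<Sum>s\<in>UNIV. christoffel G m d s z * riem_up G s j b c z))"
    proof -
      have "(\<Sum>m\<in>UNIV. pd d (\<lambda>y. G y $ i $ m) z * riem_up G m j b c z) =
        (\<Sum>m\<in>UNIV. \<Sum>e\<in>UNIV. christoffel G e d i z * (G z $ e $ m * riem_up G m j b c z)) +
        (\<Sum>m\<in>UNIV. \<Sum>s\<in>UNIV. G z $ i $ s * (christoffel G s d m z * riem_up G m j b c z))"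
        by (simp add: metric_compatible[OF z] distrib_right sum.distrib sum_distrib_right mult.assoc)
      also have "(\<Sum>m\<in>UNIV. \<Sum>e\<in>UNIV. christoffel G e d i z * (G z $ e $ m * riem_up G m j b c z)) =
          (\<Sum>e\<in>UNIV. christoffel G e d i z * rm e j b c z)"
        unfolding rm_def sum_distrib_left by (rule sum.swap)
      also have "(\<Sum>m\<in>UNIV. \<Sum>s\<in>UNIV. G z $ i $ s * (christoffel G s d m z * riem_up G m j b c z)) =
          (\<Sum>m\<in>UNIV. G z $ i $ m * (\<Sum>s\<in>UNIV. christoffel G m d s z * riem_up G s j b c z))"
        unfolding sum_distrib_left by (rule sum.swap)
      finally show ?thesis .
    qed
    moreover have "(\<Sum>e\<in>UNIV. christoffel G e d j z * rm i e b c z) =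
        (\<Sum>m\<in>UNIV. G z $ i $ m * (\<Sum>e\<in>UNIV. riem_up G m e b c z * christoffel G e d j z))"
      unfolding rm_def sum_distrib_left by (subst sum.swap) (simp add: mult_ac)
    moreover have "(\<Sum>m\<in>UNIV. G z $ i $ m * V d b c $ m $ j) =
       (\<Sum>m\<in>UNIV. G z $ i $ m * pd d (riem_up G m j b c) z) +
       (\<Sum>m\<in>UNIV. G z $ i $ m * (\<Sum>s\<in>UNIV. christoffel G m d s z * riem_up G s j b c z)) -
       (\<Sum>m\<in>UNIV. G z $ i $ m * (\<Sum>e\<in>UNIV. riem_up G m e b c z * christoffel G e d j z))"
      by (simp add: V_def dU_def U_def \<Gamma>_def matrix_matrix_mult_def algebra_simps sum.distrib sum_subtractf)
    ultimately show ?thesis by linarith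
  qed
  \<comment> \<open>Antisymmetry of the curvature in its last pair (\<open>q1\<close>) and symmetry
    of the Christoffel symbols (\<open>q2\<close>) cancel the terms of the form indices.\<close>
  have q1: "(\<Sum>e\<in>UNIV. christoffel G e d b z * rm i j c e z) = - (\<Sum>e\<in>UNIV. christoffel G e d b z * rm i j e c z)" for d b c
    unfolding sum_negf[symmetric] by (intro sum.cong refl) (simp add: rm_symmetries(2)[OF z, of i j c])
  have q2: "(\<Sum>e\<in>UNIV. christoffel G e d b z * rm i j e c z) = (\<Sum>e\<in>UNIV. christoffel G e b d z * rm i j e c z)" for d b c
    by (intro sum.cong refl) (simp add: christoffel_sym[OF z, of _ d b])
  have "(\<Sum>m\<in>UNIV. G z $ i $ m * V a k l $ m $ j) + (\<Sum>m\<in>UNIV. G z $ i $ m * V k l a $ m $ j)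
     + (\<Sum>m\<in>UNIV. G z $ i $ m * V l a k $ m $ j) = (\<Sum>m\<in>UNIV. G z $ i $ m * (V a k l + V k l a + V l a k) $ m $ j)"
    by (simp add: distrib_left sum.distrib)
  also have "\<dots> = 0" using cyc by simp
  finally show ?thesis
    unfolding N using q1[of a l k] q1[of k a l] q1[of l k a] q2[of a k l] q2[of k l a] q2[of l a k] by linarith
qed

lemma alt_riem:
  assumes "z \<in> W" "K \<in> {{0,1,2},{0,1,3},{0,2,3},{1,2,3}}"
  shows "alt_vanishes 4 (\<lambda>I. riem G I z) K"
  by (rule alt_curvature[OF _ _ _ _ assms(2)]; simp only: riem_rm)
    (fact rm_symmetries[OF assms(1)])+

lemma alt_nabla_riem:
  assumes "z \<in> W" "K \<in> {{0,1,2},{0,1,3},{0,1,4},{0,2,3},{0,2,4},{0,3,4}}"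
  shows "alt_vanishes 5 (\<lambda>I. nabla G (riem G) I z) K"
  by (rule alt_curvature_derivative[OF _ _ _ _ _ assms(2)])
    (fact nrm_symmetries[OF assms(1)] second_bianchi[OF assms(1)])+

text \<open>The hypothesis \<open>T\<close> states that the field with single component z $ t in
  direction t has the identity as covariant derivative. The curvature applied to this field is a
  commutator of its second covariant derivatives, hence zero; z $ t \<noteq> 0 allows to divide by
  the component.\<close>

lemma straight_contraction:
  assumes z: "z \<in> W" "z $ t \<noteq> 0"
    and T: "\<And>y a b. y \<in> W \<Longrightarrow> christoffel G b a t y * y $ t = (if a = b then 1 else 0) - (if a = t \<and> b = t then 1 else 0)"
  shows "rm i t k l z = 0"
proof -
  have "riem_up G m t k l z = 0" for m
  proof -
    \<comment> \<open>Derivative of the hypothesis, whose right-hand side is constant.\<close>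
    have p: "z $ t * pd c (christoffel G m b t) z = - (christoffel G m b t z * (if t = c then 1 else 0))" for c b
    proof -
      have "pd c (\<lambda>y. christoffel G m b t y * y $ t) z = pd c (\<lambda>y. (if b = m then 1 else 0) - (if b = t \<and> m = t then 1 else 0)) z"
        by (rule pd_cong_open[OF open_W z(1) T])
      also have "\<dots> = 0" by (rule pd_const)
      finally show ?thesis
        by (subst (asm) pd_mult) (auto simp: diff_christoffel[OF z(1)] pd_component mult_ac)
    qed
    \<comment> \<open>The hypothesis replaces the factor with lower index t by Kronecker deltas.
      With \<open>p\<close> only undifferentiated Christoffel symbols remain, and these cancel by
      symmetry.\<close>
    have q: "z $ t * (\<Sum>s\<in>UNIV. christoffel G m b s z * christoffel G s c t z) =
        christoffel G m b c z - (if c = t then christoffel G m b t z else 0)" for b c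
    proof -
      have "z $ t * (\<Sum>s\<in>UNIV. christoffel G m b s z * christoffel G s c t z) =
        (\<Sum>s\<in>UNIV. christoffel G m b s z * (christoffel G s c t z * z $ t))"
        by (simp add: sum_distrib_left mult_ac)
      also have "\<dots> = (\<Sum>s\<in>UNIV. (if c = s then christoffel G m b s z else 0) -
          (if t = s then (if c = t then christoffel G m b t z else 0) else 0))"
        by (intro sum.cong refl) (simp add: T[OF z(1)])
      also have "\<dots> = christoffel G m b c z - (if c = t then christoffel G m b t z else 0)"
        by (simp add: sum_subtractf)
      finally show ?thesis .
    qed
    have "z $ t * riem_up G m t k l z = z $ t * pd k (christoffel G m l t) z - z $ t * pd l (christoffel G m k t) z
       + z $ t * (\<Sum>s\<in>UNIV. christoffel G m k s z * christoffel G s l t z)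
       - z $ t * (\<Sum>s\<in>UNIV. christoffel G m l s z * christoffel G s k t z)"
      by (simp add: riem_up_def algebra_simps sum_subtractf)
    also have "\<dots> = 0"
      unfolding p q using christoffel_sym[OF z(1), of m k l] by auto
    finally show ?thesis using z(2) by simp
  qed
  then show ?thesis by (simp add: rm_def)
qed

lemma straight_riem:
  assumes z: "z \<in> W" "z $ t \<noteq> 0"
    and T: "\<And>y a b. y \<in> W \<Longrightarrow> christoffel G b a t y * y $ t = (if a = b then 1 else 0) - (if a = t \<and> b = t then 1 else 0)"
    and I: "s < 4" "I ! s = t"
  shows "riem G I z = 0"
proof -
  note c = straight_contraction[OF z T]
  have "riem G I z = rm (I ! 0) (I ! 1) (I ! 2) (I ! 3) z" by (simp add: riem_def rm_def)
  moreover have "s = 0 \<or> s = 1 \<or> s = 2 \<or> s = 3" using I(1) by auto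
  ultimately show ?thesis
    using I(2) c rm_symmetries(1)[OF z(1), of t "I ! 1" "I ! 2" "I ! 3"] rm_symmetries(3)[OF z(1), of "I ! 0" "I ! 1"]
      rm_symmetries(1)[OF z(1), of t "I ! 3"] by auto
qed

end

subsection \<open>Complete contractions\<close>

text \<open>A complete contraction as an unordered set of pairs. Numbering and orientation of the
  pairs are forgotten, which makes the slot permutations that preserve the contraction easy to
  describe.\<close>

definition perfect_matching :: "nat \<Rightarrow> nat set set \<Rightarrow> bool" where
  "perfect_matching m E \<longleftrightarrow> finite E \<and> \<Union>E = {..<m} \<and>
     (\<forall>e\<in>E. card e = 2) \<and> (\<forall>e\<in>E. \<forall>e'\<in>E. e \<inter> e' \<noteq> {} \<longrightarrow> e = e')"

text \<open>\<open>Min\<close> and \<open>Max\<close> pick the two ends of an unordered pair; for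
  symmetric g their order is immaterial.\<close>

definition edge_weight :: "('a \<Rightarrow> 'a \<Rightarrow> real) \<Rightarrow> 'a list \<Rightarrow> nat set \<Rightarrow> real" where
  "edge_weight g I e = g (I ! Min e) (I ! Max e)"

lemma edge_weight_doubleton:
  assumes "\<And>a b. g a b = g b a"
  shows "edge_weight g I {s, t} = g (I ! s) (I ! t)"
  using assms[of "I ! t" "I ! s"] by (cases "s \<le> t") (auto simp: edge_weight_def min_def max_def)

lemma pairing_perfect_matching:
  assumes m: "even m" and \<sigma>: "\<sigma> permutes {..<m}" and g: "\<And>a b. g a b = g b a"
  defines "E \<equiv> (\<lambda>k. {\<sigma> (2*k), \<sigma> (2*k+1)}) ` {..<m div 2}"
  shows "perfect_matching m E"
    and "(\<Prod>k<m div 2. g (I ! \<sigma> (2*k)) (I ! \<sigma> (2*k+1))) = (\<Prod>e\<in>E. edge_weight g I e)"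
proof -
  have inj: "\<sigma> a = \<sigma> b \<longleftrightarrow> a = b" for a b using permutes_inj[OF \<sigma>] by (auto dest: injD)
  have im: "\<sigma> a < m \<longleftrightarrow> a < m" for a using permutes_in_image[OF \<sigma>, of a] by simp
  have cover: "\<exists>k<m div 2. s = \<sigma> (2*k) \<or> s = \<sigma> (2*k+1)" if "s < m" for s
  proof -
    obtain r where r: "s = \<sigma> r" using permutes_surj[OF \<sigma>] by (metis surjD)
    then have "r < m" using that im by simp
    then have "r div 2 < m div 2" using m by auto
    moreover have "r = 2 * (r div 2) \<or> r = 2 * (r div 2) + 1" by presburger
    ultimately show ?thesis using r by metis
  qed
  have eq: "k = l" if "{\<sigma> (2*k), \<sigma> (2*k+1)} \<inter> {\<sigma> (2*l), \<sigma> (2*l+1)} \<noteq> {}" for k l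
    using that by (auto simp: inj)
  show "perfect_matching m E"
    unfolding perfect_matching_def
  proof (intro conjI ballI impI)
    show "finite E" by (simp add: E_def)
    show "\<Union>E = {..<m}"
    proof
      show "\<Union>E \<subseteq> {..<m}" using m by (auto simp: E_def im)
      show "{..<m} \<subseteq> \<Union>E" using cover by (auto simp: E_def)
    qed
    show "card e = 2" if "e \<in> E" for e using that by (auto simp: E_def inj card_insert_if)
    show "e = e'" if "e \<in> E" "e' \<in> E" "e \<inter> e' \<noteq> {}" for e e'
      using that eq unfolding E_def by blast
  qed
  have "inj_on (\<lambda>k. {\<sigma> (2*k), \<sigma> (2*k+1)}) {..<m div 2}"
    by (rule inj_onI, rule eq) auto
  then show "(\<Prod>k<m div 2. g (I ! \<sigma> (2*k)) (I ! \<sigma> (2*k+1))) = (\<Prod>e\<in>E. edge_weight g I e)"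
    unfolding E_def by (simp add: prod.reindex edge_weight_doubleton[OF g])
qed

text \<open>The first v slots carry an alternating tensor \<open>vol\<close>, later \<mu> or T
  \<rfloor> \<mu>, and the others a tensor Y that varies; g stands for the inverse metric at a fixed
  point.\<close>

locale contraction_data =
  fixes m v :: nat and E :: "nat set set" and g :: "'a::finite \<Rightarrow> 'a \<Rightarrow> real" and vol :: "'a list \<Rightarrow> real"
  assumes E: "perfect_matching m E" and vm: "v \<le> m" and g_sym: "g a b = g b a"
    and vol_alt: "length A = v \<Longrightarrow> u < v \<Longrightarrow> u' < v \<Longrightarrow> u \<noteq> u' \<Longrightarrow>
      vol (permI (Transposition.transpose u u') A) = - vol A"
begin

definition wt :: "'a list \<Rightarrow> real" where
  "wt I = (\<Prod>e\<in>E. edge_weight g I e)"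

definition total :: "('a list \<Rightarrow> real) \<Rightarrow> real" where
  "total Y = (\<Sum>I | length I = m. wt I * (vol (take v I) * Y I))"

text \<open>Y takes all m slots as argument so that one permutation can act on both factors; the
  condition says that it does not see the slots of \<open>vol\<close>.\<close>

definition tail_dependent :: "('a list \<Rightarrow> real) \<Rightarrow> bool" where
  "tail_dependent Y \<longleftrightarrow> (\<forall>I I'. length I = m \<longrightarrow> length I' = m \<longrightarrow>
     (\<forall>s. v \<le> s \<longrightarrow> s < m \<longrightarrow> I ! s = I' ! s) \<longrightarrow> Y I = Y I')"

lemma tail_dependentD:
  "tail_dependent Y \<Longrightarrow> length I = m \<Longrightarrow> length I' = m \<Longrightarrow>
    (\<And>s. v \<le> s \<Longrightarrow> s < m \<Longrightarrow> I ! s = I' ! s) \<Longrightarrow> Y I = Y I'"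
  unfolding tail_dependent_def by blast

lemma edge_doubleton: "e \<in> E \<Longrightarrow> \<exists>s t. e = {s, t} \<and> s \<noteq> t \<and> s < m \<and> t < m"
  using E unfolding perfect_matching_def by (metis UnionI card_2_iff insertI1 insertI2 lessThan_iff)

lemma edge_unique: "e \<in> E \<Longrightarrow> e' \<in> E \<Longrightarrow> s \<in> e \<Longrightarrow> s \<in> e' \<Longrightarrow> e = e'"
  using E unfolding perfect_matching_def by blast

lemma edge_exists: "s < m \<Longrightarrow> \<exists>e\<in>E. s \<in> e"
proof -
  assume "s < m"
  then have "s \<in> \<Union>E" using E by (simp add: perfect_matching_def)
  then show ?thesis by simp
qed

lemma wt_permI:
  assumes \<tau>: "\<tau> permutes {..<m}" "\<And>e. e \<in> E \<Longrightarrow> \<tau> ` e \<in> E" and I: "length I = m"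
  shows "wt (permI \<tau> I) = wt I"
proof -
  have fE: "finite E" using E by (simp add: perfect_matching_def)
  have inj: "inj_on ((`) \<tau>) E" using permutes_inj[OF \<tau>(1)] by (auto intro!: inj_onI simp: inj_image_eq_iff)
  have sub: "(`) \<tau> ` E \<subseteq> E" using \<tau>(2) by blast
  have im: "(`) \<tau> ` E = E" by (rule endo_inj_surj[OF fE sub inj])
  have "edge_weight g (permI \<tau> I) e = edge_weight g I (\<tau> ` e)" if eE: "e \<in> E" for e
  proof -
    obtain s t where e: "e = {s, t}" "s < m" "t < m" using edge_doubleton[OF eE] by blast
    then show ?thesis using I by (simp add: edge_weight_doubleton[OF g_sym])
  qed
  then have "wt (permI \<tau> I) = (\<Prod>e\<in>E. edge_weight g I (\<tau> ` e))" by (simp add: wt_def)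
  also have "\<dots> = (\<Prod>e\<in>(`) \<tau> ` E. edge_weight g I e)" by (simp add: prod.reindex[OF inj])
  finally show ?thesis by (simp add: im wt_def)
qed

text \<open>An automorphism of the matching leaves the product of inverse metrics alone, so
  reindexing the sum by it only produces the sign from \<open>vol\<close>.\<close>

lemma total_antisymmetric:
  assumes \<tau>: "\<tau> permutes {..<m}" "\<And>e. e \<in> E \<Longrightarrow> \<tau> ` e \<in> E" "\<tau> \<circ> \<tau> = id"
    and neg: "\<And>I. length I = m \<Longrightarrow> vol (take v (permI \<tau> I)) = - vol (take v I)"
  shows "total (\<lambda>I. Y (permI \<tau> I)) = - total Y"
proof -
  have inv: "permI \<tau> (permI \<tau> I) = I" if "length I = m" for I
    using that \<tau> by (simp add: permI_compose)
  have "total (\<lambda>I. Y (permI \<tau> I)) = (\<Sum>I | length I = m. - (wt (permI \<tau> I) * (vol (take v (permI \<tau> I)) * Y (permI \<tau> I))))"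
    unfolding total_def by (intro sum.cong refl) (simp add: wt_permI[OF \<tau>(1,2)] neg)
  also have "\<dots> = - (\<Sum>I | length I = m. wt (permI \<tau> I) * (vol (take v (permI \<tau> I)) * Y (permI \<tau> I)))"
    by (rule sum_negf)
  also have "(\<Sum>I | length I = m. wt (permI \<tau> I) * (vol (take v (permI \<tau> I)) * Y (permI \<tau> I))) = total Y"
    unfolding total_def
    by (rule sum.reindex_bij_witness[where i = "permI \<tau>" and j = "permI \<tau>"]) (auto simp: inv)
  finally show ?thesis .
qed

lemma take_permI: "length I = m \<Longrightarrow> (\<And>s. s < v \<Longrightarrow> \<tau> s = \<tau>' s \<and> \<tau>' s < v) \<Longrightarrow> take v (permI \<tau> I) = permI \<tau>' (take v I)"
  using vm by (intro nth_equalityI) auto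

text \<open>A symmetric inverse metric is contracted into two slots of an alternating tensor:
  swapping these slots preserves the matching and Y, and reverses the sign.\<close>

lemma total_inner_edge:
  assumes u: "{u, u'} \<in> E" "u \<noteq> u'" "u < v" "u' < v" and Y: "tail_dependent Y"
  shows "total Y = 0"
proof -
  let ?\<tau> = "Transposition.transpose u u'"
  have "total (\<lambda>I. Y (permI ?\<tau> I)) = - total Y"
  proof (rule total_antisymmetric)
    show "?\<tau> permutes {..<m}" using u vm by (intro permutes_swap_id) auto
    show "?\<tau> ` e \<in> E" if "e \<in> E" for e
    proof (cases "e = {u, u'}")
      case True
      then show ?thesis using u by (simp add: insert_commute)
    next
      case False
      then have "u \<notin> e" "u' \<notin> e" using edge_unique[OF that u(1)] by blast+
      then have "?\<tau> ` e = e" by (auto simp: Transposition.transpose_def image_iff)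
      then show ?thesis using that by simp
    qed
    show "?\<tau> \<circ> ?\<tau> = id" by simp
    fix I :: "'a list" assume I: "length I = m"
    have "take v (permI ?\<tau> I) = permI ?\<tau> (take v I)"
      using I u by (intro take_permI) (auto simp: Transposition.transpose_def)
    then show "vol (take v (permI ?\<tau> I)) = - vol (take v I)"
      using vol_alt[of "take v I" u u'] u I vm by simp
  qed
  moreover have "total (\<lambda>I. Y (permI ?\<tau> I)) = total Y"
  proof -
    have "Y (permI ?\<tau> I) = Y I" if I: "length I = m" for I
      by (rule tail_dependentD[OF Y]) (use I u in \<open>simp_all add: Transposition.transpose_def\<close>)
    then show ?thesis by (simp add: total_def)
  qed
  ultimately show ?thesis by simp
qed

definition partners :: "nat set" where
  "partners = {s. v \<le> s \<and> s < m \<and> (\<exists>u<v. {u, s} \<in> E)}"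

text \<open>Swapping a and b alone breaks the matching. Swapping the slots u and u' paired with them
  as well restores it and costs a sign; Y does not notice the second swap.\<close>

lemma total_swap_partners:
  assumes "a \<in> partners" "b \<in> partners" "a \<noteq> b" and Y: "tail_dependent Y"
  shows "total (\<lambda>I. Y (permI (Transposition.transpose a b) I)) = - total Y"
proof -
  obtain u where u: "u < v" "{u, a} \<in> E" using assms(1) by (auto simp: partners_def)
  obtain u' where u': "u' < v" "{u', b} \<in> E" using assms(2) by (auto simp: partners_def)
  have ab: "v \<le> a" "a < m" "v \<le> b" "b < m" using assms by (auto simp: partners_def)
  have uu: "u \<noteq> u'" using edge_unique[OF u(2) u'(2), of u] assms(3) ab u u' by (auto simp: doubleton_eq_iff)
  let ?\<tau> = "Transposition.transpose a b \<circ> Transposition.transpose u u'"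
  have ap: "?\<tau> s = (if s = a then b else if s = b then a else if s = u then u' else if s = u' then u else s)" for s
    using u u' ab by (auto simp: Transposition.transpose_def)
  have "total (\<lambda>I. Y (permI ?\<tau> I)) = - total Y"
  proof (rule total_antisymmetric)
    show "?\<tau> permutes {..<m}" using ab u u' vm by (intro permutes_compose permutes_swap_id) auto
    show "?\<tau> ` e \<in> E" if e: "e \<in> E" for e
    proof -
      consider "e = {u, a}" | "e = {u', b}" | "u \<notin> e" "a \<notin> e" "u' \<notin> e" "b \<notin> e"
        using edge_unique[OF e u(2)] edge_unique[OF e u'(2)] by blast
      then show ?thesis
      proof cases
        case 1
        then have "?\<tau> ` e = {u', b}" using ab u u' by (simp only: image_insert image_empty ap) auto
        then show ?thesis using u' by simp
      next
        case 2
        then have "?\<tau> ` e = {u, a}" using ab u u' uu assms(3) by (simp only: image_insert image_empty ap) auto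
        then show ?thesis using u by simp
      next
        case 3
        then have "?\<tau> s = s" if "s \<in> e" for s using that unfolding ap by metis
        then have "?\<tau> ` e = e" by force
        then show ?thesis using e by simp
      qed
    qed
    have "?\<tau> (?\<tau> s) = s" for s unfolding ap using ab u u' uu assms(3) by auto
    then show "?\<tau> \<circ> ?\<tau> = id" by (auto simp: fun_eq_iff)
    fix I :: "'a list" assume I: "length I = m"
    have "take v (permI ?\<tau> I) = permI (Transposition.transpose u u') (take v I)"
      unfolding o_def using I u u' ab by (intro take_permI) (auto simp: Transposition.transpose_def)
    then show "vol (take v (permI ?\<tau> I)) = - vol (take v I)"
      using vol_alt[of "take v I" u u'] u u' uu I vm by simp
  qed
  moreover have "Y (permI ?\<tau> I) = Y (permI (Transposition.transpose a b) I)" if "length I = m" for I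
  proof -
    have "permI ?\<tau> I ! s = permI (Transposition.transpose a b) I ! s" if "v \<le> s" "s < m" for s
      using that \<open>length I = m\<close> ap[of s] u u' by (auto simp: Transposition.transpose_def)
    then show ?thesis by (intro tail_dependentD[OF Y]) (simp_all add: \<open>length I = m\<close>)
  qed
  ultimately show ?thesis by (simp add: total_def)
qed

lemma partners_sub: "partners \<subseteq> {v..<m}"
  by (auto simp: partners_def)

lemma total_permutation:
  assumes "\<kappa> permutes K" "finite K" "K \<subseteq> partners" and Y: "tail_dependent Y"
  shows "total (\<lambda>I. Y (permI \<kappa> I)) = of_int (sign \<kappa>) * total Y"
  using assms(1,2)
proof (induction rule: permutes_induct)
  case (swap a b p)
  have Km: "K \<subseteq> {..<m}" "K \<inter> {..<v} = {}" using assms(3) partners_sub by auto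
  have pm: "p permutes {..<m}" using swap.hyps(4) Km permutes_subset by blast
  have "tail_dependent (\<lambda>I. Y (permI p I))"
    unfolding tail_dependent_def
  proof (intro allI impI)
    fix I I' :: "'a list" assume I: "length I = m" "length I' = m" "\<forall>s. v \<le> s \<longrightarrow> s < m \<longrightarrow> I ! s = I' ! s"
    have "permI p I ! s = permI p I' ! s" if s: "v \<le> s" "s < m" for s
    proof -
      have "p s < m" using permutes_in_image[OF pm] s by auto
      moreover have "v \<le> p s"
      proof (cases "s \<in> K")
        case True
        then have "p s \<in> K" using permutes_in_image[OF swap.hyps(4)] by simp
        then show ?thesis using Km by (auto simp: disjoint_iff)
      next
        case False
        then show ?thesis using s permutes_not_in[OF swap.hyps(4)] by simp
      qed
      ultimately show ?thesis using I s by simp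
    qed
    then show "Y (permI p I) = Y (permI p I')" by (intro tail_dependentD[OF Y]) (simp_all add: I)
  qed
  then have "total (\<lambda>I. Y (permI p (permI (Transposition.transpose a b) I))) = - total (\<lambda>I. Y (permI p I))"
    using swap.hyps assms(3) by (intro total_swap_partners) auto
  moreover have "total (\<lambda>I. Y (permI p (permI (Transposition.transpose a b) I))) = total (\<lambda>I. Y (permI (Transposition.transpose a b \<circ> p) I))"
    unfolding total_def using pm by (intro sum.cong refl) (simp add: permI_compose)
  moreover have "sign (Transposition.transpose a b \<circ> p) = - sign p"
  proof -
    have "permutation p" using swap.hyps(4) assms(2) permutation_permutes by blast
    then show ?thesis using swap.hyps(3) by (simp add: sign_compose sign_swap_id permutation_swap_id)
  qed
  ultimately show ?case using swap.IH by (metis minus_mult_left of_int_minus)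
qed simp

text \<open>The signed sum of the permuted copies of Y is zero termwise, but every signed copy also
  contributes the same total. So the number of permutations times the total is zero.\<close>

lemma total_alternating_zero:
  assumes K: "finite K" "K \<subseteq> partners" and Y: "tail_dependent Y"
    and alt: "\<And>I. length I = m \<Longrightarrow> (\<Sum>\<kappa> | \<kappa> permutes K. of_int (sign \<kappa>) * Y (permI \<kappa> I)) = 0"
  shows "total Y = 0"
proof -
  let ?P = "{\<kappa>. \<kappa> permutes K}"
  have fP: "finite ?P" using K(1) by (rule finite_permutations)
  have "(\<Sum>\<kappa>\<in>?P. of_int (sign \<kappa>) * total (\<lambda>I. Y (permI \<kappa> I))) =
      (\<Sum>I | length I = m. wt I * (vol (take v I) * (\<Sum>\<kappa>\<in>?P. of_int (sign \<kappa>) * Y (permI \<kappa> I))))"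
    unfolding total_def sum_distrib_left by (subst sum.swap) (simp add: mult_ac)
  also have "\<dots> = 0" using alt by simp
  finally have "0 = (\<Sum>\<kappa>\<in>?P. of_int (sign \<kappa>) * (of_int (sign \<kappa>) * total Y))"
    using total_permutation[OF _ K Y] by simp
  also have "\<dots> = real (card ?P) * total Y"
    by (simp add: mult.assoc[symmetric] of_int_mult[symmetric] del: of_int_mult)
  finally have "real (card ?P) * total Y = 0" by simp
  moreover have "id \<in> ?P" by (simp add: permutes_id)
  then have "card ?P > 0" using fP card_gt_0_iff by blast
  ultimately show ?thesis by simp
qed

text \<open>If no pair joins two slots of the alternating tensor, the matching is a bijection from
  these slots to the partners.\<close>

lemma card_partners:
  assumes "\<And>u u'. u < v \<Longrightarrow> u' < v \<Longrightarrow> u \<noteq> u' \<Longrightarrow> {u, u'} \<notin> E"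
  shows "card partners = v" "\<And>u. u < v \<Longrightarrow> \<exists>s. v \<le> s \<and> s < m \<and> {u, s} \<in> E"
proof -
  have ex: "\<exists>s. v \<le> s \<and> s < m \<and> {u, s} \<in> E" if "u < v" for u
  proof -
    have "u < m" using that vm by simp
    then obtain e where e: "e \<in> E" "u \<in> e" using edge_exists by blast
    obtain s t where st: "e = {s, t}" "s \<noteq> t" "s < m" "t < m" using edge_doubleton[OF e(1)] by blast
    have nv: "\<not> (s < v \<and> t < v)" using assms[OF _ _ st(2)] e(1) st(1) by auto
    show ?thesis
    proof (cases "u = s")
      case True
      then show ?thesis using nv that st e by (intro exI[of _ t]) auto
    next
      case False
      then have "u = t" using e st by auto
      then show ?thesis using nv that st e by (intro exI[of _ s]) (auto simp: insert_commute)
    qed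
  qed
  then show "\<And>u. u < v \<Longrightarrow> \<exists>s. v \<le> s \<and> s < m \<and> {u, s} \<in> E" by blast
  define p where "p u = (SOME s. v \<le> s \<and> s < m \<and> {u, s} \<in> E)" for u
  have p: "v \<le> p u \<and> p u < m \<and> {u, p u} \<in> E" if "u < v" for u
    unfolding p_def by (rule someI_ex[OF ex[OF that]])
  have "bij_betw p {..<v} partners"
    unfolding bij_betw_def
  proof
    show "inj_on p {..<v}"
    proof (rule inj_onI)
      fix x y assume xy: "x \<in> {..<v}" "y \<in> {..<v}" "p x = p y"
      have px: "v \<le> p x" "{x, p x} \<in> E" and py: "v \<le> p y" "{y, p y} \<in> E" using p[of x] p[of y] xy(1,2) by auto
      have "{x, p x} = {y, p y}" by (rule edge_unique[OF px(2) py(2), of "p x"]) (simp_all add: xy)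
      then show "x = y" using xy px(1) py(1) by (auto simp: doubleton_eq_iff)
    qed
    show "p ` {..<v} = partners"
    proof
      show "p ` {..<v} \<subseteq> partners" using p by (auto simp: partners_def)
      show "partners \<subseteq> p ` {..<v}"
      proof
        fix s assume "s \<in> partners"
        then obtain u where u: "u < v" "{u, s} \<in> E" "v \<le> s" by (auto simp: partners_def)
        then have "{u, s} = {u, p u}" using p[of u] edge_unique[of "{u, s}" "{u, p u}" u] by auto
        then have "s = p u" using u p[of u] by (auto simp: doubleton_eq_iff)
        then show "s \<in> p ` {..<v}" using u by auto
      qed
    qed
  qed
  from bij_betw_same_card[OF this] show "card partners = v" by simp
qed

end

lemma sum_lists_append:
  "(\<Sum>I | length I = v + k. h I) = (\<Sum>B | length B = k. \<Sum>A | length A = v. h (A @ B))"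
  for h :: "'a::finite list \<Rightarrow> real"
proof -
  have "(\<Sum>I | length I = v + k. h I) = (\<Sum>(B, A)\<in>{B. length B = k} \<times> {A. length A = v}. h (A @ B))"
    by (rule sum.reindex_bij_witness[where i = "\<lambda>(B, A). A @ B" and j = "\<lambda>I. (drop v I, take v I)"]) auto
  then show ?thesis by (simp add: sum.cartesian_product)
qed

context contraction_data
begin

text \<open>Terms in which a slot of Y carries the index t vanish. In the others the indices B of
  the slots of Y are frozen; then Y and the pairs among its own slots leave the sum over A, and
  \<open>inner\<close> applies with b u the index at the partner of u.\<close>

lemma total_zero_by_inner_sum:
  assumes ext: "\<And>u. u < v \<Longrightarrow> \<exists>s. v \<le> s \<and> s < m \<and> {u, s} \<in> E"
    and Y: "tail_dependent Y" and Y0: "\<And>I s. length I = m \<Longrightarrow> v \<le> s \<Longrightarrow> s < m \<Longrightarrow> I ! s = t \<Longrightarrow> Y I = 0"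
    and inner: "\<And>b. (\<And>u. u < v \<Longrightarrow> b u \<noteq> t) \<Longrightarrow> (\<Sum>A | length A = v. (\<Prod>u<v. g (A ! u) (b u)) * vol A) = 0"
  shows "total Y = 0"
proof -
  define p where "p u = (SOME s. v \<le> s \<and> s < m \<and> {u, s} \<in> E)" for u
  have p: "v \<le> p u \<and> p u < m \<and> {u, p u} \<in> E" if "u < v" for u
    unfolding p_def by (rule someI_ex[OF ext[OF that]])
  define E1 where "E1 = (\<lambda>u. {u, p u}) ` {..<v}"
  have fE: "finite E" using E by (simp add: perfect_matching_def)
  have E1: "E1 \<subseteq> E" using p by (auto simp: E1_def)
  have inj: "inj_on (\<lambda>u. {u, p u}) {..<v}"
  proof (rule inj_onI)
    fix x y assume xy: "x \<in> {..<v}" "y \<in> {..<v}" "{x, p x} = {y, p y}"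
    then show "x = y" using p[of x] p[of y] by (auto simp: doubleton_eq_iff)
  qed
  have E2: "e \<inter> {..<v} = {}" if e: "e \<in> E - E1" for e
  proof (rule ccontr)
    assume "e \<inter> {..<v} \<noteq> {}"
    then obtain u where u: "u \<in> e" "u < v" by auto
    then have "e = {u, p u}" using edge_unique[of e "{u, p u}" u] e p[of u] by auto
    then show False using e u by (auto simp: E1_def)
  qed
  have wt_split: "wt I = (\<Prod>u<v. g (I ! u) (I ! p u)) * (\<Prod>e\<in>E - E1. edge_weight g I e)" for I
  proof -
    have "wt I = (\<Prod>e\<in>E - E1. edge_weight g I e) * (\<Prod>e\<in>E1. edge_weight g I e)"
      unfolding wt_def by (rule prod.subset_diff[OF E1 fE])
    also have "(\<Prod>e\<in>E1. edge_weight g I e) = (\<Prod>u<v. g (I ! u) (I ! p u))"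
      unfolding E1_def by (simp add: prod.reindex[OF inj] edge_weight_doubleton[OF g_sym])
    finally show ?thesis by simp
  qed
  define k where "k = m - v"
  have m: "m = v + k" using vm by (simp add: k_def)
  have "(\<Sum>A | length A = v. wt (A @ B) * (vol (take v (A @ B)) * Y (A @ B))) = 0" if B: "length B = k" for B
  proof (cases "\<exists>s<k. B ! s = t")
    case True
    then obtain s where s: "s < k" "B ! s = t" by blast
    have "Y (A @ B) = 0" if "length A = v" for A
      by (rule Y0[of _ "v + s"]) (use that B s m in \<open>simp_all add: nth_append\<close>)
    then show ?thesis by simp
  next
    case False
    \<comment> \<open>The entries \<open>replicate v t\<close> are placeholders: neither the pairs
      outside \<open>E1\<close> nor Y involve these slots.\<close>
    define w2 where "w2 = (\<Prod>e\<in>E - E1. edge_weight g (replicate v t @ B) e)"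
    define y where "y = Y (replicate v t @ B)"
    have "wt (A @ B) * (vol (take v (A @ B)) * Y (A @ B)) =
        w2 * y * ((\<Prod>u<v. g (A ! u) (B ! (p u - v))) * vol A)" if A: "length A = v" for A
    proof -
      have "Y (A @ B) = y" unfolding y_def
        by (rule tail_dependentD[OF Y]) (use A B m in \<open>simp_all add: nth_append\<close>)
      moreover have "(\<Prod>e\<in>E - E1. edge_weight g (A @ B) e) = w2"
        unfolding w2_def
      proof (rule prod.cong[OF refl])
        fix e assume e: "e \<in> E - E1"
        then obtain s r where sr: "e = {s, r}" using edge_doubleton by blast
        then have "\<not> s < v" "\<not> r < v" using E2[OF e] by auto
        then show "edge_weight g (A @ B) e = edge_weight g (replicate v t @ B) e"
          using A by (simp add: sr edge_weight_doubleton[OF g_sym] nth_append)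
      qed
      moreover have "(\<Prod>u<v. g ((A @ B) ! u) ((A @ B) ! p u)) = (\<Prod>u<v. g (A ! u) (B ! (p u - v)))"
        by (intro prod.cong refl) (use A p in \<open>simp add: nth_append leD\<close>)
      ultimately show ?thesis using A by (simp add: wt_split)
    qed
    then have "(\<Sum>A | length A = v. wt (A @ B) * (vol (take v (A @ B)) * Y (A @ B))) =
        w2 * y * (\<Sum>A | length A = v. (\<Prod>u<v. g (A ! u) (B ! (p u - v))) * vol A)"
      unfolding sum_distrib_left by (intro sum.cong refl) (simp only: mem_Collect_eq)
    also have "(\<Sum>A | length A = v. (\<Prod>u<v. g (A ! u) (B ! (p u - v))) * vol A) = 0"
    proof (rule inner)
      fix u assume "u < v"
      then have "p u - v < k" using p[of u] m by auto
      then show "B ! (p u - v) \<noteq> t" using False by blast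
    qed
    finally show ?thesis by simp
  qed
  then have "(\<Sum>I | length I = v + k. wt I * (vol (take v I) * Y I)) = 0"
    unfolding sum_lists_append by simp
  then show ?thesis unfolding total_def m[symmetric] .
qed

end

subsection \<open>The volume form\<close>

lemma map_of_zip_nth_distinct:
  assumes "distinct e" "length I = length e" "k < length e"
  shows "the (map_of (zip e I) (e ! k)) = I ! k"
  using assms by (simp add: map_of_zip_nth)

definition frame_det :: "'a::finite list \<Rightarrow> 'a list \<Rightarrow> real" where
  "frame_det e I = det (\<chi> a b. if the (map_of (zip e I) a) = b then 1 else (0::real))"

lemma vol_form_frame_det: "vol_form e G I z = sqrt \<bar>det (G z)\<bar> * frame_det e I"
  by (simp add: vol_form_def frame_det_def)

text \<open>Swapping two slots of I exchanges the rows indexed by \<open>e ! u\<close> and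
  \<open>e ! u'\<close>.\<close>

lemma frame_det_swap:
  assumes e: "distinct e" "set e = UNIV" and I: "length I = length e" "u < length e" "u' < length e" "u \<noteq> u'"
  shows "frame_det e (permI (Transposition.transpose u u') I) = - frame_det e I"
proof -
  let ?t = "Transposition.transpose u u'" and ?q = "Transposition.transpose (e ! u) (e ! u')"
  define A :: "real^'a^'a" where "A = (\<chi> a b. if the (map_of (zip e I) a) = b then 1 else 0)"
  have "the (map_of (zip e (permI ?t I)) a) = the (map_of (zip e I) (?q a))" for a
  proof -
    obtain k where k: "a = e ! k" "k < length e" using e(2) by (metis UNIV_I in_set_conv_nth)
    have "?t k < length e" using k(2) I by (auto simp: Transposition.transpose_def)
    moreover have "?q a = e ! ?t k"
      unfolding k(1) using e(1) k(2) I by (auto simp: Transposition.transpose_def nth_eq_iff_index_eq)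
    ultimately show ?thesis using k I by (simp add: map_of_zip_nth_distinct[OF e(1)])
  qed
  then have "frame_det e (permI ?t I) = det (\<chi> a. A $ ?q a)"
    unfolding frame_det_def A_def by (intro arg_cong[of _ _ det]) (simp add: vec_eq_iff)
  also have "\<dots> = of_int (sign ?q) * det A"
    by (rule det_permute_rows) (simp add: permutes_swap_id)
  also have "sign ?q = -1" using e(1) I by (simp add: sign_swap_id nth_eq_iff_index_eq)
  finally show ?thesis by (simp add: A_def frame_det_def)
qed

lemma det_zero_if_kernel:
  fixes M :: "real^'a::finite^'a"
  assumes "M *v c = 0" "c \<noteq> 0"
  shows "det M = 0"
proof (rule ccontr)
  assume "det M \<noteq> 0"
  then have "matrix_inv M ** M = mat 1" by (simp add: invertible_det_nz matrix_inv_mult)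
  then have "c = matrix_inv M *v (M *v c)" by (simp add: matrix_vector_mul_assoc)
  then show False using assms by simp
qed

text \<open>The sum is the determinant of the matrix M whose row t is the unit vector at t and whose
  other rows are the vectors y \<mapsto> g y (b u). The vector c lies in its kernel: the third
  condition on c handles these rows, and c t = 0 handles row t. In the application c is T with
  lowered index, and c t = 0 says that T is null.\<close>

lemma frame_det_contraction_zero:
  fixes g :: "'a::finite \<Rightarrow> 'a \<Rightarrow> real" and c :: "'a \<Rightarrow> real"
  assumes e: "distinct (t # e)" "set (t # e) = UNIV"
    and c: "c t = 0" "c a \<noteq> 0" "\<And>b. b \<noteq> t \<Longrightarrow> (\<Sum>y\<in>UNIV. g y b * c y) = 0"
    and b: "\<And>u. u < length e \<Longrightarrow> b u \<noteq> t"
  shows "(\<Sum>A | length A = length e. (\<Prod>u<length e. g (A ! u) (b u)) * frame_det (t # e) (t # A)) = 0"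
proof -
  let ?v = "length e"
  define idx where "idx x = (THE k. k < ?v \<and> e ! k = x)" for x
  have idx: "idx (e ! k) = k" if "k < ?v" for k
    unfolding idx_def using that e(1) by (intro the_equality) (auto simp: nth_eq_iff_index_eq)
  have idx': "idx x < ?v" if "x \<noteq> t" for x
    using that e(2) idx by (metis UNIV_I in_set_conv_nth set_ConsD)
  define M where "M x y = (if x = t then if y = t then 1 else 0 else g y (b (idx x)))" for x y
  have "(\<chi> x y. M x y) *v (\<chi> y. c y) = 0"
  proof -
    have "(\<Sum>y\<in>UNIV. M x y * c y) = 0" for x
    proof (cases "x = t")
      case True
      then have "(\<Sum>y\<in>UNIV. M x y * c y) = (\<Sum>y\<in>UNIV. if y = t then c t else 0)"
        by (intro sum.cong refl) (auto simp: M_def)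
      then show ?thesis using c(1) by simp
    next
      case False
      then show ?thesis using c(3)[OF b[OF idx'[OF False]]] by (simp add: M_def)
    qed
    then show ?thesis by (simp add: vec_eq_iff matrix_vector_mult_def)
  qed
  moreover have "(\<chi> y. c y) \<noteq> 0" using c(2) by (auto simp: vec_eq_iff)
  ultimately have "det (\<chi> x y. M x y) = 0" by (rule det_zero_if_kernel)
  \<comment> \<open>Multilinear expansion along unit vectors. A choice f of columns corresponds to
    the index list A, and row t forces f t = t.\<close>
  moreover have "det (\<chi> x y. M x y) = det (\<chi> x. \<Sum>y\<in>UNIV. M x y *s axis y 1)"
    by (intro arg_cong[of _ _ det]) (simp add: vec_eq_iff axis_def if_distrib cong: if_cong)
  moreover have "\<dots> = (\<Sum>f\<in>UNIV. (\<Prod>x\<in>UNIV. M x (f x)) * det (\<chi> x. axis (f x) 1))"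
    by (subst det_linear_rows_sum) (simp_all add: det_rows_mul)
  moreover have "\<dots> = (\<Sum>f | f t = t. (\<Prod>x\<in>UNIV. M x (f x)) * det (\<chi> x. axis (f x) 1))"
  proof (rule sum.mono_neutral_right)
    show "\<forall>f\<in>UNIV - {f. f t = t}. (\<Prod>x\<in>UNIV. M x (f x)) * det (\<chi> x. axis (f x) (1::real)) = 0"
    proof
      fix f assume "f \<in> UNIV - {f::'a \<Rightarrow> 'a. f t = t}"
      then have "M t (f t) = 0" by (simp add: M_def)
      then have "(\<Prod>x\<in>UNIV. M x (f x)) = 0" by (intro prod_zero) auto
      then show "(\<Prod>x\<in>UNIV. M x (f x)) * det (\<chi> x. axis (f x) (1::real)) = 0" by simp
    qed
  qed auto
  moreover have "\<dots> = (\<Sum>A | length A = ?v. (\<Prod>u<?v. g (A ! u) (b u)) * frame_det (t # e) (t # A))"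
  proof (rule sum.reindex_bij_witness[where j = "\<lambda>f. map f e" and i = "\<lambda>A x. the (map_of (zip (t # e) (t # A)) x)"])
    fix f assume f: "f \<in> {f::'a \<Rightarrow> 'a. f t = t}"
    have fx: "the (map_of (zip (t # e) (t # map f e)) x) = f x" for x
    proof -
      obtain k where k: "x = (t # e) ! k" "k < length (t # e)" using e(2) by (metis UNIV_I in_set_conv_nth)
      then have "the (map_of (zip (t # e) (t # map f e)) x) = (t # map f e) ! k"
        using map_of_zip_nth_distinct[OF e(1), of "t # map f e" k] by simp
      then show ?thesis using k f by (cases k) auto
    qed
    show "(\<lambda>x. the (map_of (zip (t # e) (t # map f e)) x)) = f" using fx by (rule ext)
    show "map f e \<in> {A. length A = ?v}" by simp
    have "(\<Prod>x\<in>UNIV. M x (f x)) = (\<Prod>x\<in>insert t (set e). M x (f x))" using e(2) by simp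
    also have "\<dots> = M t (f t) * (\<Prod>x\<in>set e. M x (f x))" using e(1) by (subst prod.insert) auto
    also have "\<dots> = (\<Prod>x\<in>set e. M x (f x))" using f by (simp add: M_def)
    also have "\<dots> = (\<Prod>u<?v. M (e ! u) (f (e ! u)))"
      using e(1) by (intro prod.reindex_bij_betw[symmetric] bij_betw_nth) auto
    also have "\<dots> = (\<Prod>u<?v. g (map f e ! u) (b u))"
      using e(1) by (intro prod.cong refl) (auto simp: M_def idx)
    finally have "(\<Prod>x\<in>UNIV. M x (f x)) = (\<Prod>u<?v. g (map f e ! u) (b u))" .
    moreover have "det (\<chi> x. axis (f x) (1::real)) = frame_det (t # e) (t # map f e)"
      unfolding frame_det_def fx by (intro arg_cong[of _ _ det]) (auto simp: vec_eq_iff axis_def)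
    ultimately show "(\<Prod>u<?v. g (map f e ! u) (b u)) * frame_det (t # e) (t # map f e) =
        (\<Prod>x\<in>UNIV. M x (f x)) * det (\<chi> x. axis (f x) 1)" by simp
  next
    fix A :: "'a list" assume A: "A \<in> {A. length A = ?v}"
    show "(\<lambda>x. the (map_of (zip (t # e) (t # A)) x)) \<in> {f. f t = t}" by simp
    show "map (\<lambda>x. the (map_of (zip (t # e) (t # A)) x)) e = A"
    proof (rule nth_equalityI)
      fix k assume "k < length (map (\<lambda>x. the (map_of (zip (t # e) (t # A)) x)) e)"
      then have "k < ?v" by simp
      then show "map (\<lambda>x. the (map_of (zip (t # e) (t # A)) x)) e ! k = A ! k"
        using map_of_zip_nth_distinct[OF e(1), of "t # A" "Suc k"] A by simp
    qed (use A in simp)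
  qed
  ultimately show ?thesis by simp
qed

subsection \<open>Counting the slots contracted with the volume form\<close>

definition block_size :: "nat list \<Rightarrow> nat" where
  "block_size rs = (\<Sum>r\<leftarrow>rs. r + 4)"

lemma block_size_simps [simp]: "block_size [] = 0" "block_size (r # rs) = r + 4 + block_size rs"
  "block_size (rs @ rs') = block_size rs + block_size rs'"
  by (simp_all add: block_size_def)

lemma nabla_products_take:
  "nabla_products G rs (take (block_size rs) J) z = nabla_products G rs J z"
proof (induction rs arbitrary: J)
  case (Cons r rs)
  have "drop (r + 4) (take (block_size (r # rs)) J) = take (block_size rs) (drop (r + 4) J)"
    by (simp add: drop_take)
  moreover have "take (r + 4) (take (block_size (r # rs)) J) = take (r + 4) J" by (simp add: min_def)
  ultimately show ?case using Cons by simp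
qed simp

lemma nabla_products_split:
  "nabla_products G (rs @ r # rs') J z = nabla_products G rs (take (block_size rs) J) z *
     ((nabla G ^^ r) (riem G) (take (r + 4) (drop (block_size rs) J)) z *
      nabla_products G rs' (drop (block_size rs + r + 4) J) z)"
proof (induction rs arbitrary: J)
  case (Cons x rs)
  have "nabla_products G (x # rs) (take (block_size (x # rs)) J) z = nabla_products G (x # rs) J z"
    by (rule nabla_products_take)
  moreover have "nabla_products G rs (take (block_size rs) (drop (x + 4) J)) z = nabla_products G rs (drop (x + 4) J) z"
    by (rule nabla_products_take)
  ultimately show ?case unfolding append_Cons nabla_products.simps(2)[of G x] Cons[of "drop (x + 4) J"]
    by (simp only: nabla_products.simps(2) drop_drop block_size_simps mult.assoc add_ac)
qed simp

lemma card_le_by_blocks: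
  assumes "J \<subseteq> {off..<off + block_size rs}"
    and "\<And>rs1 r rs2. rs = rs1 @ r # rs2 \<Longrightarrow>
      card (J \<inter> {off + block_size rs1..<off + block_size rs1 + r + 4}) \<le> cap r"
  shows "card J \<le> (\<Sum>r\<leftarrow>rs. cap r)"
  using assms
proof (induction rs arbitrary: off J)
  case (Cons r rs)
  have fJ: "finite J" using Cons.prems(1) finite_subset by blast
  let ?J1 = "J \<inter> {off..<off + r + 4}" and ?J2 = "J \<inter> {off + r + 4..<off + r + 4 + block_size rs}"
  have "J \<subseteq> ?J1 \<union> ?J2" using Cons.prems(1) by auto
  then have "card J \<le> card (?J1 \<union> ?J2)" using fJ by (intro card_mono) auto
  also have "\<dots> \<le> card ?J1 + card ?J2" by (rule card_Un_le)
  also have "card ?J1 \<le> cap r" using Cons.prems(2)[of "[]" r rs] by simp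
  also have "card ?J2 \<le> (\<Sum>r\<leftarrow>rs. cap r)"
  proof (rule Cons.IH)
    fix rs1 r' rs2 assume d: "rs = rs1 @ r' # rs2"
    have "card (?J2 \<inter> {off + r + 4 + block_size rs1..<off + r + 4 + block_size rs1 + r' + 4}) \<le>
      card (J \<inter> {off + block_size (r # rs1)..<off + block_size (r # rs1) + r' + 4})"
      using fJ by (intro card_mono) auto
    also have "\<dots> \<le> cap r'" using Cons.prems(2)[of "r # rs1" r' rs2] d by simp
    finally show "card (?J2 \<inter> {off + r + 4 + block_size rs1..<off + r + 4 + block_size rs1 + r' + 4}) \<le> cap r'" .
  qed auto
  finally show ?case by simp
qed simp

lemma three_subsets_of_four:
  assumes "K \<subseteq> {..<4::nat}" "card K = 3"
  shows "K \<in> {{0,1,2},{0,1,3},{0,2,3},{1,2,3}}"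
proof -
  have "card ({..<4} - K) = 1" using assms by (subst card_Diff_subset) (auto intro: finite_subset)
  then obtain x where x: "{..<4} - K = {x}" by (auto simp: card_1_singleton_iff)
  have "{..<4::nat} = {0,1,2,3}" by auto
  then have K: "K = {0,1,2,3} - {x}" using x assms(1) by blast
  have "x \<in> {..<4}" using x by blast
  then have "x = 0 \<or> x = 1 \<or> x = 2 \<or> x = 3" by auto
  then show ?thesis unfolding K by (elim disjE) (simp_all add: insert_Diff_if)
qed

text \<open>Sets that avoid slot 0, the derivative index, are shifts of three-element subsets of the
  four curvature slots.\<close>

lemma three_subsets_of_five:
  assumes "K \<subseteq> {..<5::nat}" "card K = 3"
  shows "K \<in> {{0,1,2},{0,1,3},{0,1,4},{0,2,3},{0,2,4},{0,3,4}} \<or> K \<in> (`) Suc ` {{0,1,2},{0,1,3},{0,2,3},{1,2,3}}"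
proof (cases "0 \<in> K")
  case True
  have "card (K - {0}) = 2" using assms True by simp
  then obtain x y where xy: "K - {0} = {x, y}" "x \<noteq> y" by (meson card_2_iff)
  then have K: "K = {0, x, y}" using True by blast
  have "x \<in> K - {0}" "y \<in> K - {0}" using xy(1) by simp_all
  then have "x < 5" "x \<noteq> 0" "y < 5" "y \<noteq> 0" using assms(1) by auto
  then have "x = 1 \<or> x = 2 \<or> x = 3 \<or> x = 4" "y = 1 \<or> y = 2 \<or> y = 3 \<or> y = 4" by auto
  then show ?thesis using xy(2) unfolding K by (elim disjE) (simp_all add: insert_commute)
next
  case False
  define L where "L = (\<lambda>x. x - 1) ` K"
  have "Suc ` L = (\<lambda>x. x) ` K"
    unfolding L_def image_image
  proof (rule image_cong[OF refl])
    fix x assume "x \<in> K"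
    then show "Suc (x - 1) = x" using False by (cases x) auto
  qed
  then have "K = Suc ` L" by simp
  then have "L \<in> {{0,1,2},{0,1,3},{0,2,3},{1,2,3}}"
    using assms by (intro three_subsets_of_four) (auto simp: card_image)
  from imageI[OF this, of "(`) Suc"] show ?thesis unfolding \<open>K = Suc ` L\<close> by (rule disjI2)
qed

lemma obtain_shifted_subset:
  fixes J :: "nat set"
  assumes "3 \<le> card (J \<inter> {off..<off + w})"
  obtains K where "K \<subseteq> {..<w}" "card K = 3" "(+) off ` K \<subseteq> J"
proof -
  obtain L where L: "L \<subseteq> J \<inter> {off..<off + w}" "card L = 3"
    using obtain_subset_with_card_n[OF assms] by metis
  define K where "K = (\<lambda>x. x - off) ` L"
  have "(+) off ` K = (\<lambda>x. x) ` L"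
    unfolding K_def image_image by (rule image_cong[OF refl]) (use L(1) in auto)
  then have im: "(+) off ` K = L" by simp
  then have "card K = 3" using L(2) by (metis card_image inj_on_add)
  moreover have "K \<subseteq> {..<w}" using L(1) by (force simp: K_def)
  ultimately show ?thesis using that im L(1) by blast
qed

section \<open>Alternation inside products of derivatives of curvature\<close>

context smooth_metric
begin

lemma alt_nabla_riem5:
  assumes z: "z \<in> W" and K: "K \<subseteq> {..<5}" "card K = 3"
  shows "alt_vanishes 5 (\<lambda>I. nabla G (riem G) I z) K"
  using three_subsets_of_five[OF K]
proof
  assume "K \<in> (`) Suc ` {{0,1,2},{0,1,3},{0,2,3},{1,2,3}}"
  then obtain L where L: "K = Suc ` L" "L \<in> {{0,1,2},{0,1,3},{0,2,3},{1,2,3}}" by blast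
  have "alt_vanishes (Suc 4) (\<lambda>I. nabla G (riem G) I z) (Suc ` L)"
    by (rule alt_vanishes_nabla[OF smooth_riem _ alt_riem[OF _ L(2)] z]) (use L(2) in auto)
  then show ?thesis using L(1) by simp
qed (rule alt_nabla_riem[OF z])

text \<open>For r > 0 only r - 1 of the r + 4 slots lie outside the innermost nabla R. So r + 2
  slots of J leave at least three among its five slots, and any three of these alternate to zero.
  Without derivatives, three of four slots suffice.\<close>

lemma block_alternation:
  assumes z: "z \<in> W" and J: "(if r = 0 then 2 else r + 1) < card (J \<inter> {off..<off + r + 4})"
  obtains K where "K \<subseteq> {..<r + 4}" "(+) off ` K \<subseteq> J" "alt_vanishes (r + 4) (\<lambda>I. (nabla G ^^ r) (riem G) I z) K"
proof (cases r)
  case 0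
  then have "3 \<le> card (J \<inter> {off..<off + 4})" using J by simp
  then obtain K where K: "K \<subseteq> {..<4}" "card K = 3" "(+) off ` K \<subseteq> J" by (rule obtain_shifted_subset)
  then have "alt_vanishes 4 (\<lambda>I. riem G I z) K" using alt_riem[OF z three_subsets_of_four] by blast
  then show ?thesis using that[of K] K 0 by simp
next
  case (Suc q)
  have "J \<inter> {off..<off + r + 4} \<subseteq> {off..<off + q} \<union> (J \<inter> {off + q..<off + q + 5})" using Suc by auto
  then have "card (J \<inter> {off..<off + r + 4}) \<le> card ({off..<off + q} \<union> (J \<inter> {off + q..<off + q + 5}))"
    by (intro card_mono) auto
  also have "\<dots> \<le> q + card (J \<inter> {off + q..<off + q + 5})"
    using card_Un_le[of "{off..<off + q}" "J \<inter> {off + q..<off + q + 5}"] by simp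
  finally have "3 \<le> card (J \<inter> {off + q..<off + q + 5})" using J Suc by simp
  then obtain K where K: "K \<subseteq> {..<5}" "card K = 3" "(+) (off + q) ` K \<subseteq> J" by (rule obtain_shifted_subset)
  have "alt_vanishes (q + 5) (\<lambda>I. (nabla G ^^ q) (nabla G (riem G)) I z) ((+) q ` K)"
  proof (rule alt_vanishes_nabla_power[OF _ K(1) _ z])
    show "smooth_tens 5 (nabla G (riem G))" using smooth_nabla[OF smooth_riem] by simp
    show "alt_vanishes 5 (\<lambda>I. nabla G (riem G) I z') K" if "z' \<in> W" for z'
      by (rule alt_nabla_riem5[OF that K(1,2)])
  qed
  then have "alt_vanishes (r + 4) (\<lambda>I. (nabla G ^^ r) (riem G) I z) ((+) q ` K)"
    unfolding Suc funpow_Suc_right o_apply by (simp add: add.commute)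
  moreover have "(+) q ` K \<subseteq> {..<r + 4}" using K(1) Suc by auto
  moreover have "(+) off ` (+) q ` K \<subseteq> J" using K(3) by (simp add: image_image add.assoc)
  ultimately show ?thesis using that by blast
qed

lemma products_alternation:
  assumes z: "z \<in> W" and K: "K \<subseteq> {..<r + 4}" "alt_vanishes (r + 4) (\<lambda>I. (nabla G ^^ r) (riem G) I z) K"
    and I: "length I = v + block_size (rs1 @ r # rs2)"
  shows "(\<Sum>\<kappa> | \<kappa> permutes (+) (v + block_size rs1) ` K. of_int (sign \<kappa>) *
     nabla_products G (rs1 @ r # rs2) (drop v (permI \<kappa> I)) z) = 0"
proof -
  define n1 where "n1 = block_size rs1"
  define off where "off = v + n1"
  have fK: "finite K" using K(1) finite_subset by blast
  have len: "length I = off + (r + 4) + block_size rs2" using I by (simp add: off_def n1_def)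
  define B where "B = take (r + 4) (drop off I)"
  have lB: "length B = r + 4" using len by (simp add: B_def)
  define P1 where "P1 = nabla_products G rs1 (take n1 (drop v I)) z"
  define P2 where "P2 = nabla_products G rs2 (drop (n1 + r + 4) (drop v I)) z"
  have f: "nabla_products G (rs1 @ r # rs2) (drop v (permI (map_permutation K ((+) off) \<kappa>) I)) z =
      P1 * ((nabla G ^^ r) (riem G) (permI \<kappa> B) z * P2)" if k: "\<kappa> permutes K" for \<kappa>
  proof -
    let ?\<kappa> = "map_permutation K ((+) off) \<kappa>"
    have out: "?\<kappa> s = s" if "s < off \<or> off + (r + 4) \<le> s" for s
      by (rule map_permutation_not_in_image) (use that K(1) in auto)
    have inn: "?\<kappa> (off + s) = off + \<kappa> s" for s
      using map_permutation_inj_apply[OF _ k, of "(+) off" s] by simp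
    have kb: "\<kappa> s < r + 4" if "s < r + 4" for s
      using permutes_in_image[OF permutes_subset[OF k K(1)], of s] that by simp
    have "take n1 (drop v (permI ?\<kappa> I)) = take n1 (drop v I)"
    proof (rule nth_equalityI)
      fix s assume "s < length (take n1 (drop v (permI ?\<kappa> I)))"
      then have "v + s < off" "s < n1" by (simp_all add: off_def)
      then show "take n1 (drop v (permI ?\<kappa> I)) ! s = take n1 (drop v I) ! s"
        using out[of "v + s"] len by simp
    qed simp
    moreover have "take (r + 4) (drop n1 (drop v (permI ?\<kappa> I))) = permI \<kappa> B"
    proof (rule nth_equalityI)
      fix s assume "s < length (take (r + 4) (drop n1 (drop v (permI ?\<kappa> I))))"
      then have s: "s < r + 4" by simp
      have "take (r + 4) (drop n1 (drop v (permI ?\<kappa> I))) ! s = permI ?\<kappa> I ! (off + s)"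
        using s len by (simp add: off_def add_ac)
      also have "\<dots> = I ! (off + \<kappa> s)" using s len by (simp add: inn)
      also have "\<dots> = permI \<kappa> B ! s" using s lB kb[OF s] len by (simp add: B_def)
      finally show "take (r + 4) (drop n1 (drop v (permI ?\<kappa> I))) ! s = permI \<kappa> B ! s" .
    qed (use len lB in \<open>simp add: off_def\<close>)
    moreover have "drop (n1 + r + 4) (drop v (permI ?\<kappa> I)) = drop (n1 + r + 4) (drop v I)"
    proof (rule nth_equalityI)
      fix s assume "s < length (drop (n1 + r + 4) (drop v (permI ?\<kappa> I)))"
      then have "off + (r + 4) + s < length I" by (simp add: off_def)
      then show "drop (n1 + r + 4) (drop v (permI ?\<kappa> I)) ! s = drop (n1 + r + 4) (drop v I) ! s"
        using out[of "off + (r + 4) + s"] by (simp add: off_def add_ac)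
    qed simp
    ultimately show ?thesis
      unfolding nabla_products_split P1_def P2_def n1_def[symmetric] by simp
  qed
  have "(\<Sum>\<kappa> | \<kappa> permutes (+) off ` K. of_int (sign \<kappa>) *
     nabla_products G (rs1 @ r # rs2) (drop v (permI \<kappa> I)) z) =
     (\<Sum>\<kappa> | \<kappa> permutes K. of_int (sign \<kappa>) * (P1 * ((nabla G ^^ r) (riem G) (permI \<kappa> B) z * P2)))"
    by (subst sum_permutations_image) (auto simp: fK f)
  also have "\<dots> = (\<Sum>\<kappa> | \<kappa> permutes K. of_int (sign \<kappa>) * (nabla G ^^ r) (riem G) (permI \<kappa> B) z) * (P1 * P2)"
    unfolding sum_distrib_right by (intro sum.cong refl) (simp add: mult_ac)
  also have "\<dots> = 0" using K(2) lB by (simp add: alt_vanishes_def)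
  finally show ?thesis by (simp add: off_def n1_def)
qed

text \<open>Two slots of the volume form paired with each other give zero, and so do too many slots
  of one factor paired with the volume form. Otherwise v is at most the sum of the bounds
  \<open>cap r\<close>, this is at most the sum of the r + 2, and that is at most v; equality
  throughout forces every r to be 0.\<close>

lemma contraction_dichotomy:
  assumes z: "z \<in> W" and C: "contraction_data m v E (\<lambda>a b. gi a b z) \<nu>"
    and m: "m = v + block_size rs" and len: "(\<Sum>r\<leftarrow>rs. r + 2) \<le> v"
  defines "Y \<equiv> \<lambda>I. nabla_products G rs (drop v I) z"
  shows "contraction_data.total m v E (\<lambda>a b. gi a b z) \<nu> Y = 0 \<or>
    (\<Sum>r\<leftarrow>rs. r + 2) = v \<and> (\<forall>r\<in>set rs. r = 0) \<and> (\<forall>u<v. \<exists>s. v \<le> s \<and> s < m \<and> {u, s} \<in> E)"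
proof -
  interpret contraction_data m v E "\<lambda>a b. gi a b z" \<nu> by (rule C)
  have Y: "tail_dependent Y"
    unfolding tail_dependent_def
  proof (intro allI impI)
    fix I I' :: "'a list" assume I: "length I = m" "length I' = m" "\<forall>s. v \<le> s \<longrightarrow> s < m \<longrightarrow> I ! s = I' ! s"
    then have "drop v I = drop v I'" by (intro nth_equalityI) auto
    then show "Y I = Y I'" by (simp add: Y_def)
  qed
  show ?thesis
  proof (cases "\<exists>u u'. u < v \<and> u' < v \<and> u \<noteq> u' \<and> {u, u'} \<in> E")
    case True
    then show ?thesis using total_inner_edge[OF _ _ _ _ Y] by blast
  next
    case False
    then have cp: "card partners = v" "\<And>u. u < v \<Longrightarrow> \<exists>s. v \<le> s \<and> s < m \<and> {u, s} \<in> E"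
      using card_partners by blast+
    show ?thesis
    proof (cases "total Y = 0")
      case nz: False
      \<comment> \<open>The bound of \<open>block_alternation\<close> on the slots of one factor
        that are paired with the volume form.\<close>
      define cap where "cap r = (if r = 0 then 2 else r + 1)" for r :: nat
      have "card partners \<le> (\<Sum>r\<leftarrow>rs. cap r)"
      proof (rule card_le_by_blocks)
        show "partners \<subseteq> {v..<v + block_size rs}" using partners_sub m by simp
        fix rs1 r rs2 assume d: "rs = rs1 @ r # rs2"
        show "card (partners \<inter> {v + block_size rs1..<v + block_size rs1 + r + 4}) \<le> cap r"
        proof (rule ccontr)
          assume "\<not> card (partners \<inter> {v + block_size rs1..<v + block_size rs1 + r + 4}) \<le> cap r"
          then have "(if r = 0 then 2 else r + 1) < card (partners \<inter> {v + block_size rs1..<v + block_size rs1 + r + 4})"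
            by (simp add: cap_def)
          then obtain K where K: "K \<subseteq> {..<r + 4}" "(+) (v + block_size rs1) ` K \<subseteq> partners"
            "alt_vanishes (r + 4) (\<lambda>I. (nabla G ^^ r) (riem G) I z) K"
            using block_alternation[OF z] by blast
          have "finite K" using K(1) finite_subset by blast
          then have "total Y = 0"
            using products_alternation[OF z K(1,3), of _ v rs1 rs2] d m
            by (intro total_alternating_zero[OF _ K(2) Y]) (auto simp: Y_def)
          then show False using nz by simp
        qed
      qed
      then have v_le: "v \<le> (\<Sum>r\<leftarrow>rs. cap r)" using cp(1) by simp
      have le: "(\<Sum>r\<leftarrow>rs. cap r) \<le> (\<Sum>r\<leftarrow>rs. r + 2)" for rs
        by (induction rs) (auto simp: cap_def)
      have eq: "\<forall>r\<in>set rs. r = 0" if "(\<Sum>r\<leftarrow>rs. r + 2) \<le> (\<Sum>r\<leftarrow>rs. cap r)" for rs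
        using that
      proof (induction rs)
        case (Cons r rs)
        have "r = 0"
        proof (rule ccontr)
          assume "r \<noteq> 0"
          then show False using Cons.prems le[of rs] by (simp add: cap_def)
        qed
        then show ?case using Cons by (simp add: cap_def)
      qed simp
      have "(\<Sum>r\<leftarrow>rs. r + 2) = v" using v_le le[of rs] len by linarith
      moreover have "\<forall>r\<in>set rs. r = 0" using v_le len by (intro eq) linarith
      ultimately show ?thesis using cp(2) by blast
    qed simp
  qed
qed

lemma products_zero_slot:
  assumes "\<And>I s. s < 4 \<Longrightarrow> I ! s = t \<Longrightarrow> riem G I z = 0" "\<forall>r\<in>set rs. r = 0"
    and "s < block_size rs" "length J = block_size rs" "J ! s = t"
  shows "nabla_products G rs J z = 0"
  using assms(2-)
proof (induction rs arbitrary: J s)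
  case (Cons r rs)
  show ?case
  proof (cases "s < 4")
    case True
    then have "riem G (take 4 J) z = 0" using Cons.prems by (intro assms(1)[of s]) auto
    then show ?thesis using Cons.prems(1) by simp
  next
    case False
    then have "nabla_products G rs (drop 4 J) z = 0"
      using Cons.prems by (intro Cons.IH[of "s - 4"]) auto
    then show ?thesis using Cons.prems(1) by simp
  qed
qed simp

end

subsection \<open>Odd contractions of ambient curvature\<close>

abbreviation t_index :: "'n option option" where "t_index \<equiv> Some None"

text \<open>T is t times the coordinate field of t in the coordinates t, x, \<rho>.\<close>

lemma T_field_component: "T_field y $ b = (if b = t_index then y $ t_index else 0)"
proof -
  have "((\<lambda>s. (\<chi> b. if b = t_index then 0 else y $ b) + s *\<^sub>R (\<chi> b. if b = t_index then y $ b else 0))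
      has_vector_derivative (\<chi> b. if b = t_index then y $ b else 0)) (at 1)"
    by (auto intro!: derivative_eq_intros)
  moreover have "(\<lambda>s. dilation s y) =
      (\<lambda>s. (\<chi> b. if b = t_index then 0 else y $ b) + s *\<^sub>R (\<chi> b. if b = t_index then y $ b else 0))"
    by (auto simp: dilation_def vec_eq_iff fun_eq_iff)
  ultimately have "T_field y = (\<chi> b. if b = t_index then y $ b else 0)"
    unfolding T_field_def by (simp add: vector_derivative_at)
  then show ?thesis by simp
qed

text \<open>The subtracted term is the partial derivative of a component of T, nonzero only for the
  component t in direction t.\<close>

lemma straight_christoffel:
  assumes "straight W G" "y \<in> W"
  shows "christoffel G b a t_index y * y $ t_index =
    (if a = b then 1 else 0) - (if a = t_index \<and> b = t_index then 1 else 0)"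
proof -
  have "pd a (\<lambda>v. T_field v $ b) y = (if a = t_index \<and> b = t_index then 1 else 0)"
    unfolding T_field_component by (cases "b = t_index") (auto simp: pd_component)
  moreover have "(\<Sum>c\<in>UNIV. christoffel G b a c y * T_field y $ c) = christoffel G b a t_index y * y $ t_index"
    unfolding T_field_component by (simp add: if_distrib[where f = "\<lambda>x. _ * x"] cong: if_cong)
  moreover have "pd a (\<lambda>v. T_field v $ b) y + (\<Sum>c\<in>UNIV. christoffel G b a c y * T_field y $ c) = (if a = b then 1 else 0)"
    using assms unfolding straight_def by blast
  ultimately show ?thesis by linarith
qed

lemma iota_component: "iota z $ b = (case b of None \<Rightarrow> 0 | Some a \<Rightarrow> z $ a)"
  by (simp add: iota_def)

lemma jacobian_iota: "jacobian iota (at z) $ i $ j = (if i = Some j then 1 else 0)"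
proof -
  have "(\<lambda>y. iota y $ b) differentiable at z" for b
    unfolding iota_component by (cases b) auto
  then have "jacobian iota (at z) $ i $ j = pd j (\<lambda>y. iota y $ i) z" by (rule jacobian_component)
  also have "\<dots> = (if i = Some j then 1 else 0)"
    unfolding iota_component by (cases i) (auto simp: pd_component)
  finally show ?thesis .
qed

lemma jacobian_bundle_proj: "jacobian bundle_proj (at z) $ i $ j = (if j = Some i then 1 else 0)"
proof -
  have "(\<lambda>y. bundle_proj y $ b) differentiable at z" for b
    unfolding bundle_proj_def by simp
  then have "jacobian bundle_proj (at z) $ i $ j = pd j (\<lambda>y. bundle_proj y $ i) z" by (rule jacobian_component)
  also have "\<dots> = (if j = Some i then 1 else 0)"
    by (auto simp: bundle_proj_def pd_component)
  finally show ?thesis .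
qed

lemma pullback_component:
  "pullback \<phi> h z $ a $ b = (\<Sum>i\<in>UNIV. \<Sum>j\<in>UNIV.
     jacobian \<phi> (at z) $ i $ a * h (\<phi> z) $ i $ j * jacobian \<phi> (at z) $ j $ b)"
proof -
  have "pullback \<phi> h z $ a $ b = (\<Sum>j\<in>UNIV. \<Sum>i\<in>UNIV.
     jacobian \<phi> (at z) $ i $ a * h (\<phi> z) $ i $ j * jacobian \<phi> (at z) $ j $ b)"
    by (simp add: pullback_def matrix_matrix_mult_def transpose_def sum_distrib_right)
  also have "\<dots> = (\<Sum>i\<in>UNIV. \<Sum>j\<in>UNIV.
     jacobian \<phi> (at z) $ i $ a * h (\<phi> z) $ i $ j * jacobian \<phi> (at z) $ j $ b)"
    by (rule sum.swap)
  finally show ?thesis .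
qed

lemma pullback_iota: "pullback iota H z $ a $ b = H (iota z) $ Some a $ Some b"
proof -
  have "pullback iota H z $ a $ b =
      (\<Sum>i\<in>UNIV. if i = Some a then (\<Sum>j\<in>UNIV. if j = Some b then H (iota z) $ i $ j else 0) else 0)"
    unfolding pullback_component jacobian_iota
    by (intro sum.cong refl) (simp add: if_distrib[where f = "\<lambda>x. _ * x"] cong: if_cong)
  then show ?thesis by simp
qed

text \<open>The tautological tensor is pulled back from the base, so the fiber direction lies in its
  kernel. This is why T is null on the metric bundle.\<close>

lemma tautological_None: "tautological g z $ None $ a = 0"
  unfolding tautological_def pullback_component jacobian_bundle_proj by simp

lemma unit_section_in_cone: "x \<in> U \<Longrightarrow> unit_section x \<in> cone U"
  by (simp add: cone_def unit_section_def bundle_proj_def)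

lemma sum_list_orders: "(\<Sum>r\<leftarrow>rs. r + 2) = 2 * length rs + sum_list rs"
  by (induction rs) auto

text \<open>A factor with r derivatives is worth r + 2 in the weight. For \<mu> these numbers add up
  to at most n against n + 2 slots, for T \<rfloor> \<mu> to at most n + 1 against n + 1 slots. In
  the case of equality only undifferentiated curvature occurs, and the kernel vector of the
  determinant lemma is available.\<close>

lemma odd_contraction_zero:
  fixes g :: "real^'n::finite \<Rightarrow> real^'n^'n"
  assumes e: "coordinate_order e" and G: "straight_ambient_metric p q U g W G" and x: "x \<in> U"
    and c: "is_contraction CARD('n) c" "vol c \<noteq> NoVol" "- contraction_weight c < int CARD('n) + 1"
  shows "contraction_value e G c (iota (unit_section x)) = 0"
proof -
  let ?n = "CARD('n)"
  define z where "z = iota (unit_section x)"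
  define v where "v = vol_rank ?n (vol c)"
  define m where "m = total_rank ?n c"
  define rs where "rs = orders c"
  define \<nu> where "\<nu> A = vol_tensor e G (vol c) A z" for A
  have amb: "ambient_metric p q U g W G" and str: "straight W G"
    using G by (auto simp: straight_ambient_metric_def)
  then have met: "metric_on (p + 1) (q + 1) W G" and zW: "z \<in> W"
    using unit_section_in_cone[OF x] by (auto simp: ambient_metric_def ambient_domain_def z_def)
  interpret smooth_metric W G by (rule metric_on_smooth_metric[OF met])
  have m: "m = v + block_size rs" by (simp add: m_def v_def rs_def total_rank_def block_size_def)
  have ev: "even m" and \<sigma>: "pairing c permutes {..<m}" using c(1) by (auto simp: is_contraction_def m_def)
  define E where "E = (\<lambda>k. {pairing c (2*k), pairing c (2*k+1)}) ` {..<m div 2}"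
  define o' where "o' = map (\<lambda>i. Some (Some i)) e @ [None :: 'n option option]"
  have ao: "ambient_order e = t_index # o'" by (simp add: ambient_order_def o'_def)
  have inj: "inj_on (\<lambda>i. Some (Some i)) (set e)" by (auto simp: inj_on_def)
  have dist: "distinct (t_index # o')"
    using e inj by (auto simp: coordinate_order_def o'_def distinct_map)
  have cov: "set (t_index # o') = UNIV"
  proof -
    have "a \<in> set (t_index # o')" for a
    proof (cases a)
      case (Some b)
      then show ?thesis using e by (cases b) (auto simp: coordinate_order_def o'_def)
    qed (simp add: o'_def)
    then show ?thesis by blast
  qed
  have "length e = ?n" using e by (metis coordinate_order_def distinct_card)
  then have leno: "length o' = ?n + 1" by (simp add: o'_def)
  \<comment> \<open>The coordinate t equals 1 on the section.\<close>
  have T: "T_field z $ b = (if b = t_index then 1 else 0)" for b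
    unfolding T_field_component by (simp add: z_def iota_component unit_section_def)
  have ip: "interior_product T_field (vol_form (t_index # o') G) A z = vol_form (t_index # o') G (t_index # A) z" for A
    unfolding interior_product_def T by (simp add: if_distrib[where f = "\<lambda>x. x * _"] cong: if_cong)
  have vol_alt: "\<nu> (permI (Transposition.transpose u u') A) = - \<nu> A"
    if A: "length A = v" "u < v" "u' < v" "u \<noteq> u'" for A u u'
  proof (cases "vol c")
    case AmbVol
    then show ?thesis
      using frame_det_swap[OF dist cov, of A u u'] A leno
      by (simp add: \<nu>_def vol_form_frame_det ao v_def)
  next
    case AmbVol0
    \<comment> \<open>Inserting T fills slot 0 of \<mu> with the index t, so the slots of T
      \<rfloor> \<mu> are those of \<mu> shifted by one.\<close>
    have "t_index # permI (Transposition.transpose u u') A = permI (Transposition.transpose (Suc u) (Suc u')) (t_index # A)"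
    proof (rule nth_equalityI)
      fix s assume "s < length (t_index # permI (Transposition.transpose u u') A)"
      then show "(t_index # permI (Transposition.transpose u u') A) ! s =
          permI (Transposition.transpose (Suc u) (Suc u')) (t_index # A) ! s"
        by (cases s) (auto simp: Transposition.transpose_def)
    qed simp
    then show ?thesis
      using frame_det_swap[OF dist cov, of "t_index # A" "Suc u" "Suc u'"] A leno AmbVol0
      by (simp add: \<nu>_def ip vol_form_frame_det ao v_def)
  qed (use c in simp)
  have C: "contraction_data m v E (\<lambda>a b. gi a b z) \<nu>"
    unfolding E_def
    by (unfold_locales; (rule pairing_perfect_matching[OF ev \<sigma> gi_sym[OF zW]] vol_alt gi_sym[OF zW])?)
      (simp_all add: m)
  interpret C: contraction_data m v E "\<lambda>a b. gi a b z" \<nu> by (rule C)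
  define Y where "Y I = nabla_products G rs (drop v I) z" for I
  have wt: "C.wt I = (\<Prod>k<m div 2. gi (I ! pairing c (2*k)) (I ! pairing c (2*k+1)) z)" for I
    unfolding C.wt_def unfolding E_def
    by (rule pairing_perfect_matching(2)[OF ev \<sigma>, symmetric]) (rule gi_sym[OF zW])
  have "contraction_value e G c z = C.total Y"
    unfolding contraction_value_def Let_def contr_def C.total_def wt
    by (simp add: m_def[symmetric] v_def[symmetric] \<nu>_def Y_def rs_def)
  moreover have "C.total Y = 0"
  proof -
    \<comment> \<open>T \<rfloor> \<mu> gains one in the weight, hence the bound n + 1 for it and n
      for \<mu>.\<close>
    have cw: "2 * int (length rs) + int (sum_list rs) - (if vol c = AmbVol0 then 1 else 0) < int ?n + 1"
      using c(3) unfolding contraction_weight_def rs_def by linarith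
    have w1: "2 * length rs + sum_list rs \<le> ?n + 1" using cw by (auto split: if_splits)
    have w2: "2 * length rs + sum_list rs \<le> ?n" if "vol c = AmbVol" using cw that by simp
    have w: "(\<Sum>r\<leftarrow>rs. r + 2) \<le> v" "vol c = AmbVol \<Longrightarrow> (\<Sum>r\<leftarrow>rs. r + 2) < v"
      using w1 w2 c(2) unfolding sum_list_orders v_def by (cases "vol c"; simp)+
    note di = contraction_dichotomy[OF zW C m w(1), folded Y_def]
    show ?thesis
    proof (rule ccontr)
      assume "C.total Y \<noteq> 0"
      then have eq: "(\<Sum>r\<leftarrow>rs. r + 2) = v" and r0: "\<forall>r\<in>set rs. r = 0"
        and ext: "\<And>u. u < v \<Longrightarrow> \<exists>s. v \<le> s \<and> s < m \<and> {u, s} \<in> E"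
        using di by blast+
      then have v0: "vol c = AmbVol0" using w(2) c(2) by (cases "vol c") auto
      then have v: "v = length o'" by (simp add: v_def leno)
      have zt: "z $ t_index \<noteq> 0" by (simp add: z_def iota_component unit_section_def)
      have "C.total Y = 0"
      proof (rule C.total_zero_by_inner_sum[where t = t_index, OF ext])
        show "C.tail_dependent Y"
          unfolding C.tail_dependent_def
        proof (intro allI impI)
          fix I I' :: "'n option option list"
          assume I: "length I = m" "length I' = m" "\<forall>s. v \<le> s \<longrightarrow> s < m \<longrightarrow> I ! s = I' ! s"
          then have "drop v I = drop v I'" by (intro nth_equalityI) auto
          then show "Y I = Y I'" by (simp add: Y_def)
        qed
        show "Y I = 0" if I: "length I = m" "v \<le> s" "s < m" "I ! s = t_index" for I s
          unfolding Y_def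
        proof (rule products_zero_slot[OF _ r0, of t_index z "s - v"])
          show "riem G I z = 0" if "s < 4" "I ! s = t_index" for I s
            by (rule straight_riem[OF zW zt straight_christoffel[OF str] that])
        qed (use I m in auto)
        fix b :: "nat \<Rightarrow> 'n option option" assume b: "\<And>u. u < v \<Longrightarrow> b u \<noteq> t_index"
        have "(\<Sum>A | length A = length o'. (\<Prod>u<length o'. gi (A ! u) (b u) z) * frame_det (t_index # o') (t_index # A)) = 0"
        \<comment> \<open>c is T with its index lowered, as t = 1 here. Raising the index again
          gives the unit vector at t, whose components b \<noteq> t vanish.\<close>
        proof (rule frame_det_contraction_zero[where c = "\<lambda>y. G z $ y $ t_index", OF dist cov])
          have "pullback iota G (unit_section x) = tautological g (unit_section x)"
            using amb unit_section_in_cone[OF x] by (auto simp: ambient_metric_def)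
          then show "G z $ t_index $ t_index = 0"
            unfolding z_def by (metis pullback_iota tautological_None)
          have cz: "(\<Sum>y\<in>UNIV. gi y b z * G z $ y $ t_index) = (if b = t_index then 1 else 0)" for b
            using gi_mult(2)[OF zW, of b t_index] by (simp add: gi_sym[OF zW, of b])
          show "(\<Sum>y\<in>UNIV. gi y b z * G z $ y $ t_index) = 0" if "b \<noteq> t_index" for b
            using cz[of b] that by simp
          have "\<exists>y. G z $ y $ t_index \<noteq> 0"
          proof (rule ccontr)
            assume "\<not> (\<exists>y. G z $ y $ t_index \<noteq> 0)"
            then show False using cz[of t_index] by simp
          qed
          then show "G z $ (SOME y. G z $ y $ t_index \<noteq> 0) $ t_index \<noteq> 0" by (rule someI_ex)
        qed (use b v in simp)
        then have "sqrt \<bar>det (G z)\<bar> * (\<Sum>A | length A = v. (\<Prod>u<v. gi (A ! u) (b u) z) * frame_det (t_index # o') (t_index # A)) = 0"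
          by (simp add: v)
        then show "(\<Sum>A | length A = v. (\<Prod>u<v. gi (A ! u) (b u) z) * \<nu> A) = 0"
          by (simp add: \<nu>_def v0 ip vol_form_frame_det ao sum_distrib_left mult_ac)
      qed
      then show False using \<open>C.total Y \<noteq> 0\<close> by simp
    qed
  qed
  ultimately show ?thesis by (simp add: z_def)
qed

subsection \<open>Diagonal coordinate changes\<close>

text \<open>Diagonal maps serve two purposes: changes of sign of coordinates, and the dilations of
  the ambient space.\<close>

definition dmap :: "('a::finite \<Rightarrow> real) \<Rightarrow> real^'a \<Rightarrow> real^'a" where
  "dmap d y = (\<chi> i. d i * y $ i)"

lemma dmap_component [simp]: "dmap d y $ i = d i * y $ i"
  by (simp add: dmap_def)

lemma dmap_dmap: "dmap d (dmap d' y) = dmap (\<lambda>i. d i * d' i) y"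
  by (simp add: vec_eq_iff mult_ac)

lemma differentiable_dmap: "(\<lambda>y. dmap d y $ i) differentiable at z"
  by (simp add: differentiable_mult)

lemma pd_dmap: "pd k (\<lambda>y. dmap d y $ j) z = (if j = k then d j else 0)"
  by (simp add: pd_cmult pd_component)

lemma jacobian_dmap: "jacobian (dmap d) (at z) $ i $ j = (if i = j then d i else 0)"
  unfolding jacobian_component[OF differentiable_dmap] pd_dmap by simp

lemma pullback_dmap: "pullback (dmap d) H z $ a $ b = d a * d b * H (dmap d z) $ a $ b"
proof -
  have "pullback (dmap d) H z $ a $ b =
      (\<Sum>i\<in>UNIV. if i = a then (\<Sum>j\<in>UNIV. if j = b then d i * H (dmap d z) $ i $ j * d j else 0) else 0)"
    unfolding pullback_component jacobian_dmap
    by (intro sum.cong refl) (simp add: if_distrib[where f = "\<lambda>x. _ * x"] cong: if_cong)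
  then show ?thesis by (simp add: mult_ac)
qed

lemma pd_comp_dmap:
  assumes "f differentiable at (dmap d z)"
  shows "pd k (\<lambda>y. f (dmap d y)) z = d k * pd k f (dmap d z)"
  unfolding pd_comp[OF differentiable_dmap assms] pd_dmap
  by (simp add: if_distrib[where f = "\<lambda>x. _ * x"] mult.commute cong: if_cong)

lemma continuous_on_dmap: "continuous_on S (dmap d)"
  unfolding dmap_def by (intro continuous_intros)

lemma open_vimage_dmap: "open W \<Longrightarrow> open (dmap d -` W)"
  by (rule open_vimage[OF _ continuous_on_dmap])

lemma smooth_on_comp_dmap:
  assumes "open W" "smooth_on W f"
  shows "smooth_on (dmap d -` W) (\<lambda>y. f (dmap d y))"
proof (rule smooth_on_comp[OF open_vimage_dmap[OF assms(1)] assms(1) _ assms(2)])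
  show "smooth_on (dmap d -` W) (\<lambda>y. dmap d y $ i)" for i
    by (simp add: smooth_on_cmult[OF open_vimage_dmap[OF assms(1)] smooth_on_component])
qed simp

section \<open>Signature under congruence, and products of signs\<close>

lemma matrix_inv_unique:
  fixes A B :: "real^'a::finite^'a"
  assumes "A ** B = mat 1"
  shows "matrix_inv A = B"
proof -
  have "invertible A" using assms by (metis invertible_def matrix_left_right_inverse)
  then have "matrix_inv A ** (A ** B) = B" by (simp add: matrix_mul_assoc matrix_inv_mult)
  then show ?thesis using assms by simp
qed

lemma invertible_mult:
  fixes A B :: "real^'a::finite^'a"
  shows "invertible A \<Longrightarrow> invertible B \<Longrightarrow> invertible (A ** B)"
  by (simp add: invertible_det_nz det_mul)

text \<open>The inverse of Q carries a basis that diagonalizes A to one that diagonalizes the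
  congruent matrix, with the same diagonal.\<close>

lemma has_signature_congruent:
  fixes A Q :: "real^'a::finite^'a"
  assumes "has_signature p q A" "invertible Q"
  shows "has_signature p q (transpose Q ** A ** Q)"
proof -
  obtain P :: "real^'a^'a" and d where P: "invertible P"
    "transpose P ** A ** P = (\<chi> i j. if i = j then d i else 0)" "\<forall>i. d i = 1 \<or> d i = -1"
    "card {i. d i = 1} = p" "card {i. d i = -1} = q"
    using assms(1) unfolding has_signature_def by auto
  let ?R = "matrix_inv Q ** P"
  have Q: "Q ** matrix_inv Q = mat 1" by (rule matrix_inv_mult[OF assms(2)])
  have "invertible (matrix_inv Q)" using Q by (metis invertible_def matrix_left_right_inverse)
  then have "invertible ?R" using P(1) by (rule invertible_mult)
  moreover have "transpose ?R ** (transpose Q ** A ** Q) ** ?R = transpose P ** A ** P"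
  proof -
    have "transpose (matrix_inv Q) ** transpose Q = mat 1"
      using Q by (metis matrix_transpose_mul transpose_mat)
    then have t: "transpose ?R ** transpose Q = transpose P"
      by (metis matrix_mul_assoc matrix_mul_rid matrix_transpose_mul)
    have QR: "Q ** ?R = P" using Q by (simp add: matrix_mul_assoc)
    have "transpose ?R ** (transpose Q ** A ** Q) ** ?R = (transpose ?R ** transpose Q) ** A ** (Q ** ?R)"
      by (simp add: matrix_mul_assoc)
    then show ?thesis using t QR by simp
  qed
  ultimately show ?thesis
    unfolding has_signature_def using P(2-5) by (intro exI[of _ ?R] exI[of _ d]) (simp only: simp_thms)
qed

lemma det_jacobian_dmap: "det (jacobian (dmap d) (at z)) = (\<Prod>i\<in>UNIV. d i)"
  by (subst det_diagonal) (auto simp: jacobian_dmap)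

lemma metric_on_pullback_dmap:
  assumes "metric_on p q W G" "\<And>i. d i \<noteq> 0"
  shows "metric_on p q (dmap d -` W) (pullback (dmap d) G)"
  unfolding metric_on_def
proof (intro conjI ballI)
  have W: "open W" "smooth_tensor_on W G" using assms(1) by (auto simp: metric_on_def)
  show o: "open (dmap d -` W)" by (rule open_vimage_dmap[OF W(1)])
  show "smooth_tensor_on (dmap d -` W) (pullback (dmap d) G)"
    unfolding smooth_tensor_on_def pullback_dmap
    using W by (auto intro!: smooth_on_cmult[OF o] smooth_on_comp_dmap simp: smooth_tensor_on_def)
  fix x assume x: "x \<in> dmap d -` W"
  then have m: "transpose (G (dmap d x)) = G (dmap d x)" "has_signature p q (G (dmap d x))"
    using assms(1) by (auto simp: metric_on_def)
  then show "transpose (pullback (dmap d) G x) = pullback (dmap d) G x"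
    by (auto simp: transpose_eq_self pullback_dmap)
  have "invertible (jacobian (dmap d) (at x))"
    using assms(2) by (simp add: invertible_det_nz det_jacobian_dmap)
  then show "has_signature p q (pullback (dmap d) G x)"
    unfolding pullback_def by (rule has_signature_congruent[OF m(2)])
qed

text \<open>A sign is its own inverse, so multiplying by the sign of the old entry removes
  it.\<close>

lemma prod_list_update_sign:
  fixes \<epsilon> :: "'a \<Rightarrow> real"
  assumes "\<And>a. \<epsilon> a * \<epsilon> a = 1" "k < length I"
  shows "prod_list (map \<epsilon> (I[k := d])) = prod_list (map \<epsilon> I) * (\<epsilon> (I ! k) * \<epsilon> d)"
  using assms(2)
proof (induction I arbitrary: k)
  case (Cons a I)
  show ?case
  proof (cases k)
    case 0
    have "\<epsilon> a * x * (\<epsilon> a * \<epsilon> d) = (\<epsilon> a * \<epsilon> a) * (\<epsilon> d * x)" for x by (simp add: mult_ac)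
    then have "\<epsilon> a * x * (\<epsilon> a * \<epsilon> d) = \<epsilon> d * x" for x by (simp only: assms(1) mult_1)
    then show ?thesis by (simp only: 0 list_update.simps nat.case list.map prod_list.Cons nth_Cons_0)
  next
    case (Suc l)
    then show ?thesis using Cons by (simp add: mult_ac)
  qed
qed simp

lemma prod_list_sign_square:
  fixes \<epsilon> :: "'a \<Rightarrow> real"
  assumes "\<And>a. \<epsilon> a * \<epsilon> a = 1"
  shows "prod_list (map \<epsilon> I) * prod_list (map \<epsilon> I) = 1"
proof (induction I)
  case (Cons a I)
  have "prod_list (map \<epsilon> (a # I)) * prod_list (map \<epsilon> (a # I)) =
      (\<epsilon> a * \<epsilon> a) * (prod_list (map \<epsilon> I) * prod_list (map \<epsilon> I))"
    by (simp add: mult_ac)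
  then show ?case by (simp only: Cons assms mult_1)
qed simp

lemma prod_pairs: "(\<Prod>k<m. f (2*k) * f (2*k+1)) = (\<Prod>j<2*m. f j)" for f :: "nat \<Rightarrow> real"
  by (induction m) (simp_all add: mult_ac)

lemma prod_list_nth: "prod_list (map f I) = (\<Prod>s<length I. f (I ! s))" for f :: "'a \<Rightarrow> real"
proof (induction I rule: rev_induct)
  case (snoc a I)
  have "(\<Prod>s<length I. f ((I @ [a]) ! s)) = (\<Prod>s<length I. f (I ! s))"
    by (intro prod.cong refl) (simp add: nth_append)
  then show ?case using snoc by simp
qed simp

section \<open>Curvature under changes of sign of coordinates\<close>

context smooth_metric
begin

context
  fixes \<epsilon> :: "'a \<Rightarrow> real"
  assumes \<epsilon>: "\<And>a. \<epsilon> a * \<epsilon> a = 1"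
begin

abbreviation (input) "fl \<equiv> dmap \<epsilon>"
abbreviation (input) "W' \<equiv> dmap \<epsilon> -` W"
abbreviation (input) "G' \<equiv> pullback (dmap \<epsilon>) G"

lemma sign_cancel: "\<epsilon> a * (\<epsilon> a * x) = x" "\<epsilon> a * (x * \<epsilon> a) = x"
proof -
  have "\<epsilon> a * (\<epsilon> a * x) = (\<epsilon> a * \<epsilon> a) * x" "\<epsilon> a * (x * \<epsilon> a) = (\<epsilon> a * \<epsilon> a) * x" by (simp_all add: mult_ac)
  then show "\<epsilon> a * (\<epsilon> a * x) = x" "\<epsilon> a * (x * \<epsilon> a) = x" by (simp_all only: \<epsilon> mult_1)
qed

lemma open_W': "open W'" by (rule open_vimage_dmap[OF open_W])

lemma gi_flip:
  assumes "z \<in> W'"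
  shows "matrix_inv (G' z) $ a $ b = \<epsilon> a * \<epsilon> b * gi a b (fl z)"
proof -
  have z: "fl z \<in> W" using assms by simp
  have "G' z ** (\<chi> a b. \<epsilon> a * \<epsilon> b * gi a b (fl z)) = mat 1"
  proof -
    have "(\<Sum>k\<in>UNIV. G' z $ i $ k * (\<epsilon> k * \<epsilon> j * gi k j (fl z))) = (if i = j then 1 else 0)" for i j
    proof -
      have "(\<Sum>k\<in>UNIV. G' z $ i $ k * (\<epsilon> k * \<epsilon> j * gi k j (fl z))) =
          \<epsilon> i * \<epsilon> j * (\<Sum>k\<in>UNIV. G (fl z) $ i $ k * gi k j (fl z))"
        unfolding pullback_dmap sum_distrib_left
        by (intro sum.cong refl) (use sign_cancel in \<open>simp add: mult_ac\<close>)
      then show ?thesis using gi_mult(1)[OF z, of i j] \<epsilon> by auto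
    qed
    then show ?thesis by (simp add: vec_eq_iff matrix_matrix_mult_def mat_def)
  qed
  then have "matrix_inv (G' z) = (\<chi> a b. \<epsilon> a * \<epsilon> b * gi a b (fl z))" by (rule matrix_inv_unique)
  then show ?thesis by simp
qed

lemma pd_G_flip:
  assumes "z \<in> W'"
  shows "pd k (\<lambda>y. G' y $ a $ b) z = \<epsilon> k * \<epsilon> a * \<epsilon> b * pd k (\<lambda>y. G y $ a $ b) (fl z)"
proof -
  have z: "fl z \<in> W" using assms by simp
  have "(\<lambda>y. G (fl y) $ a $ b) differentiable at z"
    by (rule differentiable_comp[OF differentiable_dmap diff_G[OF z]])
  then have "pd k (\<lambda>y. \<epsilon> a * \<epsilon> b * G (fl y) $ a $ b) z = \<epsilon> a * \<epsilon> b * (\<epsilon> k * pd k (\<lambda>y. G y $ a $ b) (fl z))"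
    using pd_comp_dmap[OF diff_G[OF z]] by (simp add: pd_cmult)
  then show ?thesis by (simp add: pullback_dmap mult_ac)
qed

lemma christoffel_flip:
  assumes "z \<in> W'"
  shows "christoffel G' k i j z = \<epsilon> k * \<epsilon> i * \<epsilon> j * christoffel G k i j (fl z)"
proof -
  have "matrix_inv (G' z) $ k $ l * (pd i (\<lambda>y. G' y $ j $ l) z + pd j (\<lambda>y. G' y $ i $ l) z - pd l (\<lambda>y. G' y $ i $ j) z) =
     \<epsilon> k * \<epsilon> i * \<epsilon> j * (gi k l (fl z) * (pd i (\<lambda>y. G y $ j $ l) (fl z) + pd j (\<lambda>y. G y $ i $ l) (fl z) - pd l (\<lambda>y. G y $ i $ j) (fl z)))" for l
  proof -
    have "\<epsilon> k * \<epsilon> l * x * (\<epsilon> i * \<epsilon> j * \<epsilon> l * y1 + \<epsilon> j * \<epsilon> i * \<epsilon> l * y2 - \<epsilon> l * \<epsilon> i * \<epsilon> j * y3) =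
        (\<epsilon> l * \<epsilon> l) * (\<epsilon> k * \<epsilon> i * \<epsilon> j * (x * (y1 + y2 - y3)))" for x y1 y2 y3
      by (simp add: algebra_simps)
    then show ?thesis by (simp only: gi_flip[OF assms] pd_G_flip[OF assms] \<epsilon> mult_1)
  qed
  then show ?thesis
    unfolding christoffel_def by (simp add: sum_distrib_left)
qed

lemma pd_christoffel_flip:
  assumes "z \<in> W'"
  shows "pd c (christoffel G' k i j) z = \<epsilon> c * \<epsilon> k * \<epsilon> i * \<epsilon> j * pd c (christoffel G k i j) (fl z)"
proof -
  have z: "fl z \<in> W" using assms by simp
  have "pd c (christoffel G' k i j) z = pd c (\<lambda>y. (\<epsilon> k * \<epsilon> i * \<epsilon> j) * christoffel G k i j (fl y)) z"
    by (rule pd_cong_open[OF open_W' assms]) (simp add: christoffel_flip)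
  also have "\<dots> = (\<epsilon> k * \<epsilon> i * \<epsilon> j) * (\<epsilon> c * pd c (christoffel G k i j) (fl z))"
    using pd_comp_dmap[OF diff_christoffel[OF z]]
    by (subst pd_cmult[OF differentiable_comp[OF differentiable_dmap diff_christoffel[OF z]]]) simp
  finally show ?thesis by (simp add: mult_ac)
qed

lemma riem_up_flip:
  assumes "z \<in> W'"
  shows "riem_up G' m j k l z = \<epsilon> m * \<epsilon> j * \<epsilon> k * \<epsilon> l * riem_up G m j k l (fl z)"
proof -
  have q: "(\<epsilon> m * \<epsilon> k * \<epsilon> s * x) * (\<epsilon> s * \<epsilon> l * \<epsilon> j * y) = \<epsilon> m * \<epsilon> j * \<epsilon> k * \<epsilon> l * (x * y)" for k l s x y
  proof -
    have "(\<epsilon> m * \<epsilon> k * \<epsilon> s * x) * (\<epsilon> s * \<epsilon> l * \<epsilon> j * y) = (\<epsilon> s * \<epsilon> s) * (\<epsilon> m * \<epsilon> j * \<epsilon> k * \<epsilon> l * (x * y))"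
      by (simp add: mult_ac)
    then show ?thesis by (simp add: \<epsilon>)
  qed
  have "(\<Sum>s\<in>UNIV. christoffel G' m k s z * christoffel G' s l j z - christoffel G' m l s z * christoffel G' s k j z) =
     \<epsilon> m * \<epsilon> j * \<epsilon> k * \<epsilon> l * (\<Sum>s\<in>UNIV. christoffel G m k s (fl z) * christoffel G s l j (fl z) - christoffel G m l s (fl z) * christoffel G s k j (fl z))"
    unfolding sum_distrib_left christoffel_flip[OF assms] q by (simp add: algebra_simps)
  then show ?thesis
    unfolding riem_up_def pd_christoffel_flip[OF assms] by (simp add: algebra_simps)
qed

lemma ricci_flip:
  assumes "z \<in> W'"
  shows "ricci G' z = pullback fl (ricci G) z"
proof -
  have "riem_up G' m j m l z = \<epsilon> j * \<epsilon> l * riem_up G m j m l (fl z)" for m j l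
  proof -
    have "riem_up G' m j m l z = (\<epsilon> m * \<epsilon> m) * (\<epsilon> j * \<epsilon> l * riem_up G m j m l (fl z))"
      unfolding riem_up_flip[OF assms] by (simp add: mult_ac)
    then show ?thesis by (simp only: \<epsilon> mult_1)
  qed
  then show ?thesis
    by (simp add: vec_eq_iff ricci_def pullback_dmap sum_distrib_left)
qed

text \<open>S' is the pullback of the covariant tensor S under the sign change: every index
  contributes its sign.\<close>

definition flipped :: "nat \<Rightarrow> 'a tensor \<Rightarrow> 'a tensor \<Rightarrow> bool" where
  "flipped m S' S \<longleftrightarrow> (\<forall>I z. length I = m \<longrightarrow> z \<in> W' \<longrightarrow> S' I z = prod_list (map \<epsilon> I) * S I (fl z))"

lemma flipped_riem: "flipped 4 (riem G') (riem G)"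
  unfolding flipped_def
proof (intro allI impI)
  fix I :: "'a list" and z assume I: "length I = 4" and z: "z \<in> W'"
  have "prod_list (map \<epsilon> I) = \<epsilon> (I ! 0) * \<epsilon> (I ! 1) * \<epsilon> (I ! 2) * \<epsilon> (I ! 3)"
    unfolding prod_list_nth I by (simp add: numeral_eq_Suc lessThan_Suc mult_ac)
  moreover have "G' z $ (I!0) $ m * riem_up G' m (I!1) (I!2) (I!3) z =
      \<epsilon> (I ! 0) * \<epsilon> (I ! 1) * \<epsilon> (I ! 2) * \<epsilon> (I ! 3) * (G (fl z) $ (I!0) $ m * riem_up G m (I!1) (I!2) (I!3) (fl z))" for m
  proof -
    have "G' z $ (I!0) $ m * riem_up G' m (I!1) (I!2) (I!3) z = (\<epsilon> m * \<epsilon> m) *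
      (\<epsilon> (I ! 0) * \<epsilon> (I ! 1) * \<epsilon> (I ! 2) * \<epsilon> (I ! 3) * (G (fl z) $ (I!0) $ m * riem_up G m (I!1) (I!2) (I!3) (fl z)))"
      unfolding riem_up_flip[OF z] pullback_dmap by (simp add: mult_ac)
    then show ?thesis by (simp only: \<epsilon> mult_1)
  qed
  ultimately show "riem G' I z = prod_list (map \<epsilon> I) * riem G I (fl z)"
    unfolding riem_def sum_distrib_left by (simp only:)
qed

lemma flipped_nabla:
  assumes S: "smooth_tens m S" and f: "flipped m S' S"
  shows "flipped (Suc m) (nabla G' S') (nabla G S)"
  unfolding flipped_def
proof (intro allI impI)
  fix I :: "'a list" and z assume "length I = Suc m" and z: "z \<in> W'"
  then obtain a J where I: "I = a # J" "length J = m" by (cases I) auto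
  have zW: "fl z \<in> W" using z by simp
  have dS: "S J differentiable at (fl z)"
    using S I smooth_on_differentiable[OF _ open_W zW] by (simp add: smooth_tens_def)
  have "pd a (S' J) z = pd a (\<lambda>y. prod_list (map \<epsilon> J) * S J (fl y)) z"
    by (rule pd_cong_open[OF open_W' z]) (use f I in \<open>simp add: flipped_def\<close>)
  also have "\<dots> = prod_list (map \<epsilon> J) * (\<epsilon> a * pd a (S J) (fl z))"
    using pd_comp_dmap[OF dS] by (subst pd_cmult[OF differentiable_comp[OF differentiable_dmap dS]]) simp
  finally have 1: "pd a (S' J) z = prod_list (map \<epsilon> I) * pd a (S J) (fl z)" by (simp add: I)
  \<comment> \<open>The contracted index d and the replaced index J ! k each contribute their sign
    twice.\<close>
  have 2: "christoffel G' d a (J ! k) z * S' (J[k := d]) z =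
      prod_list (map \<epsilon> I) * (christoffel G d a (J ! k) (fl z) * S (J[k := d]) (fl z))" if "k < length J" for k d
  proof -
    have "S' (J[k := d]) z = prod_list (map \<epsilon> J) * (\<epsilon> (J ! k) * \<epsilon> d) * S (J[k := d]) (fl z)"
      using f I z that prod_list_update_sign[of \<epsilon>, OF \<epsilon>] by (simp add: flipped_def)
    moreover have "(\<epsilon> d * \<epsilon> a * \<epsilon> j * x) * (p * (\<epsilon> j * \<epsilon> d) * y) = (\<epsilon> d * \<epsilon> d) * ((\<epsilon> j * \<epsilon> j) * ((\<epsilon> a * p) * (x * y)))" for j x y p
      by (simp add: mult_ac)
    ultimately show ?thesis by (simp add: christoffel_flip[OF z] \<epsilon> I)
  qed
  show "nabla G' S' I z = prod_list (map \<epsilon> I) * nabla G S I (fl z)"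
    unfolding nabla_def I(1) list.sel
    by (simp add: 1[unfolded I(1)] 2[unfolded I(1)] right_diff_distrib sum_distrib_left)
qed

lemma flipped_nabla_riem: "flipped (r + 4) ((nabla G' ^^ r) (riem G')) ((nabla G ^^ r) (riem G))"
proof (induction r)
  case (Suc r)
  show ?case using flipped_nabla[OF smooth_nabla_power[OF smooth_riem] Suc] by simp
qed (simp add: flipped_riem)

lemma nabla_products_flip:
  assumes z: "z \<in> W'"
  shows "length J = block_size rs \<Longrightarrow> nabla_products G' rs J z = prod_list (map \<epsilon> J) * nabla_products G rs J (fl z)"
proof (induction rs arbitrary: J)
  case (Cons r rs)
  have "prod_list (map \<epsilon> J) = prod_list (map \<epsilon> (take (r + 4) J)) * prod_list (map \<epsilon> (drop (r + 4) J))"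
    by (metis append_take_drop_id map_append prod_list.append)
  moreover have "nabla_products G' rs (drop (r + 4) J) z = prod_list (map \<epsilon> (drop (r + 4) J)) * nabla_products G rs (drop (r + 4) J) (fl z)"
    using Cons.prems by (intro Cons.IH) simp
  moreover have "(nabla G' ^^ r) (riem G') (take (r + 4) J) z =
      prod_list (map \<epsilon> (take (r + 4) J)) * (nabla G ^^ r) (riem G) (take (r + 4) J) (fl z)"
    using flipped_nabla_riem[of r] Cons.prems z by (simp add: flipped_def)
  ultimately show ?case by (simp add: mult_ac)
qed simp

text \<open>The index in each slot meets its sign once in the inverse metrics and once in the
  tensor, so every sign is squared.\<close>

lemma contr_products_flip:
  assumes z: "z \<in> W'" and m: "even m" "m = block_size rs" and \<sigma>: "\<sigma> permutes {..<m}"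
  shows "contr G' m \<sigma> (nabla_products G' rs) z = contr G m \<sigma> (nabla_products G rs) (fl z)"
  unfolding contr_def
proof (intro sum.cong refl)
  fix I :: "'a list" assume "I \<in> {I. length I = m}"
  then have I: "length I = m" by simp
  have "(\<Prod>k<m div 2. \<epsilon> (I ! \<sigma> (2*k)) * \<epsilon> (I ! \<sigma> (2*k+1))) = (\<Prod>j<m. \<epsilon> (I ! \<sigma> j))"
    using prod_pairs[of "\<lambda>j. \<epsilon> (I ! \<sigma> j)" "m div 2"] m(1) by simp
  also have "\<dots> = (\<Prod>j<m. \<epsilon> (I ! j))"
    using prod.permute[OF \<sigma>, of "\<lambda>j. \<epsilon> (I ! j)"] by (simp add: o_def)
  also have "\<dots> = prod_list (map \<epsilon> I)" by (simp add: prod_list_nth I)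
  finally have p: "(\<Prod>k<m div 2. \<epsilon> (I ! \<sigma> (2*k)) * \<epsilon> (I ! \<sigma> (2*k+1))) = prod_list (map \<epsilon> I)" .
  have "(\<Prod>k<m div 2. matrix_inv (G' z) $ (I ! \<sigma> (2*k)) $ (I ! \<sigma> (2*k+1))) =
     prod_list (map \<epsilon> I) * (\<Prod>k<m div 2. gi (I ! \<sigma> (2*k)) (I ! \<sigma> (2*k+1)) (fl z))"
    unfolding gi_flip[OF z] p[symmetric] by (simp add: prod.distrib)
  moreover have "nabla_products G' rs I z = prod_list (map \<epsilon> I) * nabla_products G rs I (fl z)"
    by (rule nabla_products_flip[OF z]) (simp add: I m)
  moreover have "(x * a) * (x * b) = (x * x) * (a * b)" for x a b :: real by (simp add: mult_ac)
  ultimately show "(\<Prod>k<m div 2. matrix_inv (G' z) $ (I ! \<sigma> (2*k)) $ (I ! \<sigma> (2*k+1))) * nabla_products G' rs I z =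
      (\<Prod>k<m div 2. gi (I ! \<sigma> (2*k)) (I ! \<sigma> (2*k+1)) (fl z)) * nabla_products G rs I (fl z)"
    by (simp only: prod_list_sign_square[of \<epsilon>, OF \<epsilon>] mult_1)
qed

end

end

subsection \<open>Reflections of ambient metrics\<close>

text \<open>Sign 1 on the added coordinate. Lifted twice, a sign change of x acts on t, x, \<rho>
  and fixes t and \<rho>.\<close>

definition lift_sign :: "('a \<Rightarrow> real) \<Rightarrow> 'a option \<Rightarrow> real" where
  "lift_sign \<epsilon> a = (case a of None \<Rightarrow> 1 | Some i \<Rightarrow> \<epsilon> i)"

lemma lift_sign_simps [simp]: "lift_sign \<epsilon> None = 1" "lift_sign \<epsilon> (Some i) = \<epsilon> i"
  by (simp_all add: lift_sign_def)

lemma lift_sign_square: "(\<And>i. \<epsilon> i * \<epsilon> i = 1) \<Longrightarrow> lift_sign \<epsilon> a * lift_sign \<epsilon> a = 1"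
  by (cases a) auto

lemma dmap_iota: "dmap (lift_sign \<epsilon>) (iota z) = iota (dmap \<epsilon> z)"
  by (auto simp: vec_eq_iff iota_component split: option.split)

lemma dmap_unit_section: "dmap (lift_sign \<epsilon>) (unit_section x) = unit_section (dmap \<epsilon> x)"
  by (auto simp: vec_eq_iff unit_section_def split: option.split)

lemma bundle_proj_dmap: "bundle_proj (dmap (lift_sign \<epsilon>) z) = dmap \<epsilon> (bundle_proj z)"
  by (simp add: vec_eq_iff bundle_proj_def)

lemma cone_proj_dmap: "cone_proj (dmap (lift_sign \<epsilon>) y) = dmap \<epsilon> (cone_proj y)"
  by (simp add: vec_eq_iff cone_proj_def)

lemma cone_dmap: "z \<in> cone (dmap \<epsilon> -` U) \<longleftrightarrow> dmap (lift_sign \<epsilon>) z \<in> cone U"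
  by (simp add: cone_def bundle_proj_dmap)

lemma dilation_dmap: "dilation s = dmap (\<lambda>b. if b = t_index then s else 1)"
  by (auto simp: fun_eq_iff vec_eq_iff dilation_def)

lemma pullback_bundle_proj:
  "pullback bundle_proj h z $ a $ b =
    (case (a, b) of (Some i, Some j) \<Rightarrow> h (bundle_proj z) $ i $ j | _ \<Rightarrow> 0)"
proof -
  have "pullback bundle_proj h z $ a $ b = (\<Sum>i\<in>UNIV. if a = Some i then
      (\<Sum>j\<in>UNIV. if b = Some j then h (bundle_proj z) $ i $ j else 0) else 0)"
    unfolding pullback_component jacobian_bundle_proj
    by (intro sum.cong refl) (simp add: if_distrib[where f = "\<lambda>x. _ * x"] cong: if_cong)
  then show ?thesis by (cases a; cases b) auto
qed

lemma tautological_component: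
  "tautological g z $ a $ b = (case (a, b) of (Some i, Some j) \<Rightarrow> (z $ None)\<^sup>2 * g (bundle_proj z) $ i $ j | _ \<Rightarrow> 0)"
  unfolding tautological_def pullback_bundle_proj by (auto split: option.split)

lemma tautological_dmap:
  "tautological (pullback (dmap \<epsilon>) g) z $ a $ b =
    lift_sign \<epsilon> a * lift_sign \<epsilon> b * tautological g (dmap (lift_sign \<epsilon>) z) $ a $ b"
  unfolding tautological_component by (auto simp: pullback_dmap bundle_proj_dmap split: option.split)

text \<open>The pulled-back ambient metric turns out to be a straight ambient metric for the
  pulled-back metric. It is the second ambient metric to which the oddness hypothesis is
  applied.\<close>

locale reflected_ambient =
  fixes p q :: nat and U :: "(real^'n::finite) set" and g W G and \<epsilon> :: "'n \<Rightarrow> real"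
  assumes g: "metric_on p q U g" and G: "straight_ambient_metric p q U g W G"
    and \<epsilon>: "\<And>i. \<epsilon> i * \<epsilon> i = 1"
begin

abbreviation "\<epsilon>2 \<equiv> lift_sign (lift_sign \<epsilon>)"

lemma \<epsilon>2: "\<epsilon>2 a * \<epsilon>2 a = 1"
  by (intro lift_sign_square \<epsilon>)

lemma met: "metric_on (p + 1) (q + 1) W G"
  using G by (simp add: straight_ambient_metric_def ambient_metric_def)

sublocale smooth_metric W G
  by (rule metric_on_smooth_metric[OF met])

sublocale base: smooth_metric U g
  by (rule metric_on_smooth_metric[OF g])

abbreviation "Wr \<equiv> dmap \<epsilon>2 -` W"
abbreviation "Gr \<equiv> pullback (dmap \<epsilon>2) G"
abbreviation "Ur \<equiv> dmap \<epsilon> -` U"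
abbreviation "gr \<equiv> pullback (dmap \<epsilon>) g"

lemma ambient_domain_reflected: "ambient_domain Ur Wr"
proof -
  have d: "open W" "iota ` cone U \<subseteq> W" "\<And>y. y \<in> W \<Longrightarrow> cone_proj y \<in> cone U"
    "\<And>y s. y \<in> W \<Longrightarrow> s > 0 \<Longrightarrow> dilation s y \<in> W"
    using G by (auto simp: straight_ambient_metric_def ambient_metric_def ambient_domain_def)
  have c: "dmap \<epsilon>2 (dilation s y) = dilation s (dmap \<epsilon>2 y)" for s y
    unfolding dilation_dmap dmap_dmap by (simp add: mult.commute)
  show ?thesis
    unfolding ambient_domain_def
  proof (intro conjI ballI allI impI)
    show "open Wr" by (rule open_vimage_dmap[OF d(1)])
    show "iota ` cone Ur \<subseteq> Wr"
    proof
      fix y assume "y \<in> iota ` cone Ur"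
      then obtain z where z: "y = iota z" "dmap (lift_sign \<epsilon>) z \<in> cone U" by (auto simp: cone_dmap)
      have "iota (dmap (lift_sign \<epsilon>) z) \<in> W" using d(2) z(2) by blast
      then show "y \<in> Wr" by (simp add: z(1) dmap_iota)
    qed
    show "cone_proj y \<in> cone Ur" if "y \<in> Wr" for y
      using d(3)[of "dmap \<epsilon>2 y"] that by (simp add: cone_dmap cone_proj_dmap)
    show "dilation s y \<in> Wr" if "y \<in> Wr" "s > 0" for y s
      using d(4)[of "dmap \<epsilon>2 y" s] that by (simp add: c)
  qed
qed

lemma smooth_tensor_reflected:
  assumes "smooth_tensor_on W S"
  shows "smooth_tensor_on Wr (pullback (dmap \<epsilon>2) S)"
  unfolding smooth_tensor_on_def pullback_dmap
proof (intro allI)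
  fix i j
  have "smooth_on W (\<lambda>z. S z $ i $ j)" using assms by (simp add: smooth_tensor_on_def)
  from smooth_on_comp_dmap[OF open_W this]
  show "smooth_on Wr (\<lambda>z. \<epsilon>2 i * \<epsilon>2 j * S (dmap \<epsilon>2 z) $ i $ j)"
    by (rule smooth_on_cmult[OF open_vimage_dmap[OF open_W]])
qed

text \<open>The reflection fixes \<rho>, so the same power of \<rho> splits off from the reflected
  Ricci tensor.\<close>

lemma rho_quotient_reflected:
  assumes "rho_quotient W m (ricci G) S"
  shows "rho_quotient Wr m (ricci Gr) (pullback (dmap \<epsilon>2) S)"
proof -
  have S: "smooth_tensor_on W S" "\<And>y. y \<in> W \<Longrightarrow> ricci G y = (y $ None) ^ m *\<^sub>R S y"
    using assms by (auto simp: rho_quotient_def)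
  have "ricci Gr y = (y $ None) ^ m *\<^sub>R pullback (dmap \<epsilon>2) S y" if "y \<in> Wr" for y
  proof -
    have "dmap \<epsilon>2 y \<in> W" using that by simp
    from S(2)[OF this] show ?thesis
      using ricci_flip[of \<epsilon>2, OF \<epsilon>2 that] by (simp add: vec_eq_iff pullback_dmap)
  qed
  then show ?thesis using smooth_tensor_reflected[OF S(1)] by (simp add: rho_quotient_def)
qed

lemma O_plus_reflected:
  assumes "O_plus U g W m (ricci G)"
  shows "O_plus Ur gr Wr m (ricci Gr)"
proof -
  obtain S where S: "rho_quotient W m (ricci G) S" and s: "\<And>z. z \<in> cone U \<Longrightarrow> \<exists>s. transpose s = s \<and>
      trace (matrix_inv (g (bundle_proj z)) ** s) = 0 \<and> pullback iota S z = pullback bundle_proj (\<lambda>_. s) z"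
    using assms unfolding O_plus_def by blast
  have "\<exists>s. transpose s = s \<and> trace (matrix_inv (gr (bundle_proj z)) ** s) = 0 \<and>
      pullback iota (pullback (dmap \<epsilon>2) S) z = pullback bundle_proj (\<lambda>_. s) z" if z: "z \<in> cone Ur" for z
  proof -
    let ?z = "dmap (lift_sign \<epsilon>) z"
    have zU: "?z \<in> cone U" using z by (simp add: cone_dmap)
    obtain s where s: "transpose s = s" "trace (matrix_inv (g (bundle_proj ?z)) ** s) = 0"
      "pullback iota S ?z = pullback bundle_proj (\<lambda>_. s) ?z" using s[OF zU] by blast
    have bz: "bundle_proj z \<in> Ur" using z by (simp add: cone_def)
    \<comment> \<open>The reflected tensor. The inverse metric in the trace carries the same two
      signs, so the trace does not change.\<close>
    define s' where "s' = (\<chi> i j. \<epsilon> i * \<epsilon> j * s $ i $ j)"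
    have "transpose s' = s'" using s(1) by (auto simp: s'_def transpose_eq_self)
    moreover have "trace (matrix_inv (gr (bundle_proj z)) ** s') = 0"
    proof -
      have "matrix_inv (gr (bundle_proj z)) $ i $ j * s' $ j $ i =
          matrix_inv (g (bundle_proj ?z)) $ i $ j * s $ j $ i" for i j
      proof -
        have "matrix_inv (gr (bundle_proj z)) $ i $ j * s' $ j $ i =
          (\<epsilon> i * \<epsilon> i) * ((\<epsilon> j * \<epsilon> j) * (matrix_inv (g (bundle_proj ?z)) $ i $ j * s $ j $ i))"
          unfolding base.gi_flip[of \<epsilon>, OF \<epsilon> bz] s'_def bundle_proj_dmap by (simp add: mult_ac)
        then show ?thesis by (simp only: \<epsilon> mult_1)
      qed
      then have "trace (matrix_inv (gr (bundle_proj z)) ** s') = trace (matrix_inv (g (bundle_proj ?z)) ** s)"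
        by (simp only: trace_def matrix_matrix_mult_def vec_lambda_beta)
      then show ?thesis using s(2) by simp
    qed
    moreover have "pullback iota (pullback (dmap \<epsilon>2) S) z $ a $ b = pullback bundle_proj (\<lambda>_. s') z $ a $ b" for a b
    proof -
      have "S (iota ?z) $ Some a $ Some b = (case (a, b) of (Some i, Some j) \<Rightarrow> s $ i $ j | _ \<Rightarrow> 0)"
        using s(3) by (metis pullback_bundle_proj pullback_iota)
      then show ?thesis
        unfolding pullback_iota pullback_dmap pullback_bundle_proj dmap_iota
        by (auto simp: s'_def split: option.split)
    qed
    ultimately show ?thesis by (metis vec_eq_iff)
  qed
  then show ?thesis using rho_quotient_reflected[OF S] unfolding O_plus_def by blast
qed

lemma straight_reflected: "straight Wr Gr"
  unfolding straight_def
proof (intro ballI allI)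
  fix y :: "real^('n option option)" and a b assume y: "y \<in> Wr"
  have st: "straight W G" using G by (simp add: straight_ambient_metric_def)
  have yW: "dmap \<epsilon>2 y \<in> W" using y by simp
  have "pd a (\<lambda>v. T_field v $ b) y = (if a = t_index \<and> b = t_index then 1 else 0)"
    unfolding T_field_component by (cases "b = t_index") (auto simp: pd_component)
  moreover have "(\<Sum>c\<in>UNIV. christoffel Gr b a c y * T_field y $ c) = christoffel Gr b a t_index y * y $ t_index"
    unfolding T_field_component by (simp add: if_distrib[where f = "\<lambda>x. _ * x"] cong: if_cong)
  moreover have "christoffel Gr b a t_index y * y $ t_index =
      \<epsilon>2 b * \<epsilon>2 a * (christoffel G b a t_index (dmap \<epsilon>2 y) * dmap \<epsilon>2 y $ t_index)"
    using christoffel_flip[of \<epsilon>2, OF \<epsilon>2 y] by simp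
  moreover have "\<dots> = (if a = b then 1 else 0) - (if a = t_index \<and> b = t_index then 1 else 0)"
    unfolding straight_christoffel[OF st yW] using \<epsilon>2[of b] by auto
  ultimately show "pd a (\<lambda>v. T_field v $ b) y + (\<Sum>c\<in>UNIV. christoffel Gr b a c y * T_field y $ c) =
      (if a = b then 1 else 0)" by linarith
qed

lemma straight_ambient_metric_reflected: "straight_ambient_metric p q Ur gr Wr Gr"
  unfolding straight_ambient_metric_def ambient_metric_def
proof (intro conjI straight_reflected ambient_domain_reflected impI allI ballI)
  have nz: "\<epsilon>2 a \<noteq> 0" for a using \<epsilon>2[of a] by auto
  show "metric_on (p + 1) (q + 1) Wr Gr" by (rule metric_on_pullback_dmap[OF met nz])
  have amb: "ambient_metric p q U g W G" using G by (simp add: straight_ambient_metric_def)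
  show "pullback (dilation s) Gr y = s\<^sup>2 *\<^sub>R Gr y" if s: "s > 0" and y: "y \<in> Wr" for s y
  proof -
    have "pullback (dilation s) G (dmap \<epsilon>2 y) = s\<^sup>2 *\<^sub>R G (dmap \<epsilon>2 y)"
      using amb s y by (simp add: ambient_metric_def)
    then have "pullback (dilation s) G (dmap \<epsilon>2 y) $ a $ b = s\<^sup>2 * G (dmap \<epsilon>2 y) $ a $ b" for a b by simp
    then show ?thesis
      unfolding dilation_dmap by (simp add: vec_eq_iff pullback_dmap dmap_dmap mult_ac)
  qed
  show "pullback iota Gr z = tautological gr z" if z: "z \<in> cone Ur" for z
  proof -
    have "dmap (lift_sign \<epsilon>) z \<in> cone U" using z by (simp add: cone_dmap)
    then have "pullback iota G (dmap (lift_sign \<epsilon>) z) = tautological g (dmap (lift_sign \<epsilon>) z)"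
      using amb by (simp add: ambient_metric_def)
    then have "G (iota (dmap (lift_sign \<epsilon>) z)) $ Some a $ Some b = tautological g (dmap (lift_sign \<epsilon>) z) $ a $ b" for a b
      by (metis pullback_iota)
    then show ?thesis
      by (simp add: vec_eq_iff pullback_iota pullback_dmap tautological_dmap dmap_iota)
  qed
  show "vanishes_infinite_order Wr (ricci Gr)" if "odd CARD('n)"
    using amb that rho_quotient_reflected unfolding ambient_metric_def vanishes_infinite_order_def by blast
  show "O_plus Ur gr Wr (CARD('n) div 2 - 1) (ricci Gr)" if "even CARD('n)"
    using amb that by (intro O_plus_reflected) (simp add: ambient_metric_def)
qed

lemma contraction_value_reflected:
  assumes c: "is_contraction CARD('n) c" "vol c = NoVol" and x: "dmap \<epsilon> x \<in> U"
  shows "contraction_value e Gr c (iota (unit_section x)) =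
    contraction_value e G c (iota (unit_section (dmap \<epsilon> x)))"
proof -
  define m where "m = total_rank CARD('n) c"
  have m: "even m" "m = block_size (orders c)" "pairing c permutes {..<m}"
    using c by (auto simp: is_contraction_def m_def total_rank_def block_size_def)
  have d: "iota (unit_section (dmap \<epsilon> x)) = dmap \<epsilon>2 (iota (unit_section x))"
    by (simp add: dmap_iota dmap_unit_section)
  have z: "iota (unit_section x) \<in> Wr"
    using ambient_domain_reflected unit_section_in_cone[of x Ur] x by (auto simp: ambient_domain_def)
  have "contraction_value e H c z = contr H m (pairing c) (nabla_products H (orders c)) z" for H z
    unfolding contraction_value_def by (simp add: c(2) m_def contr_def)
  then show ?thesis
    unfolding d by (simp only: contr_products_flip[of \<epsilon>2, OF \<epsilon>2 z m(1,2,3)])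
qed

end

lemma diffeo_dmap_involution:
  assumes "open U" "\<And>i. \<epsilon> i * \<epsilon> i = (1::real)"
  shows "diffeo (dmap \<epsilon> -` U) U (dmap \<epsilon>)"
proof -
  have inv: "dmap \<epsilon> (dmap \<epsilon> y) = y" for y by (simp add: dmap_dmap assms(2) vec_eq_iff)
  have o: "open (dmap \<epsilon> -` U)" by (rule open_vimage_dmap[OF assms(1)])
  have bij: "bij_betw (dmap \<epsilon>) (dmap \<epsilon> -` U) U"
    by (rule bij_betw_byWitness[where f' = "dmap \<epsilon>"]) (auto simp: inv)
  have "inv_into (dmap \<epsilon> -` U) (dmap \<epsilon>) y = dmap \<epsilon> y" if "y \<in> U" for y
    using bij that inv by (intro inv_into_f_eq) (auto simp: bij_betw_def)
  then have "smooth_on U (\<lambda>y. inv_into (dmap \<epsilon> -` U) (dmap \<epsilon>) y $ i)" for i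
    by (intro smooth_on_cong[OF assms(1) _ smooth_on_cmult[OF assms(1) smooth_on_component, of "\<epsilon> i" i]]) simp
  moreover have "smooth_on (dmap \<epsilon> -` U) (\<lambda>y. dmap \<epsilon> y $ i)" for i
    by (simp add: smooth_on_cmult[OF o smooth_on_component])
  ultimately show ?thesis using assms(1) o bij by (simp add: diffeo_def smooth_map_on_def)
qed

text \<open>Contractions with a volume form vanish for the original and for the reflected ambient
  metric, and those without one take equal values. So the value is unchanged by a reflection, while
  oddness makes it change sign.\<close>

theorem odd_weyl_invariant_vanishes:
  fixes C :: "(real \<times> contraction) list" and e :: "'n::finite list"
  assumes e: "coordinate_order e" and C: "weyl_invariant CARD('n) w C" "odd_weyl p q e C"
    and w: "- w < int CARD('n) + 1"
    and g: "metric_on p q U g" and G: "straight_ambient_metric p q U g W G" and x: "x \<in> U"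
  shows "weyl_value e C G x = 0"
proof -
  \<comment> \<open>Any coordinate will do; its sign is reversed.\<close>
  define i0 :: 'n where "i0 = undefined"
  define \<epsilon> :: "'n \<Rightarrow> real" where "\<epsilon> i = (if i = i0 then -1 else 1)" for i
  have \<epsilon>: "\<epsilon> i * \<epsilon> i = 1" for i by (simp add: \<epsilon>_def)
  interpret reflected_ambient p q U g W G \<epsilon>
    by unfold_locales (use g G \<epsilon> in auto)
  define y where "y = dmap \<epsilon> x"
  have inv: "dmap \<epsilon> y = x" by (simp add: y_def dmap_dmap \<epsilon> vec_eq_iff)
  have "orientation_reversing Ur (dmap \<epsilon>)"
  proof -
    have "(\<Prod>i\<in>UNIV. \<epsilon> i) = (\<Prod>i\<in>insert i0 (UNIV - {i0}). \<epsilon> i)" by (simp add: insert_absorb)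
    also have "\<dots> = \<epsilon> i0 * (\<Prod>i\<in>UNIV - {i0}. \<epsilon> i)" by (subst prod.insert) auto
    also have "(\<Prod>i\<in>UNIV - {i0}. \<epsilon> i) = 1" by (intro prod.neutral) (simp add: \<epsilon>_def)
    finally show ?thesis by (simp add: orientation_reversing_def det_jacobian_dmap \<epsilon>_def)
  qed
  moreover have "diffeo Ur U (dmap \<epsilon>)"
    using g by (intro diffeo_dmap_involution \<epsilon>) (simp add: metric_on_def)
  ultimately have "\<forall>x\<in>Ur. weyl_value e C Gr x = - weyl_value e C G (dmap \<epsilon> x)"
    using C(2) g G straight_ambient_metric_reflected unfolding odd_weyl_def by blast
  then have "weyl_value e C Gr y = - weyl_value e C G x" using x by (simp add: inv)
  moreover have "weyl_value e C Gr y = weyl_value e C G x"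
  proof -
    have "contraction_value e Gr c (iota (unit_section y)) = contraction_value e G c (iota (unit_section x))"
      if ac: "(a, c) \<in> set C" for a c
    proof -
      have c: "is_contraction CARD('n) c" "contraction_weight c = w"
        using C(1) ac unfolding weyl_invariant_def by auto
      show ?thesis
      proof (cases "vol c = NoVol")
        case True
        then show ?thesis using contraction_value_reflected[OF c(1) True, of y] x by (simp add: inv)
      next
        case False
        have "y \<in> Ur" using x by (simp add: inv)
        then show ?thesis
          using odd_contraction_zero[OF e G x c(1) False]
            odd_contraction_zero[OF e straight_ambient_metric_reflected _ c(1) False, of y] w c(2) by simp
      qed
    qed
    then show ?thesis unfolding weyl_value_def by (intro arg_cong[of _ _ sum_list] map_cong refl) auto
  qed
  ultimately show ?thesis by simp
qed

subsection \<open>Signature is locally constant\<close>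

definition near_diag :: "('a::finite \<Rightarrow> real) \<Rightarrow> real \<Rightarrow> real^'a^'a \<Rightarrow> bool" where
  "near_diag \<eta> \<delta> A \<longleftrightarrow> (\<forall>i j. A $ i $ j = A $ j $ i) \<and> (\<forall>i j. \<bar>A $ i $ j - (if i = j then \<eta> i else 0)\<bar> < \<delta>)"

lemma congruence_component:
  fixes A Q :: "real^'a::finite^'a"
  shows "(transpose Q ** A ** Q) $ a $ b = (\<Sum>i\<in>UNIV. \<Sum>j\<in>UNIV. Q $ i $ a * A $ i $ j * Q $ j $ b)"
proof -
  have "(transpose Q ** A ** Q) $ a $ b = (\<Sum>j\<in>UNIV. \<Sum>i\<in>UNIV. Q $ i $ a * A $ i $ j * Q $ j $ b)"
    by (simp add: matrix_matrix_mult_def transpose_def sum_distrib_right)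
  also have "\<dots> = (\<Sum>i\<in>UNIV. \<Sum>j\<in>UNIV. Q $ i $ a * A $ i $ j * Q $ j $ b)"
    by (rule sum.swap)
  finally show ?thesis .
qed

text \<open>One step of completing the square with pivot \<open>A $ i $ i\<close>; the remaining
  block becomes a Schur complement.\<close>

lemma eliminate_row:
  fixes A :: "real^'a::finite^'a" and i :: 'a
  assumes sym: "\<And>x y. A $ x $ y = A $ y $ x" and nz: "A $ i $ i \<noteq> 0"
  obtains Q where "invertible Q"
    "\<And>j k. (transpose Q ** A ** Q) $ j $ k =
      (if j = i \<or> k = i then (if j = k then A $ i $ i else 0) else A $ j $ k - A $ i $ j * A $ i $ k / A $ i $ i)"
proof -
  define r where "r y = (if y = i then 0 else A $ i $ y / A $ i $ i)" for y
  define Q :: "real^'a^'a" where "Q = (\<chi> x y. (if x = y then 1 else 0) - (if x = i then r y else 0))"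
  define Q' :: "real^'a^'a" where "Q' = (\<chi> x y. (if x = y then 1 else 0) + (if x = i then r y else 0))"
  have ri: "r i = 0" by (simp add: r_def)
  have "Q ** Q' = mat 1"
  proof -
    have "(\<Sum>k\<in>UNIV. Q $ x $ k * Q' $ k $ y) = (if x = y then 1 else 0)" for x y
    proof -
      have "(\<Sum>k\<in>UNIV. Q $ x $ k * Q' $ k $ y) =
        (\<Sum>k\<in>UNIV. (if k = x then Q' $ x $ y else 0) - (if x = i then (if k = y then r y else 0) else 0)
          - (if x = i then (if k = i then r i * r y else 0) else 0))"
        by (intro sum.cong refl) (simp add: Q_def Q'_def algebra_simps)
      also have "\<dots> = Q' $ x $ y - (if x = i then r y else 0)"
        by (simp add: sum_subtractf ri)
      finally show ?thesis by (simp add: Q'_def)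
    qed
    then show ?thesis by (simp add: vec_eq_iff matrix_matrix_mult_def mat_def)
  qed
  then have inv: "invertible Q" by (metis invertible_def matrix_left_right_inverse)
  have AQ: "(\<Sum>y\<in>UNIV. A $ x $ y * Q $ y $ k) = A $ x $ k - A $ x $ i * r k" for x k
  proof -
    have "(\<Sum>y\<in>UNIV. A $ x $ y * Q $ y $ k) =
      (\<Sum>y\<in>UNIV. (if y = k then A $ x $ k else 0) - (if y = i then A $ x $ i * r k else 0))"
      by (intro sum.cong refl) (simp add: Q_def algebra_simps)
    then show ?thesis by (simp add: sum_subtractf)
  qed
  have F: "(transpose Q ** A ** Q) $ j $ k = A $ j $ k - A $ j $ i * r k - r j * (A $ i $ k - A $ i $ i * r k)" for j k
  proof -
    have "(transpose Q ** A ** Q) $ j $ k = (\<Sum>x\<in>UNIV. Q $ x $ j * (A $ x $ k - A $ x $ i * r k))"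
      unfolding congruence_component AQ[symmetric] by (simp add: sum_distrib_left mult.assoc)
    also have "\<dots> = (\<Sum>x\<in>UNIV. (if x = j then A $ j $ k - A $ j $ i * r k else 0)
        - (if x = i then r j * (A $ i $ k - A $ i $ i * r k) else 0))"
      by (intro sum.cong refl) (simp add: Q_def algebra_simps)
    finally show ?thesis by (simp add: sum_subtractf)
  qed
  have "(transpose Q ** A ** Q) $ j $ k =
      (if j = i \<or> k = i then (if j = k then A $ i $ i else 0) else A $ j $ k - A $ i $ j * A $ i $ k / A $ i $ i)" for j k
    unfolding F r_def using nz sym[of j i] by (auto simp: field_simps)
  with inv show ?thesis by (rule that)
qed

text \<open>Rows are cleared one at a time. A pivot close to 1 or -1 makes the corrections of the
  other entries quadratically small, so closeness to the diagonal matrix survives with a controlled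
  loss.\<close>

lemma near_diag_elimination:
  fixes \<eta> :: "'a::finite \<Rightarrow> real"
  assumes \<eta>: "\<And>i. \<bar>\<eta> i\<bar> = 1" and S: "finite S"
  shows "\<epsilon> > 0 \<Longrightarrow> \<exists>\<delta>>0. \<forall>A. near_diag \<eta> \<delta> A \<longrightarrow> (\<exists>Q. invertible Q \<and>
    near_diag \<eta> \<epsilon> (transpose Q ** A ** Q) \<and> (\<forall>i\<in>S. \<forall>j. j \<noteq> i \<longrightarrow> (transpose Q ** A ** Q) $ i $ j = 0))"
  using S
proof (induction S arbitrary: \<epsilon> rule: finite_induct)
  case empty
  have "near_diag \<eta> \<epsilon> A \<longrightarrow> (\<exists>Q. invertible Q \<and> near_diag \<eta> \<epsilon> (transpose Q ** A ** Q))" for A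
    by (intro impI exI[of _ "mat 1"]) (simp add: invertible_det_nz transpose_mat)
  then show ?case using empty by (intro exI[of _ \<epsilon>]) simp
next
  case (insert i S)
  \<comment> \<open>The bound 1/2 keeps the pivot above 1/2 in absolute value, so a correction is at
    most 2 * \<epsilon>1 * \<epsilon>1 \<le> \<epsilon>1. Together with the distance \<epsilon>1
    before the step this stays within \<epsilon>.\<close>
  define \<epsilon>1 where "\<epsilon>1 = min (\<epsilon> / 2) (1 / 2)"
  have e1: "\<epsilon>1 > 0" "\<epsilon>1 \<le> 1/2" "2 * \<epsilon>1 \<le> \<epsilon>" using insert.prems by (auto simp: \<epsilon>1_def)
  obtain \<delta> where \<delta>: "\<delta> > 0" and step: "\<And>A. near_diag \<eta> \<delta> A \<Longrightarrow> \<exists>Q. invertible Q \<and>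
    near_diag \<eta> \<epsilon>1 (transpose Q ** A ** Q) \<and> (\<forall>i\<in>S. \<forall>j. j \<noteq> i \<longrightarrow> (transpose Q ** A ** Q) $ i $ j = 0)"
    using insert.IH[OF e1(1)] by blast
  have "\<exists>Q. invertible Q \<and> near_diag \<eta> \<epsilon> (transpose Q ** A ** Q) \<and>
      (\<forall>i\<in>insert i S. \<forall>j. j \<noteq> i \<longrightarrow> (transpose Q ** A ** Q) $ i $ j = 0)" if A: "near_diag \<eta> \<delta> A" for A
  proof -
    obtain Q where Q: "invertible Q" "near_diag \<eta> \<epsilon>1 (transpose Q ** A ** Q)"
      "\<forall>i\<in>S. \<forall>j. j \<noteq> i \<longrightarrow> (transpose Q ** A ** Q) $ i $ j = 0" using step[OF A] by blast
    define B where "B = transpose Q ** A ** Q"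
    have Bs: "B $ x $ y = B $ y $ x" and Bn: "\<bar>B $ x $ y - (if x = y then \<eta> x else 0)\<bar> < \<epsilon>1" for x y
      using Q(2) unfolding near_diag_def B_def by blast+
    have "\<bar>B $ i $ i - \<eta> i\<bar> < 1/2" using Bn[of i i] e1(2) by simp
    then have Bii: "\<bar>B $ i $ i\<bar> > 1/2" using \<eta>[of i] by linarith
    then have nz: "B $ i $ i \<noteq> 0" by auto
    obtain R where R: "invertible R" "\<And>j k. (transpose R ** B ** R) $ j $ k =
      (if j = i \<or> k = i then (if j = k then B $ i $ i else 0) else B $ j $ k - B $ i $ j * B $ i $ k / B $ i $ i)"
      using eliminate_row[OF Bs nz] by blast
    have c: "transpose (Q ** R) ** A ** (Q ** R) = transpose R ** B ** R"
      by (simp add: B_def matrix_transpose_mul matrix_mul_assoc)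
    have "near_diag \<eta> \<epsilon> (transpose R ** B ** R)"
      unfolding near_diag_def
    proof (intro conjI allI)
      show "(transpose R ** B ** R) $ j $ k = (transpose R ** B ** R) $ k $ j" for j k
        unfolding R(2) using Bs[of j k] by (auto simp: mult.commute)
      show "\<bar>(transpose R ** B ** R) $ j $ k - (if j = k then \<eta> j else 0)\<bar> < \<epsilon>" for j k
      proof (cases "j = i \<or> k = i")
        case True
        then show ?thesis unfolding R(2) using Bn[of i i] e1 by auto
      next
        case False
        have "\<bar>B $ i $ j\<bar> < \<epsilon>1" "\<bar>B $ i $ k\<bar> < \<epsilon>1" using Bn[of i j] Bn[of i k] False by auto
        then have "\<bar>B $ i $ j\<bar> * \<bar>B $ i $ k\<bar> \<le> (1/2) * \<epsilon>1" using e1 by (intro mult_mono) auto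
        then have "\<bar>B $ i $ j * B $ i $ k\<bar> \<le> \<epsilon>1 * (1/2)" by (simp add: abs_mult)
        also have "\<dots> \<le> \<epsilon>1 * \<bar>B $ i $ i\<bar>" using Bii e1 by (intro mult_left_mono) auto
        finally have "\<bar>B $ i $ j * B $ i $ k / B $ i $ i\<bar> \<le> \<epsilon>1"
          using nz by (simp add: abs_divide divide_le_eq)
        then have "\<bar>(B $ j $ k - (if j = k then \<eta> j else 0)) - B $ i $ j * B $ i $ k / B $ i $ i\<bar> < \<epsilon>"
          using Bn[of j k] e1(3) by linarith
        then show ?thesis unfolding R(2) using False by (simp add: algebra_simps)
      qed
    qed
    \<comment> \<open>Rows cleared earlier have a zero in column i, so the correction does not touch
      them.\<close>
    moreover have "(transpose R ** B ** R) $ x $ j = 0" if "x \<in> insert i S" "j \<noteq> x" for x j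
    proof (cases "x = i \<or> j = i")
      case False
      then have "x \<in> S" using that by simp
      then have "B $ x $ j = 0" "B $ x $ i = 0" using Q(3) that False unfolding B_def by auto
      then show ?thesis unfolding R(2) using Bs[of x i] False by simp
    qed (use that in \<open>auto simp: R(2)\<close>)
    ultimately show ?thesis
      using invertible_mult[OF Q(1) R(1)] by (intro exI[of _ "Q ** R"]) (simp only: c, blast)
  qed
  then show ?case using \<delta> by blast
qed

text \<open>Once all off-diagonal entries are cleared, diagonal entries at distance less than 1 from
  \<eta> have its signs, and rescaling the basis turns them into \<eta>.\<close>

lemma near_diag_signature:
  fixes \<eta> :: "'a::finite \<Rightarrow> real"
  assumes \<eta>: "\<And>i. \<bar>\<eta> i\<bar> = 1" and card: "card {i. \<eta> i = 1} = p" "card {i. \<eta> i = -1} = q"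
  obtains \<delta> where "\<delta> > 0" "\<And>A. near_diag \<eta> \<delta> A \<Longrightarrow> has_signature p q A"
proof -
  obtain \<delta> where \<delta>: "\<delta> > 0" and step: "\<And>A. near_diag \<eta> \<delta> A \<Longrightarrow> \<exists>Q. invertible Q \<and>
    near_diag \<eta> 1 (transpose Q ** A ** Q) \<and> (\<forall>i\<in>UNIV. \<forall>j. j \<noteq> i \<longrightarrow> (transpose Q ** A ** Q) $ i $ j = 0)"
    using near_diag_elimination[of \<eta> UNIV 1, OF \<eta>] by auto
  have "has_signature p q A" if A: "near_diag \<eta> \<delta> A" for A
  proof -
    obtain Q where Q: "invertible Q" "near_diag \<eta> 1 (transpose Q ** A ** Q)"
      "\<And>i j. j \<noteq> i \<Longrightarrow> (transpose Q ** A ** Q) $ i $ j = 0" using step[OF A] by blast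
    define B where "B = transpose Q ** A ** Q"
    have Bd: "\<bar>B $ i $ i - \<eta> i\<bar> < 1" for i
      using Q(2) unfolding near_diag_def B_def by (metis (full_types))
    have sgn: "B $ i $ i = \<eta> i * \<bar>B $ i $ i\<bar>" "B $ i $ i \<noteq> 0" for i
      using Bd[of i] \<eta>[of i] by (auto simp: abs_if split: if_splits)
    define R :: "real^'a^'a" where "R = (\<chi> i j. if i = j then 1 / sqrt \<bar>B $ i $ i\<bar> else 0)"
    have "det R = (\<Prod>i\<in>UNIV. 1 / sqrt \<bar>B $ i $ i\<bar>)" unfolding R_def by (subst det_diagonal) auto
    then have "invertible R" using sgn(2) by (simp add: invertible_det_nz)
    then have inv: "invertible (Q ** R)" by (rule invertible_mult[OF Q(1)])
    have "(transpose R ** B ** R) $ a $ b = (if a = b then \<eta> a else 0)" for a b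
    proof -
      have "(transpose R ** B ** R) $ a $ b = (\<Sum>i\<in>UNIV. if i = a then (\<Sum>j\<in>UNIV. if j = b then R $ i $ i * B $ i $ j * R $ j $ j else 0) else 0)"
        unfolding congruence_component
        by (intro sum.cong refl) (simp add: R_def if_distrib[where f = "\<lambda>x. _ * x"] cong: if_cong)
      also have "\<dots> = R $ a $ a * B $ a $ b * R $ b $ b" by simp
      also have "\<dots> = (if a = b then \<eta> a else 0)"
      proof (cases "a = b")
        case True
        have "R $ a $ a * B $ a $ a * R $ a $ a = B $ a $ a / (sqrt \<bar>B $ a $ a\<bar> * sqrt \<bar>B $ a $ a\<bar>)" by (simp add: R_def)
        also have "\<dots> = B $ a $ a / \<bar>B $ a $ a\<bar>" by simp
        also have "\<dots> = \<eta> a" using sgn[of a] by (metis abs_eq_0 nonzero_mult_div_cancel_right)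
        finally show ?thesis using True by simp
      next
        case False
        then show ?thesis using Q(3)[of b a] by (simp add: B_def)
      qed
      finally show ?thesis .
    qed
    moreover have "transpose (Q ** R) ** A ** (Q ** R) = transpose R ** B ** R"
      by (simp add: B_def matrix_transpose_mul matrix_mul_assoc)
    ultimately have "transpose (Q ** R) ** A ** (Q ** R) = (\<chi> i j. if i = j then \<eta> i else 0)"
      by (simp add: vec_eq_iff)
    moreover have "\<forall>i. \<eta> i = 1 \<or> \<eta> i = -1" using \<eta> by (metis abs_if equation_minus_iff)
    ultimately show ?thesis unfolding has_signature_def using inv card by blast
  qed
  then show ?thesis using that \<delta> by blast
qed

text \<open>Signature is an open condition. This provides the open set that the definition of an
  invariant asks for, as the polynomial metrics below can degenerate away from the origin.\<close>

lemma metric_near: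
  fixes h :: "real^'a::finite \<Rightarrow> real^'a^'a"
  assumes \<eta>: "\<And>i. \<bar>\<eta> i\<bar> = 1" and card: "card {i. \<eta> i = 1} = p" "card {i. \<eta> i = -1} = q"
    and h: "smooth_tensor_on UNIV h" "\<And>y i j. h y $ i $ j = h y $ j $ i"
    and h0: "\<And>i j. h 0 $ i $ j = (if i = j then \<eta> i else 0)"
  obtains V where "0 \<in> V" "metric_on p q V h"
proof -
  obtain \<delta> where \<delta>: "\<delta> > 0" "\<And>A. near_diag \<eta> \<delta> A \<Longrightarrow> has_signature p q A"
    using near_diag_signature[OF \<eta> card] by blast
  define V where "V = (\<Inter>i. \<Inter>j. {y. \<bar>h y $ i $ j - (if i = j then \<eta> i else 0)\<bar> < \<delta>})"
  have sm: "smooth_on UNIV (\<lambda>y. h y $ i $ j)" for i j using h(1) by (simp add: smooth_tensor_on_def)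
  have cont: "continuous_on UNIV (\<lambda>y. h y $ i $ j)" for i j
    using Ck_differentiable_on[OF smooth_on_Ck[OF sm]] differentiable_imp_continuous_on by blast
  have "open V"
    unfolding V_def by (intro open_INT finite ballI open_Collect_less continuous_intros cont)
  moreover have "0 \<in> V" using \<delta>(1) by (simp add: V_def h0)
  moreover have "has_signature p q (h y)" if "y \<in> V" for y
    by (rule \<delta>(2)) (use that h(2)[of y] in \<open>auto simp: near_diag_def V_def\<close>)
  moreover have "smooth_tensor_on V h"
    using sm smooth_on_subset unfolding smooth_tensor_on_def by blast
  ultimately have "metric_on p q V h" unfolding metric_on_def transpose_eq_self using h(2) by auto
  then show ?thesis using that \<open>0 \<in> V\<close> by blast
qed

subsection \<open>Iterated derivatives\<close>

lemma pds_add: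
  assumes "open S" "smooth_on S f" "smooth_on S g" "z \<in> S"
  shows "pds ks (\<lambda>y. f y + g y) z = pds ks f z + pds ks g z"
  using assms(4)
proof (induction ks arbitrary: z)
  case (Cons k ks)
  have "pd k (pds ks (\<lambda>y. f y + g y)) z = pd k (\<lambda>y. pds ks f y + pds ks g y) z"
    by (rule pd_cong_open[OF assms(1) Cons.prems Cons.IH])
  also have "\<dots> = pd k (pds ks f) z + pd k (pds ks g) z"
    by (intro pd_add smooth_on_differentiable[OF smooth_on_pds[OF assms(2)] assms(1) Cons.prems]
        smooth_on_differentiable[OF smooth_on_pds[OF assms(3)] assms(1) Cons.prems])
  finally show ?case by simp
qed simp

lemma pds_cmult:
  assumes "open S" "smooth_on S f" "z \<in> S"
  shows "pds ks (\<lambda>y. c * f y) z = c * pds ks f z"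
  using assms(3)
proof (induction ks arbitrary: z)
  case (Cons k ks)
  have "pd k (pds ks (\<lambda>y. c * f y)) z = pd k (\<lambda>y. c * pds ks f y) z"
    by (rule pd_cong_open[OF assms(1) Cons.prems Cons.IH])
  also have "\<dots> = c * pd k (pds ks f) z"
    by (intro pd_cmult smooth_on_differentiable[OF smooth_on_pds[OF assms(2)] assms(1) Cons.prems])
  finally show ?case by simp
qed simp

lemma pds_const: "pds ks (\<lambda>_. c) z = (if ks = [] then c else 0)"
proof (induction ks arbitrary: z)
  case (Cons k ks)
  have "pds ks (\<lambda>_. c) = (\<lambda>_. if ks = [] then c else 0)" by (rule ext) (rule Cons.IH)
  then show ?case by simp
qed simp

lemma pds_sum:
  assumes "open S" "finite A" "\<And>x. x \<in> A \<Longrightarrow> smooth_on S (f x)" "z \<in> S"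
  shows "pds ks (\<lambda>y. \<Sum>x\<in>A. f x y) z = (\<Sum>x\<in>A. pds ks (f x) z)"
  using assms(2,3)
proof (induction A rule: finite_induct)
  case (insert x A)
  have "smooth_on S (\<lambda>y. \<Sum>x\<in>A. f x y)" using insert.prems by (intro smooth_on_sum assms(1)) simp
  then show ?case using insert pds_add[OF assms(1), of "f x" "\<lambda>y. \<Sum>x\<in>A. f x y"] assms(4) by simp
qed (simp add: pds_const)

lemma pds_move:
  assumes "open S" "smooth_on S f" "z \<in> S"
  shows "pds (u @ x # v) f z = pds (x # u @ v) f z"
  using assms(3)
proof (induction u arbitrary: z)
  case (Cons y u)
  have "pd y (pds (u @ x # v) f) z = pd y (pd x (pds (u @ v) f)) z"
    using Cons.IH by (intro pd_cong_open[OF assms(1) Cons.prems]) simp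
  also have "\<dots> = pd x (pd y (pds (u @ v) f)) z"
    by (rule smooth_on_pd_commute[OF assms(1) smooth_on_pds[OF assms(2)] Cons.prems])
  finally show ?case by simp
qed simp

lemma pds_mset:
  assumes "open S" "smooth_on S f"
  shows "mset ks = mset ls \<Longrightarrow> z \<in> S \<Longrightarrow> pds ks f z = pds ls f z"
proof (induction ks arbitrary: ls z)
  case (Cons k ks)
  have "k \<in> set ls" using Cons.prems(1) by (metis list.set_intros(1) set_mset_mset)
  then obtain u v where ls: "ls = u @ k # v" by (metis split_list)
  then have "mset ks = mset (u @ v)" using Cons.prems(1) by simp
  then have "pd k (pds ks f) z = pd k (pds (u @ v) f) z"
    using Cons.IH by (intro pd_cong_open[OF assms(1) Cons.prems(2)]) blast
  then show ?case unfolding ls pds_move[OF assms Cons.prems(2)] by simp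
qed simp

text \<open>The derivatives at the origin of the k-th power of the linear form b; only those of
  order exactly k survive.\<close>

definition pow_jet :: "nat \<Rightarrow> real^'a::finite \<Rightarrow> 'a list \<Rightarrow> real" where
  "pow_jet k b ls = (if length ls = k then fact k * prod_list (map (($) b) ls) else 0)"

lemma smooth_on_inner: "smooth_on S (\<lambda>y. b \<bullet> y)" if "open S" for b :: "real^'a::finite"
  unfolding inner_vec_def inner_real_def by (intro smooth_on_sum smooth_on_cmult smooth_on_component that)

lemma pd_inner: "pd i (\<lambda>y. b \<bullet> y) z = b $ i" for b :: "real^'a::finite"
proof -
  have "pd i (\<lambda>y. b \<bullet> y) z = (\<Sum>j\<in>UNIV. pd i (\<lambda>y. b $ j * y $ j) z)"
    unfolding inner_vec_def inner_real_def by (intro pd_sum) auto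
  also have "\<dots> = (\<Sum>j\<in>UNIV. if j = i then b $ i else 0)"
    by (intro sum.cong refl) (simp add: pd_cmult pd_component)
  finally show ?thesis by simp
qed

lemma pd_power:
  fixes f :: "real^'a::finite \<Rightarrow> real"
  assumes "f differentiable at z"
  shows "pd i (\<lambda>y. f y ^ k) z = real k * f z ^ (k - 1) * pd i f z"
proof (induction k)
  case (Suc k)
  have "pd i (\<lambda>y. f y * f y ^ k) z = f z * pd i (\<lambda>y. f y ^ k) z + pd i f z * f z ^ k"
    by (intro pd_mult assms differentiable_power)
  then show ?case unfolding Suc by (cases k) (simp_all add: algebra_simps)
qed simp

text \<open>The falling factorial is written with truncated subtraction, which makes it zero once
  more than k derivatives are taken.\<close>

lemma pds_power_inner:
  fixes b :: "real^'a::finite"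
  shows "pds ls (\<lambda>y. (b \<bullet> y) ^ k) z =
    real (\<Prod>j<length ls. k - j) * prod_list (map (($) b) ls) * (b \<bullet> z) ^ (k - length ls)"
proof (induction ls arbitrary: z)
  case (Cons i ls)
  have d: "(\<lambda>y. b \<bullet> y) differentiable at z"
    by (rule smooth_on_differentiable[OF smooth_on_inner[OF open_UNIV] open_UNIV]) simp
  let ?c = "real (\<Prod>j<length ls. k - j) * prod_list (map (($) b) ls)"
  have "pds (i # ls) (\<lambda>y. (b \<bullet> y) ^ k) z = pd i (\<lambda>y. ?c * (b \<bullet> y) ^ (k - length ls)) z"
    using Cons by (simp add: pds.simps(2)) (metis (no_types, lifting) ext)
  also have "\<dots> = ?c * (real (k - length ls) * (b \<bullet> z) ^ (k - length ls - 1) * b $ i)"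
    by (simp add: pd_cmult pd_power d pd_inner differentiable_power)
  finally show ?case by (simp add: mult_ac)
qed simp

lemma prod_diff_fact: "(\<Prod>j<k. k - j) = fact k"
  by (induction k) (simp_all add: prod.lessThan_Suc_shift del: prod.lessThan_Suc)

lemma pds_power_inner_0:
  fixes b :: "real^'a::finite"
  shows "pds ls (\<lambda>y. (b \<bullet> y) ^ k) 0 = pow_jet k b ls"
proof -
  consider "length ls < k" | "length ls = k" | "length ls > k" by linarith
  then show ?thesis
  proof cases
    case 2
    then show ?thesis unfolding pds_power_inner pow_jet_def by (simp only: prod_diff_fact) simp
  next
    case 3
    then have "(\<Prod>j<length ls. k - j) = 0" by (intro prod_zero) auto
    then show ?thesis using 3 unfolding pds_power_inner pow_jet_def by simp
  qed (simp add: pds_power_inner pow_jet_def)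
qed

subsection \<open>Local diffeomorphisms\<close>

lemma smooth_mapD: "smooth_map_on S \<phi> \<Longrightarrow> smooth_on S (\<lambda>y. \<phi> y $ i)"
  by (simp add: smooth_map_on_def)

lemma has_derivative_jacobian:
  fixes \<phi> :: "real^'a::finite \<Rightarrow> real^'b::finite"
  assumes "\<And>i. (\<lambda>y. \<phi> y $ i) differentiable at z"
  shows "(\<phi> has_derivative (\<lambda>v. jacobian \<phi> (at z) *v v)) (at z)"
proof -
  have "(\<lambda>v. \<chi> i. \<Sum>j\<in>UNIV. pd j (\<lambda>y. \<phi> y $ i) z * v $ j) = (\<lambda>v. jacobian \<phi> (at z) *v v)"
    by (auto simp: fun_eq_iff vec_eq_iff matrix_vector_mult_def jacobian_component[OF assms])
  then show ?thesis using has_derivative_map[OF assms] by simp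
qed

lemma continuous_on_smooth: "open S \<Longrightarrow> smooth_on S f \<Longrightarrow> continuous_on S f"
  using Ck_differentiable_on[OF smooth_on_Ck] differentiable_imp_continuous_on by blast

text \<open>Bootstrapping: the derivative of the inverse g is the inverse Jacobian of \<phi>
  evaluated along g, so it is as regular as g itself.\<close>

lemma Ck_of_inverse_jacobian:
  fixes \<phi> :: "real^'a::finite \<Rightarrow> real^'a"
  assumes \<phi>: "smooth_map_on UNIV \<phi>" and V: "open V"
    and g: "\<And>y i. y \<in> V \<Longrightarrow> (\<lambda>y. g y $ i) differentiable at y"
    and pdg: "\<And>y i j. y \<in> V \<Longrightarrow> pd j (\<lambda>y. g y $ i) y = matrix_inv (jacobian \<phi> (at (g y))) $ i $ j"
    and det: "\<And>y. y \<in> V \<Longrightarrow> det (jacobian \<phi> (at (g y))) \<noteq> 0"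
  shows "Ck k V (\<lambda>y. g y $ i)"
proof (induction k arbitrary: i)
  case 0
  show ?case using g V by (simp add: Ck_0 differentiable_on_eq_differentiable_at)
next
  case (Suc k)
  have jac: "jacobian \<phi> (at x) $ r $ c = pd c (\<lambda>y. \<phi> y $ r) x" for x r c
    by (rule jacobian_component[OF smooth_on_differentiable[OF smooth_mapD[OF \<phi>] open_UNIV UNIV_I]])
  have "Ck k V (pd j (\<lambda>y. g y $ i))" for j
  proof (rule Ck_cong[OF V])
    show "Ck k V (\<lambda>y. matrix_inv (jacobian \<phi> (at (g y))) $ i $ j)"
    proof (rule Ck_matrix_inv[OF V _ det])
      show "Ck k V (\<lambda>y. jacobian \<phi> (at (g y)) $ r $ c)" for r c
        unfolding jac
        by (rule Ck_comp[OF V open_UNIV UNIV_I smooth_on_Ck[OF smooth_on_pd[OF smooth_mapD[OF \<phi>]]] Suc.IH])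
    qed
  qed (rule pdg[symmetric])
  then show ?case using g V by (simp add: Ck_Suc differentiable_on_eq_differentiable_at)
qed

lemma local_diffeo:
  fixes \<phi> :: "real^'a::finite \<Rightarrow> real^'a"
  assumes \<phi>: "smooth_map_on UNIV \<phi>" and det0: "det (jacobian \<phi> (at 0)) \<noteq> 0"
    and N: "open N" "\<phi> 0 \<in> N"
  obtains U V where "0 \<in> U" "V \<subseteq> N" "diffeo U V \<phi>"
    "orientation_preserving U \<phi> \<or> orientation_reversing U \<phi>"
proof -
  let ?J = "\<lambda>x. jacobian \<phi> (at x)"
  have d: "(\<lambda>y. \<phi> y $ i) differentiable at x" for i x
    by (rule smooth_on_differentiable[OF smooth_mapD[OF \<phi>] open_UNIV UNIV_I])
  have jac: "?J x $ r $ c = pd c (\<lambda>y. \<phi> y $ r) x" for x r c by (rule jacobian_component[OF d])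
  have cJ: "continuous_on UNIV (\<lambda>x. ?J x $ r $ c)" for r c
    unfolding jac by (rule continuous_on_smooth[OF open_UNIV smooth_on_pd[OF smooth_mapD[OF \<phi>]]])
  have cdet: "continuous_on UNIV (\<lambda>x. det (?J x))"
    unfolding det_def by (intro continuous_intros cJ)
  have c\<phi>: "continuous_on UNIV \<phi>"
  proof -
    have "continuous_on UNIV (\<lambda>y. \<chi> i. \<phi> y $ i)"
      by (intro continuous_on_vec_lambda continuous_on_smooth[OF open_UNIV smooth_mapD[OF \<phi>]])
    then show ?thesis by simp
  qed
  \<comment> \<open>Requiring the determinant to keep the sign it has at 0 settles the orientation
    behavior on all of U.\<close>
  define U0 where "U0 = {x. det (?J x) * det (?J 0) > 0} \<inter> \<phi> -` N"
  have U0: "open U0"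
    unfolding U0_def by (intro open_Int open_Collect_less continuous_intros cdet open_vimage[OF N(1) c\<phi>])
  have zU0: "0 \<in> U0" using det0 N(2) by (auto simp: U0_def zero_less_mult_iff)
  define f' where "f' x = Blinfun (\<lambda>v. ?J x *v v)" for x
  have bl: "bounded_linear (\<lambda>v. A *v v)" for A :: "real^'a^'a"
    using matrix_vector_mul_bounded_linear by blast
  have f': "blinfun_apply (f' x) = (\<lambda>v. ?J x *v v)" for x
    unfolding f'_def by (rule bounded_linear_Blinfun_apply[OF bl])
  have der: "(\<phi> has_derivative blinfun_apply (f' x)) (at x)" for x
    unfolding f' by (rule has_derivative_jacobian[OF d])
  have contf': "continuous_on U0 f'"
  proof (rule continuous_on_blinfun_componentwise)
    fix v :: "real^'a"
    have "continuous_on UNIV (\<lambda>x. ?J x *v v)"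
      unfolding matrix_vector_mult_def by (intro continuous_intros cJ)
    then show "continuous_on U0 (\<lambda>x. blinfun_apply (f' x) v)"
      unfolding f' using continuous_on_subset by blast
  qed
  define invf where "invf = Blinfun (\<lambda>v. matrix_inv (?J 0) *v v)"
  have "invf o\<^sub>L f' 0 = id_blinfun"
    by (rule blinfun_eqI)
      (simp add: invf_def bounded_linear_Blinfun_apply[OF bl] f' matrix_vector_mul_assoc
        matrix_inv_mult invertible_det_nz det0)
  from inverse_function_theorem[OF U0 der contf' zU0 this]
  obtain U V g g' where UV: "open U" "U \<subseteq> U0" "0 \<in> U" "open V" "homeomorphism U V \<phi> g"
    and g': "\<And>y. y \<in> V \<Longrightarrow> (g has_derivative (g' y)) (at y)"
      "\<And>y. y \<in> V \<Longrightarrow> g' y = inv (blinfun_apply (f' (g y)))"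
    by metis
  have gU: "g y \<in> U" "\<phi> (g y) = y" if "y \<in> V" for y
    using UV(5) that by (auto simp: homeomorphism_def)
  have det: "det (?J (g y)) \<noteq> 0" if "y \<in> V" for y
    using gU(1)[OF that] UV(2) by (auto simp: U0_def)
  have g'm: "g' y v = matrix_inv (?J (g y)) *v v" if y: "y \<in> V" for y v
  proof -
    have i: "invertible (?J (g y))" using det[OF y] by (simp add: invertible_det_nz)
    have "inv (\<lambda>v. ?J (g y) *v v) = (\<lambda>v. matrix_inv (?J (g y)) *v v)"
      by (rule inv_equality) (simp_all add: matrix_vector_mul_assoc matrix_inv_mult[OF i])
    then show ?thesis unfolding g'(2)[OF y] f' by simp
  qed
  have hd: "((\<lambda>y. g y $ i) has_derivative (\<lambda>h. g' y h $ i)) (at y)" if "y \<in> V" for y i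
    using bounded_linear.has_derivative[OF bounded_linear_vec_nth g'(1)[OF that]] .
  have sg: "Ck k V (\<lambda>y. g y $ i)" for k i
  proof (rule Ck_of_inverse_jacobian[OF \<phi> UV(4) _ _ det])
    show "(\<lambda>y. g y $ i) differentiable at y" if "y \<in> V" for y i
      using hd[OF that] unfolding differentiable_def by blast
    show "pd j (\<lambda>y. g y $ i) y = matrix_inv (?J (g y)) $ i $ j" if "y \<in> V" for y i j
      unfolding pd_eqI[OF hd[OF that]] g'm[OF that] by (simp add: matrix_vector_mult_basis column_def)
  qed
  have bij: "bij_betw \<phi> U V"
    using UV(5) by (rule_tac bij_betw_byWitness[where f' = g]) (auto simp: homeomorphism_def)
  have "smooth_on V (\<lambda>y. inv_into U \<phi> y $ i)" for i
  proof (rule smooth_on_cong[OF UV(4)])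
    show "smooth_on V (\<lambda>y. g y $ i)" using sg by (simp add: smooth_on_iff_Ck)
    show "g y $ i = inv_into U \<phi> y $ i" if "y \<in> V" for y
      using inv_into_f_eq[OF bij_betw_imp_inj_on[OF bij] gU[OF that]] by simp
  qed
  then have "diffeo U V \<phi>"
    using UV bij smooth_on_subset[OF smooth_mapD[OF \<phi>]] by (auto simp: diffeo_def smooth_map_on_def)
  moreover have "V \<subseteq> N"
  proof
    fix y assume "y \<in> V"
    then show "y \<in> N" using gU[of y] UV(2) by (auto simp: U0_def)
  qed
  moreover have "orientation_preserving U \<phi> \<or> orientation_reversing U \<phi>"
  proof (cases "det (?J 0) > 0")
    case True
    then show ?thesis using UV(2) by (auto simp: U0_def orientation_preserving_def zero_less_mult_iff)
  next
    case False
    then show ?thesis using UV(2) by (auto simp: U0_def orientation_reversing_def zero_less_mult_iff)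
  qed
  ultimately show ?thesis using that UV(3) by blast
qed

subsection \<open>Coordinates in which the metric is constant to first order\<close>

lemma pullback_smooth:
  fixes \<phi> :: "real^'a::finite \<Rightarrow> real^'b::finite"
  assumes U: "open U" and V: "open V" and \<phi>: "smooth_map_on U \<phi>" "\<And>y. y \<in> U \<Longrightarrow> \<phi> y \<in> V"
    and g: "smooth_tensor_on V g"
  shows "smooth_tensor_on U (pullback \<phi> g)"
  unfolding smooth_tensor_on_def
proof (intro allI, rule smooth_on_cong[OF U])
  fix i j
  show "smooth_on U (\<lambda>y. \<Sum>a\<in>UNIV. \<Sum>b\<in>UNIV. pd i (\<lambda>y. \<phi> y $ a) y * g (\<phi> y) $ a $ b * pd j (\<lambda>y. \<phi> y $ b) y)"
  proof (intro smooth_on_sum smooth_on_mult U smooth_on_pd[OF smooth_mapD[OF \<phi>(1)]])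
    show "smooth_on U (\<lambda>y. g (\<phi> y) $ a $ b)" for a b
    proof (rule smooth_on_comp[OF U V \<phi>(2) _ smooth_mapD[OF \<phi>(1)]])
      show "smooth_on V (\<lambda>y. g y $ a $ b)" using g by (simp add: smooth_tensor_on_def)
    qed
  qed
  show "(\<Sum>a\<in>UNIV. \<Sum>b\<in>UNIV. pd i (\<lambda>y. \<phi> y $ a) y * g (\<phi> y) $ a $ b * pd j (\<lambda>y. \<phi> y $ b) y) =
      pullback \<phi> g y $ i $ j" if "y \<in> U" for y
    unfolding pullback_component
      jacobian_component[OF smooth_on_differentiable[OF smooth_mapD[OF \<phi>(1)] U that]] ..
qed

text \<open>A quadratic map suffices: Q diagonalizes the metric at x, and the second-order
  coefficients are chosen to cancel the first derivatives of the pulled-back metric.\<close>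

lemma normalizing_map:
  fixes g :: "real^'a::finite \<Rightarrow> real^'a^'a"
  assumes g: "metric_on p q N g" and x: "x \<in> N"
  obtains \<phi> \<eta> where "smooth_map_on UNIV \<phi>" "\<phi> 0 = x" "det (jacobian \<phi> (at 0)) \<noteq> 0"
    "\<And>i. \<bar>\<eta> i\<bar> = 1" "card {i. \<eta> i = 1} = p" "card {i. \<eta> i = -1} = q"
    "\<And>i j. pullback \<phi> g 0 $ i $ j = (if i = j then \<eta> i else 0)"
    "\<And>i j k. pd k (\<lambda>y. pullback \<phi> g y $ i $ j) 0 = 0"
proof -
  interpret smooth_metric N g by (rule metric_on_smooth_metric[OF g])
  have sym: "g x $ a $ b = g x $ b $ a" for a b by (rule sym_G[OF x])
  obtain Q :: "real^'a^'a" and \<eta> where Q: "invertible Q"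
    "transpose Q ** g x ** Q = (\<chi> i j. if i = j then \<eta> i else 0)" "\<forall>i. \<eta> i = 1 \<or> \<eta> i = -1"
    "card {i. \<eta> i = 1} = p" "card {i. \<eta> i = -1} = q"
    using g x unfolding metric_on_def has_signature_def by blast
  have ab: "\<bar>\<eta> i\<bar> = 1" for i using Q(3) by (metis abs_1 abs_minus_cancel)
  have ee: "\<eta> i * \<eta> i = 1" for i using Q(3)[rule_format, of i] by auto
  have Qg: "(\<Sum>a\<in>UNIV. \<Sum>b\<in>UNIV. Q $ a $ i * g x $ a $ b * Q $ b $ j) = (if i = j then \<eta> i else 0)" for i j
    using Q(2) unfolding congruence_component[symmetric] by simp
  \<comment> \<open>First derivatives of the metric at x in the frame Q; k is the direction of
    differentiation.\<close>
  define D where "D k i j = (\<Sum>a\<in>UNIV. \<Sum>b\<in>UNIV. Q $ a $ i * (\<Sum>c\<in>UNIV. pd c (\<lambda>y. g y $ a $ b) x * Q $ c $ k) * Q $ b $ j)" for k i j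
  have Dsym: "D k i j = D k j i" for k i j
  proof -
    have "D k i j = (\<Sum>b\<in>UNIV. \<Sum>a\<in>UNIV. Q $ a $ i * (\<Sum>c\<in>UNIV. pd c (\<lambda>y. g y $ a $ b) x * Q $ c $ k) * Q $ b $ j)"
      unfolding D_def by (rule sum.swap)
    also have "\<dots> = D k j i"
      unfolding D_def by (intro sum.cong refl) (simp add: pd_G_sym[OF x] mult_ac)
    finally show ?thesis .
  qed
  \<comment> \<open>The formula for Christoffel symbols of the first kind, with opposite sign: the
    solution of \<open>CD\<close> that is symmetric in k and i.\<close>
  define C where "C k i j = - (D k i j / 2 + D i k j / 2 - D j k i / 2)" for k i j
  have Csym: "C k i j = C i k j" for k i j unfolding C_def using Dsym[of j k i] by simp
  have CD: "C k i j + C k j i = - D k i j" for k i j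
    unfolding C_def using Dsym[of k i j] Dsym[of i k j] Dsym[of j k i] by simp
  \<comment> \<open>The last index is raised with \<eta> and brought back to the original frame by
    Q, so that pairing with Q through the metric returns C, see \<open>wg\<close>.\<close>
  define w where "w a k i = (\<Sum>j\<in>UNIV. C k i j * \<eta> j * Q $ a $ j)" for a k i
  have wsym: "w a k i = w a i k" for a k i unfolding w_def using Csym[of k i] by simp
  \<comment> \<open>Halved because differentiating the quadratic term produces each coefficient
    twice.\<close>
  define hw where "hw a k i = w a k i / 2" for a k i
  have hws: "hw a k i = hw a i k" for a k i using wsym by (simp add: hw_def)
  define \<phi> :: "real^'a \<Rightarrow> real^'a" where
    "\<phi> y = (\<chi> a. x $ a + (\<Sum>i\<in>UNIV. Q $ a $ i * y $ i) + (\<Sum>k\<in>UNIV. \<Sum>i\<in>UNIV. hw a k i * (y $ k * y $ i)))" for y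
  have sm: "smooth_map_on UNIV \<phi>"
    unfolding smooth_map_on_def \<phi>_def vec_lambda_beta
    by (intro allI smooth_on_add smooth_on_sum smooth_on_cmult smooth_on_mult smooth_on_component smooth_on_const open_UNIV)
  have dc: "(\<lambda>y. y $ k * y $ i) differentiable at z" for k i and z :: "real^'a"
    by (intro differentiable_mult differentiable_component)
  have pd\<phi>: "pd c (\<lambda>y. \<phi> y $ a) z = Q $ a $ c + (\<Sum>k\<in>UNIV. w a c k * z $ k)" for c a z
  proof -
    have "pd c (\<lambda>y. \<phi> y $ a) z = (\<Sum>i\<in>UNIV. Q $ a $ i * (if i = c then 1 else 0)) +
      (\<Sum>k\<in>UNIV. \<Sum>i\<in>UNIV. hw a k i * (z $ k * (if i = c then 1 else 0) + (if k = c then 1 else 0) * z $ i))"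
      unfolding \<phi>_def vec_lambda_beta
      by (simp add: pd_add pd_sum pd_cmult pd_mult pd_component dc differentiable_sum differentiable_add differentiable_mult)
    also have "(\<Sum>i\<in>UNIV. Q $ a $ i * (if i = c then 1 else 0)) = Q $ a $ c" by (simp add: if_distrib cong: if_cong)
    also have "(\<Sum>k\<in>UNIV. \<Sum>i\<in>UNIV. hw a k i * (z $ k * (if i = c then 1 else 0) + (if k = c then 1 else 0) * z $ i)) =
      (\<Sum>k\<in>UNIV. hw a k c * z $ k) + (\<Sum>k\<in>UNIV. if k = c then (\<Sum>i\<in>UNIV. hw a c i * z $ i) else 0)"
    proof -
      have "(\<Sum>i\<in>UNIV. hw a k i * (z $ k * (if i = c then 1 else 0) + (if k = c then 1 else 0) * z $ i)) =
         hw a k c * z $ k + (if k = c then (\<Sum>i\<in>UNIV. hw a c i * z $ i) else 0)" for k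
        by (simp add: distrib_left sum.distrib if_distrib[where f = "\<lambda>x. _ * x"] cong: if_cong)
      then show ?thesis by (simp only: sum.distrib)
    qed
    also have "\<dots> = (\<Sum>k\<in>UNIV. hw a c k * z $ k + hw a c k * z $ k)"
      unfolding sum.distrib hws[of a _ c] by simp
    also have "\<dots> = (\<Sum>k\<in>UNIV. w a c k * z $ k)" by (intro sum.cong refl) (simp add: hw_def)
    finally show ?thesis .
  qed
  have \<phi>0: "\<phi> 0 = x" by (simp add: \<phi>_def vec_eq_iff)
  have d\<phi>: "(\<lambda>y. \<phi> y $ i) differentiable at z" for i z
    by (rule smooth_on_differentiable[OF smooth_mapD[OF sm] open_UNIV UNIV_I])
  have jac: "jacobian \<phi> (at z) $ a $ c = Q $ a $ c + (\<Sum>k\<in>UNIV. w a c k * z $ k)" for z a c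
    unfolding jacobian_component[OF d\<phi>] pd\<phi> ..
  have J0: "jacobian \<phi> (at 0) = Q" by (simp add: vec_eq_iff jac)
  have h0: "pullback \<phi> g 0 $ i $ j = (if i = j then \<eta> i else 0)" for i j
    unfolding pullback_component J0 \<phi>0 by (rule Qg)
  have dg: "(\<lambda>y. g (\<phi> y) $ a $ b) differentiable at 0" for a b
    by (rule differentiable_comp[OF d\<phi>]) (simp add: \<phi>0 diff_G[OF x])
  have pdg: "pd k (\<lambda>y. g (\<phi> y) $ a $ b) 0 = (\<Sum>c\<in>UNIV. pd c (\<lambda>y. g y $ a $ b) x * Q $ c $ k)" for k a b
    by (subst pd_comp[OF d\<phi>]) (simp_all add: \<phi>0 diff_G[OF x] pd\<phi>)
  have djac: "(\<lambda>y. jacobian \<phi> (at y) $ a $ i) differentiable at 0" for a i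
    unfolding jac by (simp add: differentiable_sum differentiable_mult)
  have pdjac: "pd k (\<lambda>y. jacobian \<phi> (at y) $ a $ i) 0 = w a k i" for k a i
  proof -
    have "pd k (\<lambda>y. jacobian \<phi> (at y) $ a $ i) 0 = (\<Sum>l\<in>UNIV. w a i l * (if l = k then 1 else 0))"
      unfolding jac by (simp add: pd_add pd_sum pd_cmult pd_component differentiable_sum differentiable_mult)
    then show ?thesis by (simp add: if_distrib wsym[of a i] cong: if_cong)
  qed
  have wg: "(\<Sum>a\<in>UNIV. \<Sum>b\<in>UNIV. w a k i * g x $ a $ b * Q $ b $ j) = C k i j" for k i j
  proof -
    have "(\<Sum>a\<in>UNIV. \<Sum>b\<in>UNIV. w a k i * g x $ a $ b * Q $ b $ j) =
       (\<Sum>a\<in>UNIV. \<Sum>b\<in>UNIV. \<Sum>l\<in>UNIV. (C k i l * \<eta> l) * (Q $ a $ l * g x $ a $ b * Q $ b $ j))"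
      unfolding w_def sum_distrib_right by (simp add: mult_ac)
    also have "\<dots> = (\<Sum>a\<in>UNIV. \<Sum>l\<in>UNIV. \<Sum>b\<in>UNIV. (C k i l * \<eta> l) * (Q $ a $ l * g x $ a $ b * Q $ b $ j))"
      by (intro sum.cong refl sum.swap)
    also have "\<dots> = (\<Sum>l\<in>UNIV. \<Sum>a\<in>UNIV. \<Sum>b\<in>UNIV. (C k i l * \<eta> l) * (Q $ a $ l * g x $ a $ b * Q $ b $ j))"
      by (rule sum.swap)
    also have "\<dots> = (\<Sum>l\<in>UNIV. (C k i l * \<eta> l) * (if l = j then \<eta> l else 0))"
      unfolding sum_distrib_left[symmetric] Qg ..
    also have "\<dots> = C k i j * (\<eta> j * \<eta> j)" by (simp add: if_distrib mult_ac cong: if_cong)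
    finally show ?thesis by (simp add: ee)
  qed
  have wg': "(\<Sum>a\<in>UNIV. \<Sum>b\<in>UNIV. Q $ a $ i * g x $ a $ b * w b k j) = C k j i" for k i j
  proof -
    have "(\<Sum>a\<in>UNIV. \<Sum>b\<in>UNIV. Q $ a $ i * g x $ a $ b * w b k j) =
      (\<Sum>b\<in>UNIV. \<Sum>a\<in>UNIV. Q $ a $ i * g x $ a $ b * w b k j)" by (rule sum.swap)
    also have "\<dots> = (\<Sum>b\<in>UNIV. \<Sum>a\<in>UNIV. w b k j * g x $ b $ a * Q $ a $ i)"
      by (intro sum.cong refl) (simp add: sym mult_ac)
    finally show ?thesis by (simp add: wg)
  qed
  have h1: "pd k (\<lambda>y. pullback \<phi> g y $ i $ j) 0 = 0" for i j k
  proof -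
    have "pd k (\<lambda>y. jacobian \<phi> (at y) $ a $ i * g (\<phi> y) $ a $ b * jacobian \<phi> (at y) $ b $ j) 0 =
      w a k i * g x $ a $ b * Q $ b $ j +
      Q $ a $ i * (\<Sum>c\<in>UNIV. pd c (\<lambda>y. g y $ a $ b) x * Q $ c $ k) * Q $ b $ j +
      Q $ a $ i * g x $ a $ b * w b k j" for a b
      by (simp add: pd_mult differentiable_mult djac dg pdjac pdg J0 \<phi>0 algebra_simps)
    then have "pd k (\<lambda>y. pullback \<phi> g y $ i $ j) 0 = (\<Sum>a\<in>UNIV. \<Sum>b\<in>UNIV. w a k i * g x $ a $ b * Q $ b $ j) +
       D k i j + (\<Sum>a\<in>UNIV. \<Sum>b\<in>UNIV. Q $ a $ i * g x $ a $ b * w b k j)"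
      unfolding pullback_component D_def
      by (simp add: pd_sum differentiable_sum differentiable_mult djac dg sum.distrib)
    then show ?thesis unfolding wg wg' using CD[of k i j] by simp
  qed
  show ?thesis
    using that[OF sm \<phi>0 _ ab Q(4,5) h0 h1] Q(1) by (simp add: J0 invertible_det_nz)
qed

subsection \<open>Jets as combinations of powers of linear forms\<close>

text \<open>A combination of evaluations at the points 2^j that detects the power e0 and is blind to
  the powers in A. Subtracting 2^i times such a combination from its shift by one multiplies the
  value at e by 2^e - 2^i, which kills e = i; dividing by \<open>D\<close> restores the value 1 at
  e0.\<close>

lemma interpolation_weights:
  assumes "finite A" "e0 \<notin> A"
  shows "\<exists>J w. (\<forall>e\<in>A. (\<Sum>j\<le>J. w j * (2 ^ j) ^ e) = (0::real)) \<and> (\<Sum>j\<le>J. w j * (2 ^ j) ^ e0) = 1"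
  using assms
proof (induction A rule: finite_induct)
  case empty
  show ?case by (intro exI[of _ 0] exI[of _ "\<lambda>_. 1"]) simp
next
  case (insert i A)
  then obtain J w where w: "\<And>e. e \<in> A \<Longrightarrow> (\<Sum>j\<le>J. w j * (2 ^ j) ^ e) = (0::real)"
    "(\<Sum>j\<le>J. w j * (2 ^ j) ^ e0) = (1::real)" by auto
  define D :: real where "D = 2 ^ e0 - 2 ^ i"
  have D: "D \<noteq> 0" using insert.prems by (simp add: D_def)
  define w' where "w' j = ((if j = 0 then 0 else w (j - 1)) - 2 ^ i * (if j \<le> J then w j else 0)) / D" for j
  have S: "(\<Sum>j\<le>Suc J. w' j * (2 ^ j) ^ e) = (2 ^ e - 2 ^ i) * (\<Sum>j\<le>J. w j * (2 ^ j) ^ e) / D" for e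
  proof -
    have "(\<Sum>j\<le>Suc J. (if j = 0 then 0 else w (j - 1)) * (2 ^ j) ^ e) = (\<Sum>j\<le>J. w j * (2 ^ Suc j) ^ e)"
      by (subst sum.atMost_Suc_shift) simp
    also have "\<dots> = 2 ^ e * (\<Sum>j\<le>J. w j * (2 ^ j) ^ e)"
      unfolding sum_distrib_left by (intro sum.cong refl) (simp add: power_mult_distrib)
    finally have 1: "(\<Sum>j\<le>Suc J. (if j = 0 then 0 else w (j - 1)) * (2 ^ j) ^ e) = 2 ^ e * (\<Sum>j\<le>J. w j * (2 ^ j) ^ e)" .
    have 2: "(\<Sum>j\<le>Suc J. 2 ^ i * (if j \<le> J then w j else 0) * (2 ^ j) ^ e) = 2 ^ i * (\<Sum>j\<le>J. w j * (2 ^ j) ^ e)"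
      by (simp add: sum_distrib_left mult.assoc)
    have "(\<Sum>j\<le>Suc J. w' j * (2 ^ j) ^ e) = (\<Sum>j\<le>Suc J. (if j = 0 then 0 else w (j - 1)) * (2 ^ j) ^ e
        - 2 ^ i * (if j \<le> J then w j else 0) * (2 ^ j) ^ e) / D"
      unfolding sum_divide_distrib by (intro sum.cong refl) (simp add: w'_def left_diff_distrib)
    also have "\<dots> = (2 ^ e * (\<Sum>j\<le>J. w j * (2 ^ j) ^ e) - 2 ^ i * (\<Sum>j\<le>J. w j * (2 ^ j) ^ e)) / D"
      unfolding sum_subtractf 1 2 ..
    finally show ?thesis by (simp only: left_diff_distrib)
  qed
  have "(\<Sum>j\<le>Suc J. w' j * (2 ^ j) ^ e) = 0" if "e \<in> insert i A" for e
    unfolding S using that w(1) by auto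
  moreover have "(\<Sum>j\<le>Suc J. w' j * (2 ^ j) ^ e0) = 1" unfolding S w(2) using D by (simp add: D_def)
  ultimately show ?case by blast
qed

lemma prod_list_count:
  fixes f :: "'a::finite \<Rightarrow> real"
  shows "prod_list (map f ls) = (\<Prod>s\<in>UNIV. f s ^ count (mset ls) s)"
proof (induction ls)
  case (Cons x ls)
  have "(\<Prod>s\<in>UNIV. f s ^ count (mset (x # ls)) s) = (\<Prod>s\<in>UNIV. (if s = x then f x else 1) * f s ^ count (mset ls) s)"
    by (intro prod.cong refl) simp
  then show ?case using Cons by (simp add: prod.distrib)
qed simp

text \<open>Up to order N the array J is that of a finite combination of tensors a \<otimes> a times
  powers of linear forms. Orders below two are left out because the normalization of the metric
  fixes them.\<close>

definition jets_from_powers :: "nat \<Rightarrow> ('a::finite list \<Rightarrow> 'a \<Rightarrow> 'a \<Rightarrow> real) \<Rightarrow> bool" where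
  "jets_from_powers N J \<longleftrightarrow> (\<exists>(M::nat) k a b t. (\<forall>m<M. 2 \<le> k m) \<and>
     (\<forall>ls i j. 2 \<le> length ls \<longrightarrow> length ls \<le> N \<longrightarrow>
        J ls i j = (\<Sum>m<M. t m * (a m $ i * a m $ j) * pow_jet (k m) (b m) ls)))"

lemma jets_from_powersI:
  fixes J :: "'a::finite list \<Rightarrow> 'a \<Rightarrow> 'a \<Rightarrow> real" and M :: nat and a b :: "nat \<Rightarrow> real^'a"
  assumes "\<And>m. m < M \<Longrightarrow> 2 \<le> k m"
    and "\<And>ls i j. 2 \<le> length ls \<Longrightarrow> length ls \<le> N \<Longrightarrow>
      J ls i j = (\<Sum>m<M. t m * (a m $ i * a m $ j) * pow_jet (k m) (b m) ls)"
  shows "jets_from_powers N J"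
  unfolding jets_from_powers_def
  by (rule exI[of _ M], rule exI[of _ k], rule exI[of _ a], rule exI[of _ b], rule exI[of _ t])
    (intro conjI allI impI assms)

lemma jets_from_powersE:
  fixes J :: "'a::finite list \<Rightarrow> 'a \<Rightarrow> 'a \<Rightarrow> real"
  assumes "jets_from_powers N J"
  obtains M :: nat and k t and a b :: "nat \<Rightarrow> real^'a" where "\<And>m. m < M \<Longrightarrow> 2 \<le> k m"
    "\<And>ls i j. 2 \<le> length ls \<Longrightarrow> length ls \<le> N \<Longrightarrow>
      J ls i j = (\<Sum>m<M. t m * (a m $ i * a m $ j) * pow_jet (k m) (b m) ls)"
proof -
  from assms obtain M :: nat and k t and a b :: "nat \<Rightarrow> real^'a" where "\<forall>m<M. 2 \<le> k m"
    "\<forall>ls i j. 2 \<le> length ls \<longrightarrow> length ls \<le> N \<longrightarrow>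
      J ls i j = (\<Sum>m<M. t m * (a m $ i * a m $ j) * pow_jet (k m) (b m) ls)"
    unfolding jets_from_powers_def by (elim exE conjE)
  then show ?thesis by (rule_tac that; simp)
qed

lemma jets_from_powers_cong:
  assumes "jets_from_powers N J" "\<And>ls i j. 2 \<le> length ls \<Longrightarrow> length ls \<le> N \<Longrightarrow> J ls i j = J' ls i j"
  shows "jets_from_powers N J'"
  by (rule jets_from_powersE[OF assms(1)]) (rule jets_from_powersI, assumption, simp flip: assms(2))

lemma jets_from_powers_single:
  assumes "2 \<le> k"
  shows "jets_from_powers N (\<lambda>ls i j. c * (v $ i * v $ j) * pow_jet k b ls)"
  by (rule jets_from_powersI[where M = 1 and k = "\<lambda>_. k" and a = "\<lambda>_. v" and b = "\<lambda>_. b" and t = "\<lambda>_. c"])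
    (use assms in simp_all)

lemma jets_from_powers_zero: "jets_from_powers N (\<lambda>ls i j. 0)"
  by (rule jets_from_powersI[where M = 0]) simp_all

lemma jets_from_powers_add:
  fixes J J' :: "'a::finite list \<Rightarrow> 'a \<Rightarrow> 'a \<Rightarrow> real"
  assumes "jets_from_powers N J" "jets_from_powers N J'"
  shows "jets_from_powers N (\<lambda>ls i j. J ls i j + J' ls i j)"
proof -
  obtain M :: nat and k t and a b :: "nat \<Rightarrow> real^'a" where 1: "\<And>m. m < M \<Longrightarrow> 2 \<le> k m"
    "\<And>ls i j. 2 \<le> length ls \<Longrightarrow> length ls \<le> N \<Longrightarrow>
      J ls i j = (\<Sum>m<M. t m * (a m $ i * a m $ j) * pow_jet (k m) (b m) ls)"
    by (rule jets_from_powersE[OF assms(1)]) blast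
  obtain M' :: nat and k' t' and a' b' :: "nat \<Rightarrow> real^'a" where 2: "\<And>m. m < M' \<Longrightarrow> 2 \<le> k' m"
    "\<And>ls i j. 2 \<le> length ls \<Longrightarrow> length ls \<le> N \<Longrightarrow>
      J' ls i j = (\<Sum>m<M'. t' m * (a' m $ i * a' m $ j) * pow_jet (k' m) (b' m) ls)"
    by (rule jets_from_powersE[OF assms(2)]) blast
  let ?c = "\<lambda>f f' m. if m < M then f m else f' (m - M)"
  show ?thesis
  proof (rule jets_from_powersI[where M = "M + M'" and k = "?c k k'" and a = "?c a a'" and b = "?c b b'" and t = "?c t t'"])
    show "2 \<le> ?c k k' m" if "m < M + M'" for m using 1(1)[of m] 2(1)[of "m - M"] that by auto
    show "J ls i j + J' ls i j = (\<Sum>m<M + M'. ?c t t' m * (?c a a' m $ i * ?c a a' m $ j) * pow_jet (?c k k' m) (?c b b' m) ls)"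
      if "2 \<le> length ls" "length ls \<le> N" for ls i j
    proof -
      have s: "(\<Sum>m<M + M'. F m) = (\<Sum>m<M. F m) + (\<Sum>m<M'. F (M + m))" for F :: "nat \<Rightarrow> real"
        by (induction M') simp_all
      show ?thesis unfolding s using 1(2)[OF that] 2(2)[OF that] by simp
    qed
  qed
qed

lemma jets_from_powers_cmult:
  fixes J :: "'a::finite list \<Rightarrow> 'a \<Rightarrow> 'a \<Rightarrow> real"
  assumes "jets_from_powers N J"
  shows "jets_from_powers N (\<lambda>ls i j. c * J ls i j)"
proof (rule jets_from_powersE[OF assms])
  fix M :: nat and k t and a b :: "nat \<Rightarrow> real^'a"
  assume 1: "\<And>m. m < M \<Longrightarrow> 2 \<le> k m" "\<And>ls i j. 2 \<le> length ls \<Longrightarrow> length ls \<le> N \<Longrightarrow>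
      J ls i j = (\<Sum>m<M. t m * (a m $ i * a m $ j) * pow_jet (k m) (b m) ls)"
  show ?thesis
  proof (rule jets_from_powersI[where M = M and k = k and a = a and b = b and t = "\<lambda>m. c * t m"])
    show "c * J ls i j = (\<Sum>m<M. (c * t m) * (a m $ i * a m $ j) * pow_jet (k m) (b m) ls)"
      if "2 \<le> length ls" "length ls \<le> N" for ls i j
      using 1(2)[OF that] by (simp add: sum_distrib_left mult.assoc)
  qed (rule 1(1))
qed

lemma jets_from_powers_sum:
  assumes "\<And>x. x \<in> A \<Longrightarrow> jets_from_powers N (J x)"
  shows "jets_from_powers N (\<lambda>ls i j. \<Sum>x\<in>A. J x ls i j)"
  using assms
proof (induction A rule: infinite_finite_induct)
  case (insert x A)
  then have "jets_from_powers N (\<lambda>ls i j. J x ls i j + (\<Sum>x\<in>A. J x ls i j))"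
    by (intro jets_from_powers_add) auto
  then show ?case using insert by simp
qed (simp_all add: jets_from_powers_zero)

text \<open>Powers of linear forms span the homogeneous polynomials. Interpolation in each
  coordinate separately, at the vectors with entries 2^(f s), isolates the monomial whose exponents
  are given by \<mu>.\<close>

lemma jets_from_powers_delta:
  fixes v :: "real^'a::finite" and \<mu> :: "'a multiset"
  assumes "2 \<le> size \<mu>"
  shows "jets_from_powers N (\<lambda>ls i j. (v $ i * v $ j) * (if mset ls = \<mu> then 1 else 0))"
proof -
  define k where "k = size \<mu>"
  define interp where "interp s J w \<longleftrightarrow> (\<forall>e\<in>{..k} - {count \<mu> s}. (\<Sum>j\<le>J. w j * (2 ^ j) ^ e) = (0::real)) \<and>
      (\<Sum>j\<le>J. w j * (2 ^ j) ^ count \<mu> s) = 1" for s J w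
  have "\<exists>J w. interp s J w" for s
    unfolding interp_def by (rule interpolation_weights) auto
  then obtain J w where "\<And>s. interp s (J s) (w s)" by metis
  then have w: "\<And>s e. e \<in> {..k} - {count \<mu> s} \<Longrightarrow> (\<Sum>j\<le>J s. w s j * (2 ^ j) ^ e) = (0::real)"
    "\<And>s. (\<Sum>j\<le>J s. w s j * (2 ^ j) ^ count \<mu> s) = (1::real)"
    unfolding interp_def by blast+
  define B where "B f = (\<chi> s. (2::real) ^ (f s :: nat))" for f :: "'a \<Rightarrow> nat"
  define P where "P = PiE UNIV (\<lambda>s. {..J s})"
  have eq: "(\<Sum>f\<in>P. (\<Prod>s\<in>UNIV. w s (f s)) / fact k * (v $ i * v $ j) * pow_jet k (B f) ls) =
      (v $ i * v $ j) * (if mset ls = \<mu> then 1 else 0)" for ls i j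
  proof (cases "length ls = k")
    case True
    have "(\<Sum>f\<in>P. (\<Prod>s\<in>UNIV. w s (f s)) * prod_list (map (($) (B f)) ls)) =
        (\<Sum>f\<in>P. \<Prod>s\<in>UNIV. w s (f s) * (2 ^ f s) ^ count (mset ls) s)"
      by (simp add: prod_list_count B_def prod.distrib)
    \<comment> \<open>The sum over all choices f of one node per coordinate factors.\<close>
    also have "\<dots> = (\<Prod>s\<in>UNIV. \<Sum>j\<le>J s. w s j * (2 ^ j) ^ count (mset ls) s)"
      unfolding P_def by (rule prod_sum_PiE[symmetric]) auto
    also have "\<dots> = (\<Prod>s\<in>UNIV. if count (mset ls) s = count \<mu> s then 1 else 0)"
    proof (intro prod.cong refl)
      fix s
      have "count (mset ls) s \<le> k" using True count_le_size by (metis size_mset)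
      then show "(\<Sum>j\<le>J s. w s j * (2 ^ j) ^ count (mset ls) s) = (if count (mset ls) s = count \<mu> s then 1 else 0)"
        using w(1)[of "count (mset ls) s" s] w(2)[of s] by auto
    qed
    also have "\<dots> = (if mset ls = \<mu> then 1 else 0)"
    proof (cases "mset ls = \<mu>")
      case False
      then obtain s where "count (mset ls) s \<noteq> count \<mu> s" by (auto simp: multiset_eq_iff)
      then show ?thesis using False by (auto intro!: prod_zero)
    qed simp
    finally have *: "(\<Sum>f\<in>P. (\<Prod>s\<in>UNIV. w s (f s)) * prod_list (map (($) (B f)) ls)) = (if mset ls = \<mu> then 1 else 0)" .
    have "(\<Sum>f\<in>P. (\<Prod>s\<in>UNIV. w s (f s)) / fact k * (v $ i * v $ j) * pow_jet k (B f) ls) =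
       (v $ i * v $ j) * (\<Sum>f\<in>P. (\<Prod>s\<in>UNIV. w s (f s)) * prod_list (map (($) (B f)) ls))"
      unfolding sum_distrib_left by (intro sum.cong refl) (simp add: pow_jet_def True)
    then show ?thesis unfolding * .
  next
    case False
    then have "mset ls \<noteq> \<mu>" using size_mset k_def by metis
    then show ?thesis using False by (simp add: pow_jet_def)
  qed
  have "jets_from_powers N (\<lambda>ls i j. \<Sum>f\<in>P. (\<Prod>s\<in>UNIV. w s (f s)) / fact k * (v $ i * v $ j) * pow_jet k (B f) ls)"
    by (intro jets_from_powers_sum jets_from_powers_single) (use assms in \<open>simp add: k_def\<close>)
  then show ?thesis unfolding eq .
qed

text \<open>Polarization: the symmetric product of two unit vectors is a combination of three
  squares.\<close>

lemma symmetric_matrix_squares: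
  fixes H :: "'a::finite \<Rightarrow> 'a \<Rightarrow> real"
  assumes "\<And>i j. H i j = H j i"
  shows "(\<Sum>p\<in>UNIV. \<Sum>q\<in>UNIV. H p q / 2 * (((axis p 1 + axis q 1) $ i * (axis p 1 + axis q 1) $ j)
     - axis p 1 $ i * axis p 1 $ j - axis q 1 $ i * axis q 1 $ j)) = H i j"
proof -
  have "(\<Sum>p\<in>UNIV. \<Sum>q\<in>UNIV. H p q / 2 * (((axis p 1 + axis q 1) $ i * (axis p 1 + axis q 1) $ j)
     - axis p 1 $ i * axis p 1 $ j - axis q 1 $ i * axis q 1 $ j)) =
    (\<Sum>p\<in>UNIV. \<Sum>q\<in>UNIV. (if p = i then (if q = j then H i j / 2 else 0) else 0) + (if p = j then (if q = i then H j i / 2 else 0) else 0))"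
    by (intro sum.cong refl) (auto simp: axis_def algebra_simps)
  also have "\<dots> = H i j / 2 + H j i / 2"
  proof -
    have "(\<Sum>q\<in>UNIV. if p = x then (if q = y then c else 0) else 0) = (if p = x then c else 0)"
      for p x y :: 'a and c :: real by (cases "p = x") simp_all
    then show ?thesis by (simp add: sum.distrib)
  qed
  finally show ?thesis using assms[of i j] by simp
qed

text \<open>An array with these symmetries is determined up to order N by one symmetric matrix for
  each of finitely many multisets of directions. Delta arrays separate the multisets, and
  polarization writes each matrix in squares.\<close>

lemma jets_from_powers_all:
  fixes J :: "'a::finite list \<Rightarrow> 'a \<Rightarrow> 'a \<Rightarrow> real"
  assumes perm: "\<And>ls ls' i j. mset ls = mset ls' \<Longrightarrow> J ls i j = J ls' i j"
    and sym: "\<And>ls i j. J ls i j = J ls j i"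
  shows "jets_from_powers N J"
proof -
  define Ms where "Ms = mset ` {ls :: 'a list. 2 \<le> length ls \<and> length ls \<le> N}"
  have "finite {ls :: 'a list. set ls \<subseteq> UNIV \<and> length ls \<le> N}" by (rule finite_lists_length_le) simp
  then have "finite {ls :: 'a list. 2 \<le> length ls \<and> length ls \<le> N}" by (rule rev_finite_subset) auto
  then have fin: "finite Ms" by (simp add: Ms_def)
  \<comment> \<open>Evaluated at a representative list for each multiset; \<open>perm\<close> makes
    the choice irrelevant.\<close>
  define H where "H \<mu> p q = J (SOME ls. mset ls = \<mu>) p q" for \<mu> p q
  have HJ: "H (mset ls) p q = J ls p q" for ls p q
    unfolding H_def by (intro perm) (rule someI[of "\<lambda>l. mset l = mset ls"], simp)
  let ?\<delta> = "\<lambda>\<mu> ls. if mset ls = \<mu> then 1 else (0::real)"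
  define F where "F ls i j = (\<Sum>\<mu>\<in>Ms. \<Sum>p\<in>UNIV. \<Sum>q\<in>UNIV. H \<mu> p q / 2 *
     (((axis p 1 + axis q 1) $ i * (axis p 1 + axis q 1) $ j) * ?\<delta> \<mu> ls
     + (-1) * (axis p 1 $ i * axis p 1 $ j * ?\<delta> \<mu> ls) + (-1) * (axis q 1 $ i * axis q 1 $ j * ?\<delta> \<mu> ls)))" for ls i j
  have "jets_from_powers N F"
    unfolding F_def
    by (intro jets_from_powers_sum jets_from_powers_cmult jets_from_powers_add jets_from_powers_delta)
      (auto simp: Ms_def)
  then show ?thesis
  proof (rule jets_from_powers_cong)
    fix ls :: "'a list" and i j assume ls: "2 \<le> length ls" "length ls \<le> N"
    have "F ls i j = (\<Sum>\<mu>\<in>Ms. if \<mu> = mset ls then (\<Sum>p\<in>UNIV. \<Sum>q\<in>UNIV. H (mset ls) p q / 2 * (((axis p 1 + axis q 1) $ i * (axis p 1 + axis q 1) $ j)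
     - axis p 1 $ i * axis p 1 $ j - axis q 1 $ i * axis q 1 $ j)) else 0)"
      unfolding F_def
    proof (intro sum.cong refl)
      fix \<mu>
      show "(\<Sum>p\<in>UNIV. \<Sum>q\<in>UNIV. H \<mu> p q / 2 *
     (((axis p 1 + axis q 1) $ i * (axis p 1 + axis q 1) $ j) * ?\<delta> \<mu> ls
     + (-1) * (axis p 1 $ i * axis p 1 $ j * ?\<delta> \<mu> ls) + (-1) * (axis q 1 $ i * axis q 1 $ j * ?\<delta> \<mu> ls))) =
       (if \<mu> = mset ls then (\<Sum>p\<in>UNIV. \<Sum>q\<in>UNIV. H (mset ls) p q / 2 * (((axis p 1 + axis q 1) $ i * (axis p 1 + axis q 1) $ j)
     - axis p 1 $ i * axis p 1 $ j - axis q 1 $ i * axis q 1 $ j)) else 0)"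
        by (cases "\<mu> = mset ls") (simp_all add: algebra_simps)
    qed
    also have "\<dots> = (\<Sum>\<mu>\<in>Ms. if \<mu> = mset ls then J ls i j else 0)"
      by (subst symmetric_matrix_squares) (simp_all only: HJ, rule sym)
    also have "\<dots> = J ls i j" using fin ls by (auto simp: Ms_def)
    finally show "F ls i j = J ls i j" .
  qed
qed

subsection \<open>A polynomial family of metrics\<close>

text \<open>Affine in the parameters t. When all exponents k m are positive the value at the origin
  does not depend on t, so neither does the determinant variable there.\<close>

definition power_metric ::
  "('a::finite \<Rightarrow> real) \<Rightarrow> nat \<Rightarrow> (nat \<Rightarrow> nat) \<Rightarrow> (nat \<Rightarrow> real^'a) \<Rightarrow> (nat \<Rightarrow> real^'a) \<Rightarrow> (nat \<Rightarrow> real) \<Rightarrow> real^'a \<Rightarrow> real^'a^'a" where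
  "power_metric \<eta> M k a b t y =
     (\<chi> i j. (if i = j then \<eta> i else 0) + (\<Sum>m<M. t m * (a m $ i * a m $ j) * (b m \<bullet> y) ^ k m))"

lemma smooth_power_metric: "smooth_tensor_on UNIV (power_metric \<eta> M k a b t)"
  unfolding smooth_tensor_on_def power_metric_def vec_lambda_beta
  by (intro allI smooth_on_add smooth_on_sum smooth_on_cmult smooth_on_power smooth_on_inner smooth_on_const open_UNIV)

lemma power_metric_sym: "power_metric \<eta> M k a b t y $ i $ j = power_metric \<eta> M k a b t y $ j $ i"
  by (simp add: power_metric_def mult.commute mult.left_commute)

lemma pds_power_metric:
  "pds ls (\<lambda>y. power_metric \<eta> M k a b t y $ i $ j) 0 =
    (if ls = [] \<and> i = j then \<eta> i else 0) + (\<Sum>m<M. t m * (a m $ i * a m $ j) * pow_jet (k m) (b m) ls)"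
proof -
  have s: "smooth_on UNIV (\<lambda>y. c * (b m \<bullet> y) ^ k m)" for c m
    by (intro smooth_on_cmult smooth_on_power smooth_on_inner open_UNIV)
  have "pds ls (\<lambda>y. power_metric \<eta> M k a b t y $ i $ j) 0 =
     pds ls (\<lambda>y. if i = j then \<eta> i else 0) 0 + pds ls (\<lambda>y. \<Sum>m<M. t m * (a m $ i * a m $ j) * (b m \<bullet> y) ^ k m) 0"
    unfolding power_metric_def vec_lambda_beta
    by (rule pds_add[OF open_UNIV]) (auto intro!: smooth_on_sum s)
  also have "pds ls (\<lambda>y. \<Sum>m<M. t m * (a m $ i * a m $ j) * (b m \<bullet> y) ^ k m) 0 =
     (\<Sum>m<M. pds ls (\<lambda>y. t m * (a m $ i * a m $ j) * (b m \<bullet> y) ^ k m) 0)"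
    by (rule pds_sum[OF open_UNIV]) (auto intro!: s)
  also have "\<dots> = (\<Sum>m<M. t m * (a m $ i * a m $ j) * pow_jet (k m) (b m) ls)"
    by (intro sum.cong refl) (simp add: pds_cmult[OF open_UNIV] smooth_on_power smooth_on_inner pds_power_inner_0)
  finally show ?thesis by (auto simp: pds_const)
qed

lemma pow_jet_short: "2 \<le> k \<Longrightarrow> length ls < 2 \<Longrightarrow> pow_jet k b ls = 0"
  by (simp add: pow_jet_def)

lemma power_metric_0:
  assumes "\<And>m. m < M \<Longrightarrow> 2 \<le> k m"
  shows "power_metric \<eta> M k a b t 0 $ i $ j = (if i = j then \<eta> i else 0)"
proof -
  have "(0::real) ^ k m = 0" if "m < M" for m using assms[OF that] by simp
  then have "(\<Sum>m<M. t m * (a m $ i * a m $ j) * 0 ^ k m) = 0" by (intro sum.neutral) simp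
  then show ?thesis by (simp only: power_metric_def vec_lambda_beta inner_zero_right add_0_right)
qed

lemma power_metric_near:
  assumes "\<And>m. m < M \<Longrightarrow> 2 \<le> k m"
    and "\<And>i. \<bar>\<eta> i\<bar> = 1" "card {i. \<eta> i = 1} = p" "card {i. \<eta> i = -1} = q"
  obtains V where "0 \<in> V" "metric_on p q V (power_metric \<eta> M k a b t)"
proof (rule metric_near[OF assms(2-4) smooth_power_metric power_metric_sym power_metric_0])
  show "2 \<le> k m" if "m < M" for m by (rule assms(1)[OF that])
qed (rule that)

subsection \<open>Linear coordinate changes\<close>

lemma pd_linear: "pd k (\<lambda>y. (A *v y) $ i) z = A $ i $ k" for A :: "real^'a::finite^'b::finite"
proof -
  have "pd k (\<lambda>y. (A *v y) $ i) z = (\<Sum>j\<in>UNIV. A $ i $ j * (if j = k then 1 else 0))"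
    unfolding matrix_vector_mult_def vec_lambda_beta
    by (subst pd_sum) (auto intro!: sum.cong simp: pd_cmult pd_component differentiable_mult)
  then show ?thesis by (simp add: if_distrib cong: if_cong)
qed

lemma smooth_on_linear: "open S \<Longrightarrow> smooth_on S (\<lambda>y. (A *v y) $ i)" for A :: "real^'a::finite^'b::finite"
  unfolding matrix_vector_mult_def vec_lambda_beta
  by (intro smooth_on_sum smooth_on_cmult smooth_on_component)

lemma jacobian_matrix: "jacobian (\<lambda>y. A *v y) (at z) = A" for A :: "real^'a::finite^'b::finite"
proof -
  have "(\<lambda>y. (A *v y) $ i) differentiable at z" for i
    by (rule smooth_on_differentiable[OF smooth_on_linear[OF open_UNIV] open_UNIV UNIV_I])
  from jacobian_component[OF this] show ?thesis by (simp add: vec_eq_iff pd_linear)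
qed

lemma diffeo_linear:
  fixes A B :: "real^'a::finite^'a"
  assumes AB: "A ** B = mat 1" and V: "open V"
  shows "diffeo ((\<lambda>y. A *v y) -` V) V (\<lambda>y. A *v y)"
proof -
  let ?U = "(\<lambda>y. A *v y) -` V"
  have BA: "B ** A = mat 1" using AB matrix_left_right_inverse by blast
  have inv: "B *v (A *v y) = y" "A *v (B *v y) = y" for y
    by (simp_all add: matrix_vector_mul_assoc AB BA)
  have U: "open ?U" by (rule open_vimage[OF V]) (simp add: linear_continuous_on matrix_vector_mul_bounded_linear)
  have bij: "bij_betw (\<lambda>y. A *v y) ?U V"
    by (rule bij_betw_byWitness[where f' = "\<lambda>y. B *v y"]) (auto simp: inv)
  have "smooth_on V (\<lambda>y. inv_into ?U (\<lambda>y. A *v y) y $ i)" for i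
  proof (rule smooth_on_cong[OF V _ smooth_on_linear[OF V, of B]])
    fix y assume y: "y \<in> V"
    show "(B *v y) $ i = inv_into ?U (\<lambda>y. A *v y) y $ i"
      using inv_into_f_eq[OF bij_betw_imp_inj_on[OF bij], of "B *v y" y] y by (simp add: inv)
  qed
  then show ?thesis using U V bij smooth_on_linear[OF U, of A] by (simp add: diffeo_def smooth_map_on_def)
qed

lemma det_identity_row: "det (\<chi> i. if i = k then r else axis i 1) = r $ k" for r :: "real^'a::finite"
proof -
  have "row i (mat 1 :: real^'a^'a) = axis i 1" for i
    by (simp add: row_def mat_def axis_def vec_eq_iff eq_commute)
  then show ?thesis using cramer_lemma_transpose[where A = "mat 1 :: real^'a^'a" and x = r and k = k]
    by (simp add: basis_expansion cong: if_cong)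
qed

text \<open>The matrix determinant lemma, by expanding one row after the other: only terms with r in
  at most one row survive.\<close>

lemma det_rank_one:
  fixes u r :: "real^'a::finite"
  shows "det (\<chi> i. axis i 1 + u $ i *s r) = 1 + (\<Sum>i\<in>UNIV. u $ i * r $ i)"
proof -
  \<comment> \<open>With r itself in row k, the multiples of r in other rows drop out.\<close>
  have D: "det (\<chi> i. if i = k then r else if i \<in> S then axis i 1 + u $ i *s r else axis i 1) = r $ k"
    if "finite S" "k \<notin> S" for S k
    using that
  proof (induction S rule: finite_induct)
    case (insert j S)
    have kj: "k \<noteq> j" using insert.prems by auto
    let ?c = "\<lambda>i. if i = k then r else if i \<in> S then axis i 1 + u $ i *s r else axis i 1"
    have "det (\<chi> i. if i = k then r else if i \<in> insert j S then axis i 1 + u $ i *s r else axis i 1) =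
      det (\<chi> i. if i = j then axis j 1 + u $ j *s r else ?c i)"
      using kj by (intro arg_cong[of _ _ det]) (simp add: vec_eq_iff)
    also have "\<dots> = det (\<chi> i. if i = j then axis j 1 else ?c i) + u $ j * det (\<chi> i. if i = j then r else ?c i)"
      unfolding det_row_add det_row_mul ..
    also have "det (\<chi> i. if i = j then r else ?c i) = 0"
      by (rule det_identical_rows[OF kj]) (use kj in \<open>simp add: row_def vec_eq_iff\<close>)
    also have "det (\<chi> i. if i = j then axis j 1 else ?c i) = det (\<chi> i. ?c i)"
      using kj insert.hyps by (intro arg_cong[of _ _ det]) (simp add: vec_eq_iff)
    finally show ?case using insert by simp
  qed (simp add: det_identity_row cong: if_cong)
  have "det (\<chi> i. if i \<in> S then axis i 1 + u $ i *s r else axis i 1) = 1 + (\<Sum>i\<in>S. u $ i * r $ i)" if "finite S" for S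
    using that
  proof (induction S rule: finite_induct)
    case empty
    have "(\<chi> i. axis i (1::real)) = (mat 1 :: real^'a^'a)" by (simp add: vec_eq_iff mat_def axis_def eq_commute)
    then show ?case by simp
  next
    case (insert j S)
    let ?c = "\<lambda>i. if i \<in> S then axis i 1 + u $ i *s r else axis i 1"
    have "det (\<chi> i. if i \<in> insert j S then axis i 1 + u $ i *s r else axis i 1) =
      det (\<chi> i. if i = j then axis j 1 + u $ j *s r else ?c i)"
      by (intro arg_cong[of _ _ det]) (simp add: vec_eq_iff)
    also have "\<dots> = det (\<chi> i. if i = j then axis j 1 else ?c i) + u $ j * det (\<chi> i. if i = j then r else ?c i)"
      unfolding det_row_add det_row_mul ..
    also have "det (\<chi> i. if i = j then r else ?c i) = r $ j" by (rule D) (use insert in auto)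
    also have "det (\<chi> i. if i = j then axis j 1 else ?c i) = det (\<chi> i. ?c i)"
      using insert.hyps by (intro arg_cong[of _ _ det]) (simp add: vec_eq_iff)
    finally show ?case using insert by simp
  qed
  from this[of UNIV] show ?thesis by simp
qed

subsection \<open>Polynomial functions of the parameters\<close>

definition monom_value :: "nat \<Rightarrow> (nat \<Rightarrow> real) \<Rightarrow> real \<times> (nat \<Rightarrow> nat) \<Rightarrow> real" where
  "monom_value M t x = fst x * (\<Prod>m<M. t m ^ snd x m)"

definition polyfun :: "nat \<Rightarrow> ((nat \<Rightarrow> real) \<Rightarrow> real) \<Rightarrow> bool" where
  "polyfun M f \<longleftrightarrow> (\<exists>L. \<forall>t. f t = (\<Sum>x\<leftarrow>L. monom_value M t x))"

lemma polyfun_const: "polyfun M (\<lambda>_. c)"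
  unfolding polyfun_def by (rule exI[of _ "[(c, \<lambda>_. 0)]"]) (simp add: monom_value_def)

lemma polyfun_var:
  assumes "m < M"
  shows "polyfun M (\<lambda>t. t m)"
proof -
  have "(\<Prod>i<M. t i ^ (if i = m then 1 else 0)) = (\<Prod>i<M. if i = m then t i else 1)" for t :: "nat \<Rightarrow> real"
    by (intro prod.cong) auto
  then have "(\<Prod>i<M. t i ^ (if i = m then 1 else 0)) = t m" for t :: "nat \<Rightarrow> real" using assms by simp
  then have "monom_value M t (1, \<lambda>i. if i = m then 1 else 0) = t m" for t
    by (simp only: monom_value_def fst_conv snd_conv mult_1)
  then show ?thesis unfolding polyfun_def
    by (intro exI[of _ "[(1, \<lambda>i. if i = m then 1 else 0)]"] allI)
      (simp only: list.map sum_list.Cons sum_list.Nil add_0_right)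
qed

lemma polyfun_add: "polyfun M f \<Longrightarrow> polyfun M g \<Longrightarrow> polyfun M (\<lambda>t. f t + g t)"
proof -
  assume "polyfun M f" "polyfun M g"
  then obtain L L' where "\<And>t. f t = (\<Sum>x\<leftarrow>L. monom_value M t x)" "\<And>t. g t = (\<Sum>x\<leftarrow>L'. monom_value M t x)"
    unfolding polyfun_def by blast
  then show ?thesis unfolding polyfun_def by (intro exI[of _ "L @ L'"]) simp
qed

lemma polyfun_mult: "polyfun M f \<Longrightarrow> polyfun M g \<Longrightarrow> polyfun M (\<lambda>t. f t * g t)"
proof -
  assume "polyfun M f" "polyfun M g"
  then obtain L L' where L: "\<And>t. f t = (\<Sum>x\<leftarrow>L. monom_value M t x)" "\<And>t. g t = (\<Sum>x\<leftarrow>L'. monom_value M t x)"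
    unfolding polyfun_def by blast
  define mul where "mul x y = (fst x * fst y :: real, \<lambda>m. snd x m + snd y m :: nat)" for x y :: "real \<times> (nat \<Rightarrow> nat)"
  have m: "monom_value M t (mul x y) = monom_value M t x * monom_value M t y" for t x y
    by (simp add: monom_value_def mul_def power_add prod.distrib)
  have 1: "(\<Sum>y\<leftarrow>L'. monom_value M t (mul x y)) = monom_value M t x * (\<Sum>y\<leftarrow>L'. monom_value M t y)" for t x
    by (simp add: m sum_list_const_mult)
  have "(\<Sum>z\<leftarrow>concat (map (\<lambda>x. map (mul x) L') L). monom_value M t z) =
      (\<Sum>x\<leftarrow>L. monom_value M t x) * (\<Sum>y\<leftarrow>L'. monom_value M t y)" for t
    by (induction L) (simp_all add: o_def 1 distrib_right)
  then show ?thesis unfolding polyfun_def L by (intro exI[of _ "concat (map (\<lambda>x. map (mul x) L') L)"]) simp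
qed

lemma polyfun_sum: "(\<And>x. x \<in> A \<Longrightarrow> polyfun M (f x)) \<Longrightarrow> polyfun M (\<lambda>t. \<Sum>x\<in>A. f x t)"
  by (induction A rule: infinite_finite_induct) (simp_all add: polyfun_const polyfun_add)

lemma polyfun_prod: "(\<And>x. x \<in> A \<Longrightarrow> polyfun M (f x)) \<Longrightarrow> polyfun M (\<lambda>t. \<Prod>x\<in>A. f x t)"
  by (induction A rule: infinite_finite_induct) (simp_all add: polyfun_const polyfun_mult)

lemma polyfun_power: "polyfun M f \<Longrightarrow> polyfun M (\<lambda>t. f t ^ n)"
  by (induction n) (simp_all add: polyfun_const polyfun_mult)

lemma sum_sum_list: "(\<Sum>T\<in>A. \<Sum>x\<leftarrow>L. h T x) = (\<Sum>x\<leftarrow>L. \<Sum>T\<in>A. h T x)" for h :: "_ \<Rightarrow> _ \<Rightarrow> real"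
  by (induction L) (simp_all add: sum.distrib)

text \<open>Splitting a polynomial into the parts of given monomial support: the parts of small support vanish
  because they are combinations of restrictions of the polynomial, and the others are of high weighted
  order.\<close>

lemma polyfun_weighted_zero:
  fixes k :: "nat \<Rightarrow> nat" and d :: real
  assumes f: "polyfun M f" and k: "\<And>m. m < M \<Longrightarrow> 2 \<le> k m"
    and low: "\<And>S t. S \<subseteq> {..<M} \<Longrightarrow> 2 * card S < n \<Longrightarrow> f (\<lambda>m. if m \<in> S then t m else 0) = 0"
    and hom: "\<And>c t. 0 < c \<Longrightarrow> f (\<lambda>m. c ^ k m * t m) = c powr d * f t" and d: "d < real n"
  shows "f t = 0"
proof -
  obtain L where L: "\<And>t. f t = (\<Sum>x\<leftarrow>L. monom_value M t x)" using f unfolding polyfun_def by blast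
  define supp where "supp x = {m. m < M \<and> snd x m \<noteq> 0}" for x :: "real \<times> (nat \<Rightarrow> nat)"
  define part where "part S t = (\<Sum>x\<leftarrow>L. if supp x = S then monom_value M t x else 0)" for S t
  \<comment> \<open>Setting the parameters outside S to zero keeps exactly the monomials supported
    in S.\<close>
  have restr: "f (\<lambda>m. if m \<in> S then t m else 0) = (\<Sum>T\<in>Pow S. part T t)" if S: "S \<subseteq> {..<M}" for S t
  proof -
    have fS: "finite S" using S finite_subset by blast
    have "monom_value M (\<lambda>m. if m \<in> S then t m else 0) x = (\<Sum>T\<in>Pow S. if supp x = T then monom_value M t x else 0)" for x
    proof (cases "supp x \<subseteq> S")
      case True
      then have "(\<Prod>m<M. (if m \<in> S then t m else 0) ^ snd x m) = (\<Prod>m<M. t m ^ snd x m)"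
      proof (intro prod.cong refl)
        fix m assume "m \<in> {..<M}"
        then have "m \<notin> S \<Longrightarrow> snd x m = 0" using True by (auto simp: supp_def)
        then show "(if m \<in> S then t m else 0) ^ snd x m = t m ^ snd x m" by auto
      qed
      then show ?thesis using True fS by (simp add: monom_value_def)
    next
      case False
      then obtain m where "m < M" "snd x m \<noteq> 0" "m \<notin> S" by (auto simp: supp_def)
      then have "(\<Prod>m<M. (if m \<in> S then t m else 0) ^ snd x m) = 0" by (intro prod_zero) auto
      then show ?thesis using False fS by (simp add: monom_value_def)
    qed
    then show ?thesis
      unfolding L part_def sum_sum_list by (intro arg_cong[of _ _ sum_list] map_cong refl)
  qed
  \<comment> \<open>Induction over subsets extracts a single part from the sums in
    \<open>restr\<close>: the parts of proper subsets are zero already.\<close>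
  have low0: "part S t = 0" if "S \<subseteq> {..<M}" "2 * card S < n" for S t
  proof -
    have "finite S" using that(1) finite_subset by blast
    then show ?thesis using that
    proof (induction S rule: finite_psubset_induct)
      case (psubset S)
      have "part T t = 0" if "T \<in> Pow S - {S}" for T
      proof (rule psubset.IH)
        show T: "T \<subset> S" using that by auto
        show "T \<subseteq> {..<M}" using T psubset.prems(1) by blast
        show "2 * card T < n" using psubset_card_mono[OF psubset.hyps(1) T] psubset.prems(2) by simp
      qed
      then have "(\<Sum>T\<in>Pow S - {S}. part T t) = 0" by (rule sum.neutral[OF ballI])
      moreover have "(\<Sum>T\<in>Pow S. part T t) = part S t + (\<Sum>T\<in>Pow S - {S}. part T t)"
        using psubset.hyps(1) by (intro sum.remove) auto
      ultimately show ?case using restr[OF psubset.prems(1), of t] low[OF psubset.prems, of t] by simp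
    qed
  qed
  have ft: "f t = (\<Sum>T\<in>Pow {..<M}. part T t)" for t
  proof -
    have "f (\<lambda>m. if m \<in> {..<M} then t m else 0) = f t"
      unfolding L monom_value_def by (intro arg_cong[of _ _ sum_list] map_cong refl arg_cong2[of _ _ _ _ "(*)"] prod.cong) auto
    then show ?thesis using restr[of "{..<M}" t] by simp
  qed
  define K where "K = (\<Sum>T\<in>Pow {..<M}. \<Sum>x\<leftarrow>L. \<bar>monom_value M t x\<bar>)"
  have bound: "\<bar>f (\<lambda>m. c ^ k m * t m)\<bar> \<le> c ^ n * K" if c: "0 < c" "c \<le> 1" for c
  proof -
    have mono: "\<bar>monom_value M (\<lambda>m. c ^ k m * t m) x\<bar> \<le> c ^ n * \<bar>monom_value M t x\<bar>"
      if T: "supp x = T" "n \<le> 2 * card T" for x T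
    proof -
      have "monom_value M (\<lambda>m. c ^ k m * t m) x = c ^ (\<Sum>m<M. k m * snd x m) * monom_value M t x"
        by (simp add: monom_value_def power_mult_distrib prod.distrib power_mult[symmetric] power_sum)
      \<comment> \<open>T consists of at least n/2 parameters, each of weight at least 2.\<close>
      moreover have "n \<le> (\<Sum>m<M. k m * snd x m)"
      proof -
        have "2 * card T = (\<Sum>m\<in>T. 2)" by simp
        also have "\<dots> \<le> (\<Sum>m\<in>T. k m * snd x m)"
        proof (rule sum_mono)
          fix m assume "m \<in> T"
          then have "2 \<le> k m" "1 \<le> snd x m" using T k by (auto simp: supp_def)
          then show "2 \<le> k m * snd x m" using mult_le_mono by fastforce
        qed
        also have "\<dots> \<le> (\<Sum>m<M. k m * snd x m)" by (rule sum_mono2) (use T in \<open>auto simp: supp_def\<close>)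
        finally show ?thesis using T(2) by simp
      qed
      then have "c ^ (\<Sum>m<M. k m * snd x m) \<le> c ^ n" using c by (intro power_decreasing) auto
      ultimately show ?thesis using c by (simp add: abs_mult mult_right_mono)
    qed
    have pb: "\<bar>part T (\<lambda>m. c ^ k m * t m)\<bar> \<le> c ^ n * (\<Sum>x\<leftarrow>L. \<bar>monom_value M t x\<bar>)" if T: "T \<in> Pow {..<M}" for T
    proof (cases "2 * card T < n")
      case True
      have "0 \<le> (\<Sum>x\<leftarrow>L. \<bar>monom_value M t x\<bar>)" by (intro sum_list_nonneg) auto
      then show ?thesis using low0[of T] T True c by simp
    next
      case False
      have "\<bar>part T (\<lambda>m. c ^ k m * t m)\<bar> \<le> (\<Sum>x\<leftarrow>L. c ^ n * \<bar>monom_value M t x\<bar>)"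
        unfolding part_def
      proof (induction L)
        case (Cons x L)
        have "\<bar>if supp x = T then monom_value M (\<lambda>m. c ^ k m * t m) x else 0\<bar> \<le> c ^ n * \<bar>monom_value M t x\<bar>"
          using mono[of x T] False c by simp
        then show ?case using Cons by simp
      qed simp
      then show ?thesis by (simp add: sum_list_const_mult)
    qed
    have "\<bar>f (\<lambda>m. c ^ k m * t m)\<bar> \<le> (\<Sum>T\<in>Pow {..<M}. \<bar>part T (\<lambda>m. c ^ k m * t m)\<bar>)"
      unfolding ft[of "\<lambda>m. c ^ k m * t m"] by (rule sum_abs)
    also have "\<dots> \<le> (\<Sum>T\<in>Pow {..<M}. c ^ n * (\<Sum>x\<leftarrow>L. \<bar>monom_value M t x\<bar>))" by (intro sum_mono pb)
    finally show ?thesis unfolding K_def sum_distrib_left .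
  qed
  have K0: "0 \<le> K" unfolding K_def by (intro sum_nonneg sum_list_nonneg) auto
  have "\<bar>f t\<bar> \<le> e * K" if e: "0 < e" "e \<le> 1" for e
  proof -
    \<comment> \<open>Chosen so that c powr (n - d) = e. As d < n, comparing homogeneity of degree d
      with decay of order n leaves a factor that tends to zero with e.\<close>
    define c where "c = e powr (1 / (real n - d))"
    have c: "0 < c" "c \<le> 1" using e d by (auto simp: c_def powr_le_one_le powr_le1)
    have "c powr d * \<bar>f t\<bar> \<le> c ^ n * K" using bound[OF c] unfolding hom[OF c(1)] by (simp add: abs_mult)
    also have "c ^ n = c powr d * c powr (real n - d)"
      using c by (simp add: powr_realpow[symmetric] powr_add[symmetric])
    also have "c powr (real n - d) = e" using e d by (simp add: c_def powr_powr)
    finally show ?thesis using c by simp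
  qed
  then have "\<bar>f t\<bar> \<le> 0 + e" if "e > 0" for e
  proof -
    define e' where "e' = min 1 (e / (K + 1))"
    have e': "0 < e'" "e' \<le> 1" using that K0 by (auto simp: e'_def)
    have "e' * K \<le> e / (K + 1) * K" using K0 by (intro mult_right_mono) (auto simp: e'_def)
    also have "\<dots> \<le> e" using K0 that by (simp add: divide_le_eq field_simps)
    finally show ?thesis using \<open>\<And>e. 0 < e \<Longrightarrow> e \<le> 1 \<Longrightarrow> \<bar>f t\<bar> \<le> e * K\<close>[OF e'] by linarith
  qed
  then have "\<bar>f t\<bar> \<le> 0" by (rule field_le_epsilon)
  then show ?thesis by simp
qed

subsection \<open>Odd invariants of the polynomial family\<close>

lemma pullback_matrix: "pullback (\<lambda>y. A *v y) h y = transpose A ** h (A *v y) ** A"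
  by (simp add: pullback_def jacobian_matrix)

lemma jet_value_power_metric:
  fixes \<eta> :: "'n::finite \<Rightarrow> real"
  assumes "\<forall>m<M. 2 \<le> k m"
  shows "jet_value (power_metric \<eta> M k a b t) 0 x = (case x of
     Jet ls i j \<Rightarrow> (if ls = [] \<and> i = j then \<eta> i else 0) + (\<Sum>m<M. t m * (a m $ i * a m $ j) * pow_jet (k m) (b m) ls)
   | DetVar \<Rightarrow> \<bar>det (\<chi> i j. if i = j then \<eta> i else 0)\<bar> powr (- (1/2)))"
proof (cases x)
  case DetVar
  have "power_metric \<eta> M k a b t 0 = (\<chi> i j. if i = j then \<eta> i else 0)"
    using power_metric_0[of M k \<eta> a b t] assms by (simp add: vec_eq_iff)
  then show ?thesis using DetVar by simp
qed (simp add: pds_power_metric)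

text \<open>At the origin every jet is affine in t and the determinant variable is constant.\<close>

lemma polyfun_inv_value:
  assumes "\<forall>m<M. 2 \<le> k m"
  shows "polyfun M (\<lambda>t. inv_value P (power_metric \<eta> M k a b t) 0)"
proof -
  have "polyfun M (\<lambda>t. jet_value (power_metric \<eta> M k a b t) 0 x)" for x
  proof (cases x)
    case (Jet ls i j)
    have "polyfun M (\<lambda>t. (if ls = [] \<and> i = j then \<eta> i else 0) + (\<Sum>m<M. t m * (a m $ i * a m $ j) * pow_jet (k m) (b m) ls))"
      by (intro polyfun_add polyfun_sum polyfun_mult polyfun_const polyfun_var) simp
    then show ?thesis unfolding Jet jet_value_power_metric[OF assms] jet_var.case .
  next
    case DetVar
    then show ?thesis by (simp only: jet_value_power_metric[OF assms] jet_var.case polyfun_const)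
  qed
  then show ?thesis
    unfolding inv_value_def poly_value_def
    by (intro polyfun_sum polyfun_mult polyfun_const polyfun_prod polyfun_power)
qed

lemma isCont_pow_jet:
  assumes "\<And>i. isCont (\<lambda>s. b s $ i) (s0::real)"
  shows "isCont (\<lambda>s. pow_jet k (b s) ls) s0"
proof (cases "length ls = k")
  case True
  show ?thesis
    using assms unfolding pow_jet_def prod_list_count isCont_def by (simp add: True) (intro tendsto_mult tendsto_const tendsto_prod tendsto_power)
qed (simp add: pow_jet_def)

text \<open>Continuity in the covectors a and b, for the passage to the limit when the orthogonal
  vector is null.\<close>

lemma isCont_inv_value:
  assumes k: "\<forall>m<M. 2 \<le> k m"
    and a: "\<And>m i. isCont (\<lambda>s. a s m $ i) (s0::real)" and b: "\<And>m i. isCont (\<lambda>s. b s m $ i) s0"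
  shows "isCont (\<lambda>s. inv_value P (power_metric \<eta> M k (a s) (b s) t) 0) s0"
proof -
  have "isCont (\<lambda>s. jet_value (power_metric \<eta> M k (a s) (b s) t) 0 x) s0" for x
  proof (cases x)
    case (Jet ls i j)
    show ?thesis
      using a isCont_pow_jet[OF b] unfolding Jet jet_value_power_metric[OF k] jet_var.case isCont_def
      by (intro tendsto_add tendsto_sum tendsto_mult tendsto_const)
  next
    case DetVar
    then show ?thesis by (simp only: jet_value_power_metric[OF k] jet_var.case continuous_const)
  qed
  then show ?thesis
    unfolding inv_value_def poly_value_def isCont_def
    by (intro tendsto_sum tendsto_mult tendsto_const tendsto_prod tendsto_power)
qed

locale odd_invariant =
  fixes p q :: nat and w :: real and P :: "('n::finite) jet_var polynomial"
    and \<eta> :: "'n \<Rightarrow> real" and M :: nat and k :: "nat \<Rightarrow> nat"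
  assumes conf: "scalar_conformal_invariant p q w P" and odd: "odd_scalar_invariant p q P"
    and \<eta>: "\<And>i. \<bar>\<eta> i\<bar> = 1" and card_\<eta>: "card {i. \<eta> i = 1} = p" "card {i. \<eta> i = -1} = q"
    and k: "\<And>m. m < M \<Longrightarrow> 2 \<le> k m"
begin

abbreviation "pm \<equiv> power_metric \<eta> M k"

definition val :: "(nat \<Rightarrow> real^'n) \<Rightarrow> (nat \<Rightarrow> real^'n) \<Rightarrow> (nat \<Rightarrow> real) \<Rightarrow> real" where
  "val a b t = inv_value P (pm a b t) 0"

lemma near: obtains V where "0 \<in> V" "metric_on p q V (pm a b t)"
proof (rule power_metric_near[of M k \<eta> p q a b t])
  show "2 \<le> k m" if "m < M" for m by (rule k[OF that])
qed (use \<eta> card_\<eta> that in auto)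

text \<open>The pullback under y \<mapsto> c y is c^2 times the metric with t m replaced by c^(k m)
  * t m. Coordinate invariance undoes the pullback, and conformal invariance with the constant
  factor c extracts the power c powr w.\<close>

lemma val_scale:
  assumes c: "0 < c"
  shows "val a b (\<lambda>m. c ^ k m * t m) = c powr (- w) * val a b t"
proof -
  obtain V where V: "0 \<in> V" "metric_on p q V (pm a b t)" by (rule near)
  obtain V' where V': "0 \<in> V'" "metric_on p q V' (pm a b (\<lambda>m. c ^ k m * t m))" by (rule near)
  let ?A = "mat c :: real^'n^'n"
  have cm: "?A *v y = c *\<^sub>R y" for y
    by (simp add: vec_eq_iff matrix_vector_mult_def mat_def if_distrib[where f = "\<lambda>x. x * _"] cong: if_cong)
  have AB: "?A ** mat (1 / c) = mat 1"
    using c by (simp add: vec_eq_iff matrix_matrix_mult_def mat_def if_distrib[where f = "\<lambda>x. x * _"] cong: if_cong)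
  let ?U = "(\<lambda>y. ?A *v y) -` V"
  have "det ?A = (\<Prod>i\<in>(UNIV :: 'n set). c)" by (subst det_diagonal) (auto simp: mat_def)
  then have "orientation_preserving ?U (\<lambda>y. ?A *v y)"
    using c by (simp add: orientation_preserving_def jacobian_matrix)
  moreover have "diffeo ?U V (\<lambda>y. ?A *v y)"
    using V(2) by (intro diffeo_linear[OF AB]) (simp add: metric_on_def)
  moreover have "scalar_invariant p q P" using conf by (simp add: scalar_conformal_invariant_def)
  ultimately have "inv_value P (pullback (\<lambda>y. ?A *v y) (pm a b t)) 0 = inv_value P (pm a b t) (?A *v 0)"
    using V unfolding scalar_invariant_def by simp
  then have 1: "inv_value P (pullback (\<lambda>y. ?A *v y) (pm a b t)) 0 = val a b t" by (simp add: val_def)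
  have "pullback (\<lambda>y. ?A *v y) (pm a b t) y $ i $ j = (c\<^sup>2 *\<^sub>R pm a b (\<lambda>m. c ^ k m * t m) y) $ i $ j" for y i j
  proof -
    have "pullback (\<lambda>y. ?A *v y) (pm a b t) y $ i $ j = (\<Sum>x\<in>UNIV. if x = i then
        (\<Sum>z\<in>UNIV. if z = j then c * pm a b t (c *\<^sub>R y) $ x $ z * c else 0) else 0)"
      unfolding pullback_matrix congruence_component unfolding cm
      by (intro sum.cong refl) (simp add: mat_def if_distrib[where f = "\<lambda>x. _ * x"] cong: if_cong)
    also have "\<dots> = c\<^sup>2 * pm a b t (c *\<^sub>R y) $ i $ j" by (simp add: power2_eq_square)
    also have "pm a b t (c *\<^sub>R y) $ i $ j = pm a b (\<lambda>m. c ^ k m * t m) y $ i $ j"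
      unfolding power_metric_def by (simp add: power_mult_distrib mult_ac)
    finally show ?thesis by simp
  qed
  then have "pullback (\<lambda>y. ?A *v y) (pm a b t) = (\<lambda>y. c\<^sup>2 *\<^sub>R pm a b (\<lambda>m. c ^ k m * t m) y)"
    by (simp add: fun_eq_iff vec_eq_iff)
  then have "val a b t = inv_value P (\<lambda>y. c\<^sup>2 *\<^sub>R pm a b (\<lambda>m. c ^ k m * t m) y) 0" using 1 by simp
  also have "\<dots> = c powr w * inv_value P (pm a b (\<lambda>m. c ^ k m * t m)) 0"
  proof -
    have "\<forall>U g \<Omega>. metric_on p q U g \<longrightarrow> smooth_on U \<Omega> \<longrightarrow> (\<forall>x\<in>U. \<Omega> x > 0) \<longrightarrow>
        (\<forall>x\<in>U. inv_value P (\<lambda>y. (\<Omega> y)\<^sup>2 *\<^sub>R g y) x = \<Omega> x powr w * inv_value P g x)"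
      using conf by (simp add: scalar_conformal_invariant_def)
    from this[rule_format, OF V'(2) smooth_on_const _ V'(1)] c show ?thesis by blast
  qed
  finally have "val a b t = c powr w * val a b (\<lambda>m. c ^ k m * t m)" by (simp add: val_def)
  then show ?thesis using c by (simp add: powr_minus)
qed

text \<open>The reflection along u that is orthogonal for \<eta> preserves \<eta> and all covectors
  that annihilate u. So it is an orientation-reversing isometry fixing the origin, and the value
  there equals its negative.\<close>

lemma val_reflection:
  assumes u: "(\<Sum>i\<in>UNIV. \<eta> i * (u $ i)\<^sup>2) \<noteq> 0"
    and ab: "\<And>m. m < M \<Longrightarrow> t m \<noteq> 0 \<Longrightarrow> a m \<bullet> u = 0 \<and> b m \<bullet> u = 0"
  shows "val a b t = 0"
proof -
  define Q where "Q = (\<Sum>i\<in>UNIV. \<eta> i * (u $ i)\<^sup>2)"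
  \<comment> \<open>The multiple of the covector \<eta> u that takes the value -2 on u, so that A u
    = -u.\<close>
  define r where "r = (\<chi> i. - (2 * \<eta> i * u $ i / Q))"
  define A :: "real^'n^'n" where "A = (\<chi> i. axis i 1 + u $ i *s r)"
  have Q0: "Q \<noteq> 0" using u by (simp add: Q_def)
  have ur: "(\<Sum>i\<in>UNIV. u $ i * r $ i) = - 2"
  proof -
    have "(\<Sum>i\<in>UNIV. u $ i * r $ i) = (\<Sum>i\<in>UNIV. (- 2 / Q) * (\<eta> i * (u $ i)\<^sup>2))"
      by (intro sum.cong refl) (simp add: r_def power2_eq_square)
    also have "\<dots> = (- 2 / Q) * Q" unfolding sum_distrib_left[symmetric] Q_def ..
    finally show ?thesis using Q0 by simp
  qed
  have Ac: "A $ i $ j = (if i = j then 1 else 0) + u $ i * r $ j" for i j by (auto simp: A_def axis_def)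
  have detA: "det A = -1" unfolding A_def det_rank_one ur by simp
  have Av: "A *v y = y + (\<Sum>j\<in>UNIV. r $ j * y $ j) *\<^sub>R u" for y
  proof -
    have "(A *v y) $ i = y $ i + (\<Sum>j\<in>UNIV. r $ j * y $ j) * u $ i" for i
    proof -
      have "(A *v y) $ i = (\<Sum>j\<in>UNIV. (if j = i then y $ i else 0) + u $ i * (r $ j * y $ j))"
        unfolding matrix_vector_mult_def vec_lambda_beta by (intro sum.cong refl) (auto simp: Ac algebra_simps)
      then show ?thesis by (simp add: sum.distrib sum_distrib_left[symmetric] mult.commute)
    qed
    then show ?thesis by (simp add: vec_eq_iff)
  qed
  have AA: "A ** A = mat 1"
  proof -
    have "(A ** A) $ i $ j = (if i = j then 1 else 0)" for i j
    proof -
      have "(A ** A) $ i $ j = (\<Sum>l\<in>UNIV. (if l = i then (if i = j then 1 else 0) + u $ i * r $ j else 0)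
        + (if l = j then u $ i * r $ j else 0) + (u $ i * r $ j) * (u $ l * r $ l))"
        unfolding matrix_matrix_mult_def vec_lambda_beta Ac by (intro sum.cong refl) (auto simp: algebra_simps)
      then show ?thesis by (simp add: sum.distrib sum_distrib_left[symmetric] ur)
    qed
    then show ?thesis by (simp add: vec_eq_iff mat_def)
  qed
  have A\<eta>: "(\<Sum>x\<in>UNIV. A $ x $ i * \<eta> x * A $ x $ j) = (if i = j then \<eta> i else 0)" for i j
  proof -
    have "(\<Sum>x\<in>UNIV. A $ x $ i * \<eta> x * A $ x $ j) = (\<Sum>x\<in>UNIV. (if x = i then (if i = j then \<eta> i else 0) + \<eta> i * u $ i * r $ j else 0)
       + (if x = j then \<eta> j * u $ j * r $ i else 0) + (r $ i * r $ j) * (\<eta> x * (u $ x)\<^sup>2))"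
      unfolding Ac by (intro sum.cong refl) (auto simp: algebra_simps power2_eq_square)
    also have "\<dots> = (if i = j then \<eta> i else 0) + \<eta> i * u $ i * r $ j + \<eta> j * u $ j * r $ i + r $ i * r $ j * Q"
      by (simp add: sum.distrib sum_distrib_left[symmetric] Q_def)
    also have "\<dots> = (if i = j then \<eta> i else 0)" using Q0 by (simp add: r_def field_simps)
    finally show ?thesis .
  qed
  have Aa: "(\<Sum>x\<in>UNIV. A $ x $ i * v $ x) = v $ i" if "v \<bullet> u = 0" for v :: "real^'n" and i
  proof -
    have "(\<Sum>x\<in>UNIV. A $ x $ i * v $ x) = (\<Sum>x\<in>UNIV. (if x = i then v $ i else 0) + r $ i * (v $ x * u $ x))"
      unfolding Ac by (intro sum.cong refl) (auto simp: algebra_simps)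
    also have "\<dots> = v $ i + r $ i * (v \<bullet> u)"
      by (simp add: sum.distrib sum_distrib_left[symmetric] inner_vec_def)
    finally show ?thesis using that by simp
  qed
  have pb: "pullback (\<lambda>y. A *v y) (pm a b t) = pm a b t"
  proof -
    have "pullback (\<lambda>y. A *v y) (pm a b t) y $ i $ j = pm a b t y $ i $ j" for y i j
    proof -
      have term0: "(\<Sum>x\<in>UNIV. \<Sum>z\<in>UNIV. A $ x $ i * (if x = z then \<eta> x else 0) * A $ z $ j) = (if i = j then \<eta> i else 0)"
      proof -
        have "(\<Sum>z\<in>UNIV. A $ x $ i * (if x = z then \<eta> x else 0) * A $ z $ j) = A $ x $ i * \<eta> x * A $ x $ j" for x
          by (simp add: if_distrib[where f = "\<lambda>x. _ * x"] if_distrib[where f = "\<lambda>x. x * _"] cong: if_cong)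
        then show ?thesis by (simp only: A\<eta>)
      qed
      have term1: "(\<Sum>x\<in>UNIV. \<Sum>z\<in>UNIV. A $ x $ i * (t m * (a m $ x * a m $ z) * (b m \<bullet> (A *v y)) ^ k m) * A $ z $ j) =
          t m * (a m $ i * a m $ j) * (b m \<bullet> y) ^ k m" if m: "m < M" for m
      proof (cases "t m = 0")
        case False
        then have o: "a m \<bullet> u = 0" "b m \<bullet> u = 0" using ab[OF m] by auto
        have "b m \<bullet> (A *v y) = b m \<bullet> y" using o by (simp add: Av inner_add_right)
        then have "(\<Sum>x\<in>UNIV. \<Sum>z\<in>UNIV. A $ x $ i * (t m * (a m $ x * a m $ z) * (b m \<bullet> (A *v y)) ^ k m) * A $ z $ j) =
          t m * (b m \<bullet> y) ^ k m * ((\<Sum>x\<in>UNIV. A $ x $ i * a m $ x) * (\<Sum>z\<in>UNIV. A $ z $ j * a m $ z))"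
          unfolding sum_product unfolding sum_distrib_left by (intro sum.cong refl) (simp add: mult_ac)
        then show ?thesis unfolding Aa[OF o(1)] by (simp add: mult_ac)
      qed simp
      have "pullback (\<lambda>y. A *v y) (pm a b t) y $ i $ j =
        (\<Sum>x\<in>UNIV. \<Sum>z\<in>UNIV. A $ x $ i * (if x = z then \<eta> x else 0) * A $ z $ j +
          (\<Sum>m<M. A $ x $ i * (t m * (a m $ x * a m $ z) * (b m \<bullet> (A *v y)) ^ k m) * A $ z $ j))"
        unfolding pullback_matrix congruence_component power_metric_def vec_lambda_beta
        by (intro sum.cong refl) (simp only: distrib_left distrib_right sum_distrib_left sum_distrib_right)
      also have "\<dots> = (if i = j then \<eta> i else 0) +
          (\<Sum>x\<in>UNIV. \<Sum>z\<in>UNIV. \<Sum>m<M. A $ x $ i * (t m * (a m $ x * a m $ z) * (b m \<bullet> (A *v y)) ^ k m) * A $ z $ j)"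
        unfolding sum.distrib term0 ..
      also have "(\<Sum>x\<in>UNIV. \<Sum>z\<in>UNIV. \<Sum>m<M. A $ x $ i * (t m * (a m $ x * a m $ z) * (b m \<bullet> (A *v y)) ^ k m) * A $ z $ j) =
          (\<Sum>x\<in>UNIV. \<Sum>m<M. \<Sum>z\<in>UNIV. A $ x $ i * (t m * (a m $ x * a m $ z) * (b m \<bullet> (A *v y)) ^ k m) * A $ z $ j)"
        by (intro sum.cong refl sum.swap)
      also have "\<dots> = (\<Sum>m<M. \<Sum>x\<in>UNIV. \<Sum>z\<in>UNIV. A $ x $ i * (t m * (a m $ x * a m $ z) * (b m \<bullet> (A *v y)) ^ k m) * A $ z $ j)"
        by (rule sum.swap)
      also have "\<dots> = (\<Sum>m<M. t m * (a m $ i * a m $ j) * (b m \<bullet> y) ^ k m)"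
        by (intro sum.cong refl term1) simp
      finally show ?thesis by (simp only: power_metric_def[of _ _ _ _ _ _ y] vec_lambda_beta)
    qed
    then show ?thesis by (simp add: fun_eq_iff vec_eq_iff)
  qed
  obtain V where V: "0 \<in> V" "metric_on p q V (pm a b t)" by (rule near)
  let ?U = "(\<lambda>y. A *v y) -` V"
  have "diffeo ?U V (\<lambda>y. A *v y)"
    using V(2) by (intro diffeo_linear[OF AA]) (simp add: metric_on_def)
  moreover have "orientation_reversing ?U (\<lambda>y. A *v y)"
    by (simp add: orientation_reversing_def jacobian_matrix detA)
  ultimately have "inv_value P (pullback (\<lambda>y. A *v y) (pm a b t)) 0 = - inv_value P (pm a b t) (A *v 0)"
    using odd V unfolding odd_scalar_invariant_def by simp
  then show ?thesis by (simp add: pb val_def)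
qed

text \<open>The few vectors involved have a common orthogonal vector; if it is null, perturb it, and the
  vectors with it, into the non-null case.\<close>

lemma val_few:
  assumes S: "S \<subseteq> {..<M}" "2 * card S < CARD('n)" and t: "\<And>m. m \<notin> S \<Longrightarrow> t m = 0"
  shows "val a b t = 0"
proof -
  have fS: "finite S" using S(1) finite_subset by blast
  have "dim (a ` S \<union> b ` S) \<le> card (a ` S \<union> b ` S)" by (rule dim_le_card') (use fS in simp)
  also have "\<dots> \<le> card (a ` S) + card (b ` S)" by (rule card_Un_le)
  also have "\<dots> \<le> 2 * card S" using card_image_le[OF fS, of a] card_image_le[OF fS, of b] by simp
  finally have "dim (a ` S \<union> b ` S) < DIM(real^'n)" using S(2) by simp
  from orthogonal_to_subspace_exists[OF this]
  obtain u where u: "u \<noteq> 0" "\<And>y. y \<in> span (a ` S \<union> b ` S) \<Longrightarrow> orthogonal u y" by blast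
  have au: "a m \<bullet> u = 0" "b m \<bullet> u = 0" if "m \<in> S" for m
    using u(2)[OF span_base, of "a m"] u(2)[OF span_base, of "b m"] that by (auto simp: orthogonal_def inner_commute)
  show ?thesis
  proof (cases "(\<Sum>i\<in>UNIV. \<eta> i * (u $ i)\<^sup>2) = 0")
    case False
    show ?thesis by (rule val_reflection[OF False]) (use t au in blast)
  next
    case null: True
    \<comment> \<open>With u also z = \<eta> u is null, and the two pair under \<eta> to u \<bullet>
      u > 0. Hence u + s z is not null for s \<noteq> 0.\<close>
    define z where "z = (\<chi> i. \<eta> i * u $ i)"
    define us where "us s = u + s *\<^sub>R z" for s :: real
    have ee: "\<eta> i * \<eta> i = 1" for i using \<eta>[of i] by (metis abs_mult_self_eq mult_1)
    have quad: "(\<Sum>i\<in>UNIV. \<eta> i * (us s $ i)\<^sup>2) = 2 * s * (u \<bullet> u)" for s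
    proof -
      have "\<eta> i * (us s $ i)\<^sup>2 = \<eta> i * (u $ i)\<^sup>2 + 2 * s * (u $ i * u $ i) + s\<^sup>2 * (\<eta> i * (u $ i)\<^sup>2)" for i
      proof -
        have "\<eta> i * (us s $ i)\<^sup>2 = \<eta> i * (u $ i)\<^sup>2 + 2 * s * ((\<eta> i * \<eta> i) * (u $ i * u $ i))
            + s\<^sup>2 * ((\<eta> i * \<eta> i) * (\<eta> i * (u $ i)\<^sup>2))"
          by (simp add: us_def z_def power2_eq_square algebra_simps)
        then show ?thesis by (simp only: ee mult_1)
      qed
      then have "(\<Sum>i\<in>UNIV. \<eta> i * (us s $ i)\<^sup>2) = (\<Sum>i\<in>UNIV. \<eta> i * (u $ i)\<^sup>2) + 2 * s * (\<Sum>i\<in>UNIV. u $ i * u $ i)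
          + s\<^sup>2 * (\<Sum>i\<in>UNIV. \<eta> i * (u $ i)\<^sup>2)"
        by (simp add: sum.distrib sum_distrib_left)
      then show ?thesis by (simp add: null inner_vec_def)
    qed
    have nz: "us s \<noteq> 0" for s
    proof (cases "s = 0")
      case False
      then have "2 * s * (u \<bullet> u) \<noteq> 0" using u(1) by simp
      then show ?thesis using quad[of s] by auto
    qed (use u(1) in \<open>simp add: us_def\<close>)
    \<comment> \<open>Covectors are written as vectors, so annihilating \<open>us s\<close> is
      Euclidean orthogonality to it. At s = 0 the projection fixes the vectors that are orthogonal
      to u.\<close>
    define proj where "proj s v = v - ((v \<bullet> us s) / (us s \<bullet> us s)) *\<^sub>R us s" for s :: real and v :: "real^'n"
    define as where "as s m = (if m \<in> S then proj s (a m) else a m)" for s m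
    define bs where "bs s m = (if m \<in> S then proj s (b m) else b m)" for s m
    have orth: "proj s v \<bullet> us s = 0" for s v using nz[of s] by (simp add: proj_def inner_diff_left)
    have zero: "val (as s) (bs s) t = 0" if "s \<noteq> 0" for s
    proof (rule val_reflection[of "us s"])
      show "(\<Sum>i\<in>UNIV. \<eta> i * (us s $ i)\<^sup>2) \<noteq> 0" unfolding quad using that u(1) by simp
      show "as s m \<bullet> us s = 0 \<and> bs s m \<bullet> us s = 0" if "t m \<noteq> 0" for m
        using t[of m] that orth by (auto simp: as_def bs_def)
    qed
    have cu: "isCont us 0" unfolding us_def by (intro continuous_intros)
    have cp: "isCont (\<lambda>s. proj s v $ i) 0" for v i
    proof -
      have "isCont (\<lambda>s. proj s v) 0"
        unfolding proj_def using nz[of 0] by (intro continuous_intros cu) simp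
      then show ?thesis by (intro continuous_intros)
    qed
    have "isCont (\<lambda>s. val (as s) (bs s) t) 0"
      unfolding val_def
    proof (rule isCont_inv_value)
      show "\<forall>m<M. 2 \<le> k m" using k by blast
      show "isCont (\<lambda>s. as s m $ i) 0" for m i unfolding as_def using cp by (cases "m \<in> S") auto
      show "isCont (\<lambda>s. bs s m $ i) 0" for m i unfolding bs_def using cp by (cases "m \<in> S") auto
    qed
    then have "(\<lambda>s. val (as s) (bs s) t) \<midarrow>0\<rightarrow> val (as 0) (bs 0) t" by (simp add: isCont_def)
    moreover have "(\<lambda>s. val (as s) (bs s) t) \<midarrow>0\<rightarrow> 0"
      by (rule tendsto_eventually) (use zero in \<open>auto simp: eventually_at_filter\<close>)
    ultimately have "val (as 0) (bs 0) t = 0" by (rule LIM_unique)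
    moreover have "as 0 = a" "bs 0 = b"
      using au by (auto simp: fun_eq_iff as_def bs_def proj_def us_def)
    ultimately show ?thesis by simp
  qed
qed

lemma val_zero:
  assumes "- w < real CARD('n)"
  shows "val a b t = 0"
proof (rule polyfun_weighted_zero[where f = "val a b" and k = k and n = "CARD('n)" and d = "- w" and M = M])
  show "polyfun M (val a b)"
    unfolding val_def[abs_def] by (rule polyfun_inv_value) (use k in blast)
  show "val a b (\<lambda>m. if m \<in> S then t m else 0) = 0" if "S \<subseteq> {..<M}" "2 * card S < CARD('n)" for S t
    by (rule val_few[OF that]) simp
qed (use k val_scale assms in auto)

end

subsection \<open>Scalar conformal invariants\<close>

lemma inv_value_cong:
  fixes P :: "('n::finite) jet_var polynomial"
  assumes "\<And>m x. m \<in> Poly_Mapping.keys P \<Longrightarrow> x \<in> Poly_Mapping.keys m \<Longrightarrow> jet_value g y x = jet_value h z x"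
  shows "inv_value P g y = inv_value P h z"
  unfolding inv_value_def poly_value_def using assms by (intro sum.cong prod.cong refl arg_cong2[of _ _ _ _ "(*)"]) simp

text \<open>A polynomial involves finitely many variables, so only jets up to a fixed order have to
  be matched.\<close>

lemma jet_order_bound:
  fixes P :: "'n jet_var polynomial"
  obtains N where "\<And>m ls i j. m \<in> Poly_Mapping.keys P \<Longrightarrow> Jet ls i j \<in> Poly_Mapping.keys m \<Longrightarrow> length ls \<le> N"
proof -
  define ord where "ord x = (case x of Jet ls i j \<Rightarrow> length ls | DetVar \<Rightarrow> 0)" for x :: "'n jet_var"
  have f: "finite (ord ` (\<Union>m\<in>Poly_Mapping.keys P. Poly_Mapping.keys m))" by simp
  have "length ls \<le> Max (ord ` (\<Union>m\<in>Poly_Mapping.keys P. Poly_Mapping.keys m))"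
    if "m \<in> Poly_Mapping.keys P" "Jet ls i j \<in> Poly_Mapping.keys m" for m ls i j
  proof (rule Max_ge[OF f])
    show "length ls \<in> ord ` (\<Union>m\<in>Poly_Mapping.keys P. Poly_Mapping.keys m)"
      by (rule image_eqI[of _ _ "Jet ls i j"]) (use that in \<open>auto simp: ord_def\<close>)
  qed
  then show ?thesis using that by blast
qed

text \<open>In normalized coordinates the metric has, up to the order that P sees, the same jets at
  the origin as a metric of the polynomial family. The coordinate change may reverse the
  orientation, which at most changes the sign of the value.\<close>

theorem odd_scalar_conformal_invariant_vanishes:
  fixes P :: "('n::finite) jet_var polynomial"
  assumes conf: "scalar_conformal_invariant p q w P" and odd: "odd_scalar_invariant p q P"
    and w: "- w < real CARD('n)" and g: "metric_on p q N g" and x: "x \<in> N"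
  shows "inv_value P g x = 0"
proof -
  obtain \<phi> \<eta> where \<phi>: "smooth_map_on UNIV \<phi>" "\<phi> 0 = x" "det (jacobian \<phi> (at 0)) \<noteq> 0"
    and \<eta>: "\<And>i. \<bar>\<eta> i\<bar> = 1" "card {i. \<eta> i = 1} = p" "card {i. \<eta> i = -1} = q"
    and h0: "\<And>i j. pullback \<phi> g 0 $ i $ j = (if i = j then \<eta> i else 0)"
    and h1: "\<And>i j k. pd k (\<lambda>y. pullback \<phi> g y $ i $ j) 0 = 0"
    by (rule normalizing_map[OF g x]) (rule that; assumption)
  have oN: "open N" and gN: "smooth_tensor_on N g" using g by (auto simp: metric_on_def)
  obtain U V where UV: "0 \<in> U" "V \<subseteq> N" "diffeo U V \<phi>"
    "orientation_preserving U \<phi> \<or> orientation_reversing U \<phi>"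
    using local_diffeo[OF \<phi>(1,3) oN] \<phi>(2) x by metis
  have oU: "open U" "open V" and bij: "bij_betw \<phi> U V" and s\<phi>: "smooth_map_on U \<phi>"
    using UV(3) by (auto simp: diffeo_def)
  have \<phi>V: "\<phi> y \<in> V" if "y \<in> U" for y using bij that by (auto simp: bij_betw_def)
  have gV: "metric_on p q V g"
  proof -
    have "smooth_tensor_on V g"
      unfolding smooth_tensor_on_def
    proof (intro allI)
      fix i j
      have "smooth_on N (\<lambda>y. g y $ i $ j)" using gN by (simp add: smooth_tensor_on_def)
      then show "smooth_on V (\<lambda>y. g y $ i $ j)" using UV(2) by (rule smooth_on_subset)
    qed
    then show ?thesis using g UV(2) oU(2) unfolding metric_on_def by blast
  qed
  define h where "h = pullback \<phi> g"
  have "inv_value P h 0 = inv_value P g x \<or> inv_value P h 0 = - inv_value P g x"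
    using UV(4)
  proof
    assume o: "orientation_preserving U \<phi>"
    have "\<forall>U V \<phi> g. diffeo U V \<phi> \<longrightarrow> orientation_preserving U \<phi> \<longrightarrow> metric_on p q V g \<longrightarrow>
        (\<forall>x\<in>U. inv_value P (pullback \<phi> g) x = inv_value P g (\<phi> x))"
      using conf by (simp add: scalar_conformal_invariant_def scalar_invariant_def)
    from this[rule_format, OF UV(3) o gV UV(1)] show ?thesis by (simp add: h_def \<phi>(2))
  next
    assume o: "orientation_reversing U \<phi>"
    have "\<forall>U V \<phi> g. diffeo U V \<phi> \<longrightarrow> orientation_reversing U \<phi> \<longrightarrow> metric_on p q V g \<longrightarrow>
        (\<forall>x\<in>U. inv_value P (pullback \<phi> g) x = - inv_value P g (\<phi> x))"
      using odd by (simp add: odd_scalar_invariant_def)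
    from this[rule_format, OF UV(3) o gV UV(1)] show ?thesis by (simp add: h_def \<phi>(2))
  qed
  moreover have "inv_value P h 0 = 0"
  proof -
    have sh: "smooth_on U (\<lambda>y. h y $ i $ j)" for i j
      using pullback_smooth[OF oU s\<phi> \<phi>V] gV by (simp add: h_def metric_on_def smooth_tensor_on_def)
    have symh: "h y $ i $ j = h y $ j $ i" if "y \<in> U" for y i j
    proof -
      interpret smooth_metric V g by (rule metric_on_smooth_metric[OF gV])
      have "h y $ i $ j = (\<Sum>b\<in>UNIV. \<Sum>a\<in>UNIV. jacobian \<phi> (at y) $ a $ i * g (\<phi> y) $ a $ b * jacobian \<phi> (at y) $ b $ j)"
        unfolding h_def pullback_component by (rule sum.swap)
      also have "\<dots> = h y $ j $ i"
        unfolding h_def pullback_component by (intro sum.cong refl) (simp add: sym_G[OF \<phi>V[OF that]] mult_ac)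
      finally show ?thesis .
    qed
    obtain ord where ord: "\<And>m ls i j. m \<in> Poly_Mapping.keys P \<Longrightarrow> Jet ls i j \<in> Poly_Mapping.keys m \<Longrightarrow> length ls \<le> ord"
      using jet_order_bound[of P] by blast
    have "jets_from_powers ord (\<lambda>ls i j. pds ls (\<lambda>y. h y $ i $ j) 0)"
    proof (rule jets_from_powers_all)
      show "pds ls (\<lambda>y. h y $ i $ j) 0 = pds ls' (\<lambda>y. h y $ i $ j) 0" if "mset ls = mset ls'" for ls ls' i j
        by (rule pds_mset[OF oU(1) sh that UV(1)])
      show "pds ls (\<lambda>y. h y $ i $ j) 0 = pds ls (\<lambda>y. h y $ j $ i) 0" for ls i j
        by (rule pds_cong_open[OF oU(1) symh UV(1)])
    qed
    then show ?thesis
    proof (rule jets_from_powersE)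
      fix M :: nat and k t and a b :: "nat \<Rightarrow> real^'n"
      assume k: "\<And>m. m < M \<Longrightarrow> 2 \<le> k m"
        and J: "\<And>ls i j. 2 \<le> length ls \<Longrightarrow> length ls \<le> ord \<Longrightarrow>
          pds ls (\<lambda>y. h y $ i $ j) 0 = (\<Sum>m<M. t m * (a m $ i * a m $ j) * pow_jet (k m) (b m) ls)"
      interpret odd_invariant p q w P \<eta> M k by unfold_locales (use conf odd \<eta> k in auto)
      have "inv_value P h 0 = inv_value P (power_metric \<eta> M k a b t) 0"
      proof (rule inv_value_cong)
        fix m v assume mv: "m \<in> Poly_Mapping.keys P" "v \<in> Poly_Mapping.keys m"
        show "jet_value h 0 v = jet_value (power_metric \<eta> M k a b t) 0 v"
        proof (cases v)
          case DetVar
          have "h 0 = (\<chi> i j. if i = j then \<eta> i else 0)" using h0 by (simp add: h_def vec_eq_iff)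
          then show ?thesis using DetVar jet_value_power_metric[of M k \<eta> a b t v] k by simp
        next
          case (Jet ls i j)
          have len: "length ls \<le> ord" using ord mv Jet by blast
          \<comment> \<open>Powers with exponent at least 2 do not contribute to jets of order 0 and
            1, which the normalization has already made those of the constant metric \<eta>.\<close>
          have short: "(\<Sum>m<M. t m * (a m $ i * a m $ j) * pow_jet (k m) (b m) ls) = 0" if "length ls < 2"
            by (rule sum.neutral) (use that k pow_jet_short in auto)
          have "pds ls (\<lambda>y. h y $ i $ j) 0 = (if ls = [] \<and> i = j then \<eta> i else 0) +
              (\<Sum>m<M. t m * (a m $ i * a m $ j) * pow_jet (k m) (b m) ls)"
          proof (cases "2 \<le> length ls")
            case True
            then have "ls \<noteq> []" by auto
            then show ?thesis using J[OF True len] by simp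
          next
            case False
            then have "length ls < 2" by simp
            then consider "ls = []" | c where "ls = [c]" by (cases ls; cases "tl ls") auto
            then show ?thesis
              using short[OF \<open>length ls < 2\<close>] h0[of i j] h1[of _ i j] by cases (auto simp: h_def)
          qed
          then show ?thesis using Jet pds_power_metric[of ls \<eta> M k a b t i j] by simp
        qed
      qed
      also have "\<dots> = 0" using val_zero[OF w, of a b t] by (simp add: val_def)
      finally show ?thesis .
    qed
  qed
  ultimately show ?thesis by auto
qed

theorem theorem9p2:
  fixes p q :: nat
  assumes "CARD('n::finite) \<ge> 3" and "p + q = CARD('n)"
  shows "(\<forall>(w::real) (P :: 'n jet_var polynomial).
            scalar_conformal_invariant p q w P \<and> odd_scalar_invariant p q P \<and> - w < real CARD('n) \<longrightarrow>
            (\<forall>U g. metric_on p q U g \<longrightarrow> (\<forall>x\<in>U. inv_value P g x = 0))) \<and>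
         (\<forall>(w::int) (C :: (real \<times> contraction) list) (e :: 'n list).
            coordinate_order e \<and> weyl_invariant CARD('n) w C \<and> odd_weyl p q e C \<and>
            - w < int CARD('n) + 1 \<longrightarrow>
            (\<forall>U g W G. metric_on p q U g \<longrightarrow> straight_ambient_metric p q U g W G \<longrightarrow>
               (\<forall>x\<in>U. weyl_value e C G x = 0)))"
proof (intro conjI allI impI ballI; elim conjE)
  fix w :: real and P :: "'n jet_var polynomial" and U :: "(real^'n) set" and g x
  assume "metric_on p q U g" "x \<in> U" "scalar_conformal_invariant p q w P" "odd_scalar_invariant p q P"
    "- w < real CARD('n)"
  then show "inv_value P g x = 0" by (intro odd_scalar_conformal_invariant_vanishes)
next
  fix w :: int and C :: "(real \<times> contraction) list" and e :: "'n list" and U :: "(real^'n) set" and g W G x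
  assume "metric_on p q U g" "straight_ambient_metric p q U g W G" "x \<in> U" "coordinate_order e"
    "weyl_invariant CARD('n) w C" "odd_weyl p q e C" "- w < int CARD('n) + 1"
  then show "weyl_value e C G x = 0" by (intro odd_weyl_invariant_vanishes)
qed

end
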